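(* Let $\mathscr G$ be an ample groupoid and $K$ a commutative ring with unit. Suppose that there is a set $\{\mathcal O_a\mid a\in A\}$ of orbits of $\mathscr G$, each of which is closed in $\mathscr G^{(0)}$ and discrete in the subspace topology, such that $\bigcup_{a\in A}\mathcal O_a$ is $K$-dense and such that the group algebra $KG$ is stably finite for each isotropy group $G$ of an element of an orbit $\mathcal O_a$ with $a\in A$. Then $K\mathscr G$ is stably finite. In particular, given such a set of closed discrete orbits with $K$-dense union, if $K$ is an integral domain of characteristic $0$, or if the isotropy groups of the elements of the orbits $\mathcal O_a$ are sofic, then $K\mathscr G$ is stably finite.
   Context: Rings are not assumed unital. A ring $R$ is Dedekind finite if for every idempotent $e\in R$ and all $u,v\in eRe$, $uv=e$ implies $vu=e$; $R$ is stably finite if $M_n(R)$ is Dedekind finite for all $n\geq 1$. A groupoid $\mathscr G$ is identified with its set of arrows, objects being identified with identity arrows; $\mathscr G^{(0)}$ is the unit space, $\boldsymbol d(\gamma)=\gamma^{-1}\gamma$, $\boldsymbol r(\gamma)=\gamma\gamma^{-1}$. A topological groupoid is étale if $\boldsymbol d$ is a local homeomorphism. An ample groupoid is an étale groupoid whose unit space is Hausdorff with a basis of compact open sets ($\mathscr G$ itself need not be Hausdorff). A bisection is an open subset $U\subseteq\mathscr G$ on which $\boldsymbol d$ and $\boldsymbol r$ are injective (hence homeomorphisms onto their images); $\Gamma_c(\mathscr G)$ is the set of compact open bisections. $K\mathscr G$ is the $K$-span, inside the functions $\mathscr G\to K$, of the indicator functions $1_U$ with $U\in\Gamma_c(\mathscr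 G)$, with convolution product $(f\ast g)(\gamma)=\sum_{\alpha\beta=\gamma}f(\alpha)g(\beta)$. The orbit of $x\in\mathscr G^{(0)}$ is the set of $y\in \mathscr G^{(0)}$ for which there is an arrow $x\to y$; the isotropy group at $x$ is the (discrete) group of all arrows $x\to x$. For $f\in K\mathscr G$, $\mathrm{supp}(f)=\{\gamma\in\mathscr G\mid f(\gamma)\neq 0\}$. A subset $X\subseteq\mathscr G^{(0)}$ is $K$-dense if $X\cap\boldsymbol r(\mathrm{supp}(f))\neq\emptyset$ for every $0\neq f\in K\mathscr G$. A group $G$ is sofic if for every finite $F\subseteq G$ and $\varepsilon>0$ there are $n\ge 1$ and a map $\sigma\colon G\to \mathrm{Sym}(n)$ such that for all $g,h\in F$, $\sigma(g)\sigma(h)$ and $\sigma(gh)$ agree on at least $(1-\varepsilon)n$ points, and for all $1\ne g\in F$, $\sigma(g)$ has at most $\varepsilon n$ fixed points. *)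

theory Defs
  imports
    "HOL-Analysis.Product_Topology"
    "HOL-Algebra.Sym_Groups"
    "HOL-Algebra.Ring"
begin

section \<open>Dedekind finite and stably finite rings, possibly without unit\<close>

text \<open>
  Rings without unit are represented by the record type of HOL-Algebra, whose field \<^term>\<open>one\<close> is
  then meaningless. Dedekind and stable finiteness depend only on the carrier, the multiplication
  and the addition.
\<close>

definition corner :: "('a, 'm) ring_scheme \<Rightarrow> 'a \<Rightarrow> 'a set"
  where "corner R e = {e \<otimes>\<^bsub>R\<^esub> x \<otimes>\<^bsub>R\<^esub> e | x. x \<in> carrier R}"

definition dedekind_finite :: "('a, 'm) ring_scheme \<Rightarrow> bool"
  where "dedekind_finite R \<longleftrightarrow>
    (\<forall>e \<in> carrier R. e \<otimes>\<^bsub>R\<^esub> e = e \<longrightarrow>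
      (\<forall>u \<in> corner R e. \<forall>v \<in> corner R e. u \<otimes>\<^bsub>R\<^esub> v = e \<longrightarrow> v \<otimes>\<^bsub>R\<^esub> u = e))"

definition matrix_ring :: "nat \<Rightarrow> ('a, 'm) ring_scheme \<Rightarrow> (nat \<times> nat \<Rightarrow> 'a) ring"
  where "matrix_ring n R = \<lparr>
    carrier = {..<n} \<times> {..<n} \<rightarrow>\<^sub>E carrier R,
    monoid.mult = (\<lambda>A B. \<lambda>(i, j) \<in> {..<n} \<times> {..<n}. \<Oplus>\<^bsub>R\<^esub>k \<in> {..<n}. A (i, k) \<otimes>\<^bsub>R\<^esub> B (k, j)),
    one = (\<lambda>(i, j) \<in> {..<n} \<times> {..<n}. if i = j then \<one>\<^bsub>R\<^esub> else \<zero>\<^bsub>R\<^esub>),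
    zero = (\<lambda>_ \<in> {..<n} \<times> {..<n}. \<zero>\<^bsub>R\<^esub>),
    add = (\<lambda>A B. \<lambda>p \<in> {..<n} \<times> {..<n}. A p \<oplus>\<^bsub>R\<^esub> B p)\<rparr>"

definition stably_finite :: "('a, 'm) ring_scheme \<Rightarrow> bool"
  where "stably_finite R \<longleftrightarrow> (\<forall>n \<ge> 1. dedekind_finite (matrix_ring n R))"

definition char_zero :: "('a, 'm) ring_scheme \<Rightarrow> bool"
  where "char_zero R \<longleftrightarrow> (\<forall>n :: nat. n > 0 \<longrightarrow> [n] \<cdot>\<^bsub>R\<^esub> \<one>\<^bsub>R\<^esub> \<noteq> \<zero>\<^bsub>R\<^esub>)"


section \<open>Groupoids\<close>

text \<open>
  A groupoid is identified with its set of arrows. The operation \<^term>\<open>comp\<close> is a total function in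
  HOL; its values are only relevant on composable pairs. The product of arrows \<open>a\<close> and \<open>b\<close> is defined
  when the domain of \<open>a\<close> is the range of \<open>b\<close>.
\<close>

record 'a groupoid = "'a partial_object" +
  comp :: "'a \<Rightarrow> 'a \<Rightarrow> 'a" (infixl \<open>\<odot>\<index>\<close> 70)
  ginv :: "'a \<Rightarrow> 'a"

definition dom_of :: "('a, 'm) groupoid_scheme \<Rightarrow> 'a \<Rightarrow> 'a"
  where "dom_of G a = ginv G a \<odot>\<^bsub>G\<^esub> a"

definition ran_of :: "('a, 'm) groupoid_scheme \<Rightarrow> 'a \<Rightarrow> 'a"
  where "ran_of G a = a \<odot>\<^bsub>G\<^esub> ginv G a"

definition composable :: "('a, 'm) groupoid_scheme \<Rightarrow> ('a \<times> 'a) set"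
  where "composable G = {(a, b). a \<in> carrier G \<and> b \<in> carrier G \<and> dom_of G a = ran_of G b}"

definition unit_space :: "('a, 'm) groupoid_scheme \<Rightarrow> 'a set"
  where "unit_space G = dom_of G ` carrier G"

locale groupoid =
  fixes G (structure)
  assumes comp_closed: "(a, b) \<in> composable G \<Longrightarrow> a \<odot> b \<in> carrier G"
    and dom_comp: "(a, b) \<in> composable G \<Longrightarrow> dom_of G (a \<odot> b) = dom_of G b"
    and ran_comp: "(a, b) \<in> composable G \<Longrightarrow> ran_of G (a \<odot> b) = ran_of G a"
    and comp_assoc:
      "(a, b) \<in> composable G \<Longrightarrow> (b, c) \<in> composable G \<Longrightarrow> a \<odot> b \<odot> c = a \<odot> (b \<odot> c)"
    and comp_dom: "a \<in> carrier G \<Longrightarrow> a \<odot> dom_of G a = a"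
    and ran_comp_self: "a \<in> carrier G \<Longrightarrow> ran_of G a \<odot> a = a"
    and ginv_closed: "a \<in> carrier G \<Longrightarrow> ginv G a \<in> carrier G"
    and ginv_ginv: "a \<in> carrier G \<Longrightarrow> ginv G (ginv G a) = a"

definition orbit_of :: "('a, 'm) groupoid_scheme \<Rightarrow> 'a \<Rightarrow> 'a set"
  where "orbit_of G x = {y \<in> unit_space G. \<exists>a \<in> carrier G. dom_of G a = x \<and> ran_of G a = y}"

definition orbits :: "('a, 'm) groupoid_scheme \<Rightarrow> 'a set set"
  where "orbits G = orbit_of G ` unit_space G"

definition isotropy_group :: "('a, 'm) groupoid_scheme \<Rightarrow> 'a \<Rightarrow> 'a monoid"
  where "isotropy_group G x = \<lparr>
    carrier = {a \<in> carrier G. dom_of G a = x \<and> ran_of G a = x},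
    monoid.mult = comp G,
    one = x\<rparr>"


section \<open>Ample groupoids\<close>

locale topological_groupoid = groupoid G
  for G :: "('a, 'm) groupoid_scheme" (structure) and T :: "'a topology" +
  assumes topspace_eq: "topspace T = carrier G"
    and continuous_comp:
      "continuous_map (subtopology (prod_topology T T) (composable G)) T (\<lambda>(a, b). a \<odot> b)"
    and continuous_ginv: "continuous_map T T (ginv G)"

definition unit_topology :: "('a, 'm) groupoid_scheme \<Rightarrow> 'a topology \<Rightarrow> 'a topology"
  where "unit_topology G T = subtopology T (unit_space G)"

definition local_homeomorphism :: "'a topology \<Rightarrow> 'b topology \<Rightarrow> ('a \<Rightarrow> 'b) \<Rightarrow> bool"
  where "local_homeomorphism X Y f \<longleftrightarrow>
    (\<forall>x \<in> topspace X. \<exists>U. openin X U \<and> x \<in> U \<and> openin Y (f ` U) \<and>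
      homeomorphic_map (subtopology X U) (subtopology Y (f ` U)) f)"

locale etale_groupoid = topological_groupoid +
  assumes local_homeomorphism_dom: "local_homeomorphism T (unit_topology G T) (dom_of G)"

locale ample_groupoid = etale_groupoid +
  assumes Hausdorff_units: "Hausdorff_space (unit_topology G T)"
    and compact_open_basis:
      "\<exists>\<B>. (\<forall>B \<in> \<B>. openin (unit_topology G T) B \<and> compactin (unit_topology G T) B) \<and>
        openin (unit_topology G T) = arbitrary union_of (\<lambda>B. B \<in> \<B>)"

definition compact_open_bisections :: "('a, 'm) groupoid_scheme \<Rightarrow> 'a topology \<Rightarrow> 'a set set"
  where "compact_open_bisections G T =
    {U. openin T U \<and> compactin T U \<and> inj_on (dom_of G) U \<and> inj_on (ran_of G) U}"


section \<open>Groupoid algebras and group algebras\<close>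

text \<open>
  Functions on the arrows (or on the elements of a group) are extensional. In both convolution
  products the sum is restricted to the terms with nonzero factors, because \<^term>\<open>finsum\<close> over an
  infinite index set is zero by convention; for elements of the algebra only finitely many such
  terms occur.
\<close>

definition ring_indicator :: "('k, 'm) ring_scheme \<Rightarrow> 'a set \<Rightarrow> 'a \<Rightarrow> 'k"
  where "ring_indicator K U a = (if a \<in> U then \<one>\<^bsub>K\<^esub> else \<zero>\<^bsub>K\<^esub>)"

text \<open>
  The groupoid algebra is unital only if the unit space is compact, in which case the field
  \<^term>\<open>one\<close> below is its unit.
\<close>

definition groupoid_algebra ::
    "('k, 'm) ring_scheme \<Rightarrow> ('a, 'n) groupoid_scheme \<Rightarrow> 'a topology \<Rightarrow> ('a \<Rightarrow> 'k) ring"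
  where "groupoid_algebra K G T = \<lparr>
    carrier = {(\<lambda>a \<in> carrier G. \<Oplus>\<^bsub>K\<^esub>U \<in> F. c U \<otimes>\<^bsub>K\<^esub> ring_indicator K U a) | F c.
      finite F \<and> F \<subseteq> compact_open_bisections G T \<and> c \<in> F \<rightarrow> carrier K},
    monoid.mult = (\<lambda>f g. \<lambda>x \<in> carrier G.
      \<Oplus>\<^bsub>K\<^esub>p \<in> {(a, b) \<in> composable G. a \<odot>\<^bsub>G\<^esub> b = x \<and> f a \<noteq> \<zero>\<^bsub>K\<^esub> \<and> g b \<noteq> \<zero>\<^bsub>K\<^esub>}.
        f (fst p) \<otimes>\<^bsub>K\<^esub> g (snd p)),
    one = (\<lambda>a \<in> carrier G. ring_indicator K (unit_space G) a),
    zero = (\<lambda>_ \<in> carrier G. \<zero>\<^bsub>K\<^esub>),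
    add = (\<lambda>f g. \<lambda>a \<in> carrier G. f a \<oplus>\<^bsub>K\<^esub> g a)\<rparr>"

definition group_algebra ::
    "('k, 'm) ring_scheme \<Rightarrow> ('g, 'n) monoid_scheme \<Rightarrow> ('g \<Rightarrow> 'k) ring"
  where "group_algebra K H = \<lparr>
    carrier = {f \<in> carrier H \<rightarrow>\<^sub>E carrier K. finite {g \<in> carrier H. f g \<noteq> \<zero>\<^bsub>K\<^esub>}},
    monoid.mult = (\<lambda>f g. \<lambda>x \<in> carrier H.
      \<Oplus>\<^bsub>K\<^esub>p \<in> {(a, b) \<in> carrier H \<times> carrier H.
          a \<otimes>\<^bsub>H\<^esub> b = x \<and> f a \<noteq> \<zero>\<^bsub>K\<^esub> \<and> g b \<noteq> \<zero>\<^bsub>K\<^esub>}.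
        f (fst p) \<otimes>\<^bsub>K\<^esub> g (snd p)),
    one = (\<lambda>a \<in> carrier H. ring_indicator K {\<one>\<^bsub>H\<^esub>} a),
    zero = (\<lambda>_ \<in> carrier H. \<zero>\<^bsub>K\<^esub>),
    add = (\<lambda>f g. \<lambda>a \<in> carrier H. f a \<oplus>\<^bsub>K\<^esub> g a)\<rparr>"

definition support :: "('k, 'm) ring_scheme \<Rightarrow> ('a, 'n) groupoid_scheme \<Rightarrow> ('a \<Rightarrow> 'k) \<Rightarrow> 'a set"
  where "support K G f = {a \<in> carrier G. f a \<noteq> \<zero>\<^bsub>K\<^esub>}"

definition K_dense ::
    "('k, 'm) ring_scheme \<Rightarrow> ('a, 'n) groupoid_scheme \<Rightarrow> 'a topology \<Rightarrow> 'a set \<Rightarrow> bool"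
  where "K_dense K G T X \<longleftrightarrow> X \<subseteq> unit_space G \<and>
    (\<forall>f \<in> carrier (groupoid_algebra K G T).
      f \<noteq> \<zero>\<^bsub>groupoid_algebra K G T\<^esub> \<longrightarrow> X \<inter> ran_of G ` support K G f \<noteq> {})"


section \<open>Sofic groups\<close>

definition sofic :: "('g, 'n) monoid_scheme \<Rightarrow> bool"
  where "sofic H \<longleftrightarrow> group H \<and>
    (\<forall>F \<epsilon>. F \<subseteq> carrier H \<and> finite F \<and> (\<epsilon> :: real) > 0 \<longrightarrow>
      (\<exists>n \<ge> 1. \<exists>\<sigma> \<in> carrier H \<rightarrow> carrier (sym_group n).
        (\<forall>g \<in> F. \<forall>h \<in> F.
          real (card {i \<in> {1..n}. (\<sigma> g \<otimes>\<^bsub>sym_group n\<^esub> \<sigma> h) i = \<sigma> (g \<otimes>\<^bsub>H\<^esub> h) i})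
            \<ge> (1 - \<epsilon>) * real n) \<and>
        (\<forall>g \<in> F - {\<one>\<^bsub>H\<^esub>}. real (card {i \<in> {1..n}. \<sigma> g i = i}) \<le> \<epsilon> * real n)))"

end

theory Submission
  imports
    Defs
    "HOL-Algebra.Ring_Divisibility"
    "HOL-Algebra.Subrings"
    "HOL-Analysis.Abstract_Topological_Spaces"
    "HOL-Analysis.L2_Norm"
    "HOL-Computational_Algebra.Fundamental_Theorem_Algebra"
begin

text \<open>
  Restricting functions to the arrows over a closed discrete orbit turns a matrix over the groupoid
  algebra into a finite matrix over the group algebra of an isotropy group, because a compact set
  meets the orbit in finitely many points. The restriction is multiplicative, and by \<open>K\<close>-density an
  element that restricts to zero on every orbit of the family vanishes; so a relation \<open>v u = e\<close> can be
  checked over the group algebras.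

  For a sofic group, a finite approximation by permutations represents matrices over the group algebra
  by large matrices over \<open>K\<close>, and a count of linearly independent columns modulo a prime ideal shows
  that one-sided inverses are two-sided. For a domain of characteristic zero, a homomorphism from the
  ring generated by the finitely many coefficients involved to the complex numbers reduces the claim to
  Kaplansky's theorem that an idempotent complex matrix over a group algebra of trace zero is zero.
\<close>

section \<open>Finite sums\<close>

text \<open>\<open>KG\<close> may lack a unit, so the corner relations cannot be reduced to e = 1
  there and are carried through the restriction. Restricting to a finite set F of points of an orbit
  respects a product AB when every arrow in the support of A with range in F also has its domain in
  F. Hence F is built from the finitely many matrices that occur as left factors. The isotropy group
  algebras do have units, and there the question becomes whether the idempotent 1 - vu vanishes.

  In the sofic case K may have zero divisors, so columns are counted modulo a prime ideal. A
  suitable prime exists because the coefficients of a nonzero idempotent matrix cannot lie in every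
  prime.

  In the other case K may be too large to embed in the complex numbers. A homomorphism that keeps
  one chosen nonzero coefficient of the idempotent nonzero is enough, but to build it one generator
  at a time, every nonzero element of the smaller ring must be separable from zero. In Kaplansky's
  theorem the orthogonal projection need not have finite support; finitely supported approximations
  with error \<epsilon> replace it, and \<epsilon> tends to zero only at the end.\<close>

context abelian_monoid
begin

lemma finsum_Sigma:
  assumes "finite A" "\<And>x. x \<in> A \<Longrightarrow> finite (B x)"
    and "\<And>x y. x \<in> A \<Longrightarrow> y \<in> B x \<Longrightarrow> f x y \<in> carrier G"
  shows "(\<Oplus>x\<in>A. \<Oplus>y\<in>B x. f x y) = (\<Oplus>p\<in>Sigma A B. f (fst p) (snd p))"
  using assms
proof (induction A rule: finite_induct)
  case empty
  then show ?case by simp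
next
  case (insert a A)
  have eq: "Sigma (insert a A) B = Pair a ` B a \<union> Sigma A B" by auto
  have inner: "(\<Oplus>p\<in>Pair a ` B a. f (fst p) (snd p)) = (\<Oplus>y\<in>B a. f a y)"
    using insert.prems by (subst finsum_reindex) (auto simp: inj_on_def)
  have "(\<Oplus>p\<in>Sigma (insert a A) B. f (fst p) (snd p))
      = (\<Oplus>p\<in>Pair a ` B a. f (fst p) (snd p)) \<oplus> (\<Oplus>p\<in>Sigma A B. f (fst p) (snd p))"
    unfolding eq using insert by (intro finsum_Un_disjoint) auto
  also have "\<dots> = (\<Oplus>y\<in>B a. f a y) \<oplus> (\<Oplus>x\<in>A. \<Oplus>y\<in>B x. f x y)"
    using insert inner by simp
  also have "\<dots> = (\<Oplus>x\<in>insert a A. \<Oplus>y\<in>B x. f x y)"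
    using insert by (subst finsum_insert) (auto intro!: finsum_closed)
  finally show ?case ..
qed

lemma finsum_bij:
  assumes "bij_betw h A B" and "\<And>x. x \<in> A \<Longrightarrow> f x = g (h x)"
    and "\<And>y. y \<in> B \<Longrightarrow> g y \<in> carrier G"
  shows "(\<Oplus>x\<in>A. f x) = (\<Oplus>y\<in>B. g y)"
proof -
  have B: "B = h ` A" and inj: "inj_on h A"
    using assms(1) by (auto simp: bij_betw_def)
  have "(\<Oplus>y\<in>B. g y) = (\<Oplus>x\<in>A. g (h x))"
    unfolding B using assms(3) inj B by (intro finsum_reindex) auto
  also have "\<dots> = (\<Oplus>x\<in>A. f x)"
    using assms B by (intro finsum_cong') auto
  finally show ?thesis ..
qed

lemma finsum_swap:
  assumes "finite A" "finite B"
    and "\<And>x y. x \<in> A \<Longrightarrow> y \<in> B \<Longrightarrow> f x y \<in> carrier G"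
  shows "(\<Oplus>x\<in>A. \<Oplus>y\<in>B. f x y) = (\<Oplus>y\<in>B. \<Oplus>x\<in>A. f x y)"
proof -
  have "(\<Oplus>x\<in>A. \<Oplus>y\<in>B. f x y) = (\<Oplus>p\<in>A \<times> B. f (fst p) (snd p))"
    using assms by (intro finsum_Sigma) auto
  also have "\<dots> = (\<Oplus>p\<in>B \<times> A. f (snd p) (fst p))"
    by (rule finsum_bij[where h = prod.swap]) (use assms in \<open>auto simp: bij_betw_def inj_on_def\<close>)
  also have "\<dots> = (\<Oplus>y\<in>B. \<Oplus>x\<in>A. f x y)"
    using assms by (intro finsum_Sigma[symmetric]) auto
  finally show ?thesis .
qed

text \<open>Convolutions are defined with an index set that depends on both factors; this moves such
  a sum to one finite set fixed in advance.\<close>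

lemma finsum_mono_neutral:
  assumes "finite B" "A \<subseteq> B" "\<And>x. x \<in> B - A \<Longrightarrow> f x = \<zero>"
    and "\<And>x. x \<in> A \<Longrightarrow> f x \<in> carrier G"
  shows "(\<Oplus>x\<in>A. f x) = (\<Oplus>x\<in>B. f x)"
proof (rule add.finprod_mono_neutral_cong_left)
  show "f \<in> B \<rightarrow> carrier G"
  proof
    fix x assume "x \<in> B"
    then show "f x \<in> carrier G" using assms(3)[of x] assms(4)[of x] by (cases "x \<in> A") auto
  qed
qed (use assms in auto)

lemma finsum_delta:
  assumes "finite A" "a \<in> A" "f a \<in> carrier G"
  shows "(\<Oplus>x\<in>A. if x = a then f x else \<zero>) = f a"
proof -
  have "(\<Oplus>x\<in>A. if x = a then f x else \<zero>) = (\<Oplus>x\<in>{a}. if x = a then f x else \<zero>)"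
    using assms by (intro finsum_mono_neutral[symmetric]) auto
  then show ?thesis using assms by simp
qed

end

section \<open>Matrix rings\<close>

lemma matrix_ring_carrier:
  "carrier (matrix_ring n R) = {..<n} \<times> {..<n} \<rightarrow>\<^sub>E carrier R"
  by (simp add: matrix_ring_def)

lemma matrix_ring_entry:
  "A \<in> carrier (matrix_ring n R) \<Longrightarrow> i < n \<Longrightarrow> j < n \<Longrightarrow> A (i, j) \<in> carrier R"
  by (auto simp: matrix_ring_carrier)

lemma matrix_ring_mult:
  "i < n \<Longrightarrow> j < n \<Longrightarrow>
    (A \<otimes>\<^bsub>matrix_ring n R\<^esub> B) (i, j) = (\<Oplus>\<^bsub>R\<^esub>k\<in>{..<n}. A (i, k) \<otimes>\<^bsub>R\<^esub> B (k, j))"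
  by (simp add: matrix_ring_def)

lemma matrix_ring_add:
  "i < n \<Longrightarrow> j < n \<Longrightarrow> (A \<oplus>\<^bsub>matrix_ring n R\<^esub> B) (i, j) = A (i, j) \<oplus>\<^bsub>R\<^esub> B (i, j)"
  by (simp add: matrix_ring_def)

lemma matrix_ring_one:
  "i < n \<Longrightarrow> j < n \<Longrightarrow> \<one>\<^bsub>matrix_ring n R\<^esub> (i, j) = (if i = j then \<one>\<^bsub>R\<^esub> else \<zero>\<^bsub>R\<^esub>)"
  by (simp add: matrix_ring_def)

lemma matrix_ring_zero:
  "i < n \<Longrightarrow> j < n \<Longrightarrow> \<zero>\<^bsub>matrix_ring n R\<^esub> (i, j) = \<zero>\<^bsub>R\<^esub>"
  by (simp add: matrix_ring_def)

lemma matrix_ring_eqI: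
  assumes "A \<in> carrier (matrix_ring n R)" "B \<in> carrier (matrix_ring n R)"
    and "\<And>i j. i < n \<Longrightarrow> j < n \<Longrightarrow> A (i, j) = B (i, j)"
  shows "A = B"
  using assms(1,2) unfolding matrix_ring_carrier
  by (rule PiE_ext) (use assms(3) in auto)

lemmas matrix_ring_entries = matrix_ring_mult matrix_ring_add matrix_ring_one matrix_ring_zero

lemma (in ring) ring_matrix_ring: "ring (matrix_ring n R)"
proof -
  let ?M = "matrix_ring n R"
  have add_closed: "A \<oplus>\<^bsub>?M\<^esub> B \<in> carrier ?M"
    if "A \<in> carrier ?M" "B \<in> carrier ?M" for A B
    using that by (auto simp: matrix_ring_def PiE_iff)
  have mult_closed: "A \<otimes>\<^bsub>?M\<^esub> B \<in> carrier ?M"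
    if "A \<in> carrier ?M" "B \<in> carrier ?M" for A B
    using that by (auto simp: matrix_ring_def PiE_iff intro!: finsum_closed)
  have zero_closed: "\<zero>\<^bsub>?M\<^esub> \<in> carrier ?M" and one_closed: "\<one>\<^bsub>?M\<^esub> \<in> carrier ?M"
    by (auto simp: matrix_ring_def PiE_iff)
  note entry = matrix_ring_entry[where R = R and n = n]
  show ?thesis
  proof (rule ringI)
    show "abelian_group ?M"
    proof (rule abelian_groupI)
      fix A assume A: "A \<in> carrier ?M"
      let ?B = "\<lambda>p\<in>{..<n} \<times> {..<n}. \<ominus> A p"
      have B: "?B \<in> carrier ?M" using A by (auto simp: matrix_ring_carrier PiE_iff)
      have "?B \<oplus>\<^bsub>?M\<^esub> A = \<zero>\<^bsub>?M\<^esub>"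
        using A B entry[OF A]
        by (intro matrix_ring_eqI[where n = n and R = R])
          (auto simp: matrix_ring_entries l_neg intro!: add_closed zero_closed)
      then show "\<exists>B\<in>carrier ?M. B \<oplus>\<^bsub>?M\<^esub> A = \<zero>\<^bsub>?M\<^esub>" using B by blast
    next
      fix A B C assume A: "A \<in> carrier ?M" and B: "B \<in> carrier ?M" and C: "C \<in> carrier ?M"
      show "A \<oplus>\<^bsub>?M\<^esub> B \<oplus>\<^bsub>?M\<^esub> C = A \<oplus>\<^bsub>?M\<^esub> (B \<oplus>\<^bsub>?M\<^esub> C)"
        using A B C entry[OF A] entry[OF B] entry[OF C]
        by (intro matrix_ring_eqI[where n = n and R = R] add_closed)
          (simp_all add: matrix_ring_add a_assoc)
      show "A \<oplus>\<^bsub>?M\<^esub> B = B \<oplus>\<^bsub>?M\<^esub> A"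
        using A B entry[OF A] entry[OF B]
        by (intro matrix_ring_eqI[where n = n and R = R] add_closed)
          (simp_all add: matrix_ring_add a_comm)
    qed (auto intro!: add_closed zero_closed matrix_ring_eqI[where n = n and R = R]
          simp: matrix_ring_add matrix_ring_zero entry)
    show "monoid ?M"
    proof (rule monoidI)
      fix A B C assume A: "A \<in> carrier ?M" and B: "B \<in> carrier ?M" and C: "C \<in> carrier ?M"
      show "A \<otimes>\<^bsub>?M\<^esub> B \<otimes>\<^bsub>?M\<^esub> C = A \<otimes>\<^bsub>?M\<^esub> (B \<otimes>\<^bsub>?M\<^esub> C)"
      proof (rule matrix_ring_eqI[where n = n and R = R])
        fix i j assume ij: "i < n" "j < n"
        have "(A \<otimes>\<^bsub>?M\<^esub> B \<otimes>\<^bsub>?M\<^esub> C) (i, j)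
            = (\<Oplus>k\<in>{..<n}. \<Oplus>l\<in>{..<n}. A (i, l) \<otimes> B (l, k) \<otimes> C (k, j))"
          using ij entry[OF A] entry[OF B] entry[OF C]
          by (auto simp: matrix_ring_mult finsum_ldistr Pi_def intro!: finsum_cong')
        also have "\<dots> = (\<Oplus>l\<in>{..<n}. \<Oplus>k\<in>{..<n}. A (i, l) \<otimes> B (l, k) \<otimes> C (k, j))"
          using ij entry[OF A] entry[OF B] entry[OF C] by (intro finsum_swap) auto
        also have "\<dots> = (A \<otimes>\<^bsub>?M\<^esub> (B \<otimes>\<^bsub>?M\<^esub> C)) (i, j)"
          using ij entry[OF A] entry[OF B] entry[OF C]
          by (auto simp: matrix_ring_mult finsum_rdistr Pi_def m_assoc intro!: finsum_cong')
        finally show "(A \<otimes>\<^bsub>?M\<^esub> B \<otimes>\<^bsub>?M\<^esub> C) (i, j) = (A \<otimes>\<^bsub>?M\<^esub> (B \<otimes>\<^bsub>?M\<^esub> C)) (i, j)" .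
      qed (use A B C in \<open>auto intro!: mult_closed\<close>)
    next
      fix A assume A: "A \<in> carrier ?M"
      show "\<one>\<^bsub>?M\<^esub> \<otimes>\<^bsub>?M\<^esub> A = A"
      proof (rule matrix_ring_eqI[where n = n and R = R])
        fix i j assume ij: "i < n" "j < n"
        have "(\<one>\<^bsub>?M\<^esub> \<otimes>\<^bsub>?M\<^esub> A) (i, j) = (\<Oplus>k\<in>{..<n}. if k = i then A (k, j) else \<zero>)"
          using ij entry[OF A] by (auto simp: matrix_ring_mult matrix_ring_one intro!: finsum_cong')
        then show "(\<one>\<^bsub>?M\<^esub> \<otimes>\<^bsub>?M\<^esub> A) (i, j) = A (i, j)"
          using ij entry[OF A] by (simp add: finsum_delta)
      qed (use A in \<open>auto intro!: mult_closed one_closed\<close>)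
      show "A \<otimes>\<^bsub>?M\<^esub> \<one>\<^bsub>?M\<^esub> = A"
      proof (rule matrix_ring_eqI[where n = n and R = R])
        fix i j assume ij: "i < n" "j < n"
        have "(A \<otimes>\<^bsub>?M\<^esub> \<one>\<^bsub>?M\<^esub>) (i, j) = (\<Oplus>k\<in>{..<n}. if k = j then A (i, k) else \<zero>)"
          using ij entry[OF A] by (auto simp: matrix_ring_mult matrix_ring_one intro!: finsum_cong')
        then show "(A \<otimes>\<^bsub>?M\<^esub> \<one>\<^bsub>?M\<^esub>) (i, j) = A (i, j)"
          using ij entry[OF A] by (simp add: finsum_delta)
      qed (use A in \<open>auto intro!: mult_closed one_closed\<close>)
    qed (auto intro!: mult_closed one_closed)
    fix A B C assume A: "A \<in> carrier ?M" and B: "B \<in> carrier ?M" and C: "C \<in> carrier ?M"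
    note e = entry[OF A] entry[OF B] entry[OF C]
    show "(A \<oplus>\<^bsub>?M\<^esub> B) \<otimes>\<^bsub>?M\<^esub> C = A \<otimes>\<^bsub>?M\<^esub> C \<oplus>\<^bsub>?M\<^esub> B \<otimes>\<^bsub>?M\<^esub> C"
    proof (rule matrix_ring_eqI[where n = n and R = R])
      fix i j assume ij: "i < n" "j < n"
      have "((A \<oplus>\<^bsub>?M\<^esub> B) \<otimes>\<^bsub>?M\<^esub> C) (i, j)
          = (\<Oplus>k\<in>{..<n}. A (i, k) \<otimes> C (k, j) \<oplus> B (i, k) \<otimes> C (k, j))"
        unfolding matrix_ring_mult[OF ij] using ij e
        by (intro finsum_cong') (auto simp: matrix_ring_add l_distr)
      also have "\<dots> = (A \<otimes>\<^bsub>?M\<^esub> C \<oplus>\<^bsub>?M\<^esub> B \<otimes>\<^bsub>?M\<^esub> C) (i, j)"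
        unfolding matrix_ring_add[OF ij] matrix_ring_mult[OF ij] using ij e
        by (intro finsum_addf) auto
      finally show "((A \<oplus>\<^bsub>?M\<^esub> B) \<otimes>\<^bsub>?M\<^esub> C) (i, j) = (A \<otimes>\<^bsub>?M\<^esub> C \<oplus>\<^bsub>?M\<^esub> B \<otimes>\<^bsub>?M\<^esub> C) (i, j)" .
    qed (use A B C in \<open>auto intro!: mult_closed add_closed\<close>)
    show "C \<otimes>\<^bsub>?M\<^esub> (A \<oplus>\<^bsub>?M\<^esub> B) = C \<otimes>\<^bsub>?M\<^esub> A \<oplus>\<^bsub>?M\<^esub> C \<otimes>\<^bsub>?M\<^esub> B"
    proof (rule matrix_ring_eqI[where n = n and R = R])
      fix i j assume ij: "i < n" "j < n"
      have "(C \<otimes>\<^bsub>?M\<^esub> (A \<oplus>\<^bsub>?M\<^esub> B)) (i, j)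
          = (\<Oplus>k\<in>{..<n}. C (i, k) \<otimes> A (k, j) \<oplus> C (i, k) \<otimes> B (k, j))"
        unfolding matrix_ring_mult[OF ij] using ij e
        by (intro finsum_cong') (auto simp: matrix_ring_add r_distr)
      also have "\<dots> = (C \<otimes>\<^bsub>?M\<^esub> A \<oplus>\<^bsub>?M\<^esub> C \<otimes>\<^bsub>?M\<^esub> B) (i, j)"
        unfolding matrix_ring_add[OF ij] matrix_ring_mult[OF ij] using ij e
        by (intro finsum_addf) auto
      finally show "(C \<otimes>\<^bsub>?M\<^esub> (A \<oplus>\<^bsub>?M\<^esub> B)) (i, j) = (C \<otimes>\<^bsub>?M\<^esub> A \<oplus>\<^bsub>?M\<^esub> C \<otimes>\<^bsub>?M\<^esub> B) (i, j)" .
    qed (use A B C in \<open>auto intro!: mult_closed add_closed\<close>)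
  qed
qed

section \<open>Group algebras\<close>

locale cring_group = cring K + H: group H for K (structure) and H (structure)
begin

abbreviation "KH \<equiv> group_algebra K H"

lemma group_cancel [simp]:
  assumes "a \<in> carrier H" "b \<in> carrier H"
  shows "inv\<^bsub>H\<^esub> a \<otimes>\<^bsub>H\<^esub> (a \<otimes>\<^bsub>H\<^esub> b) = b" "a \<otimes>\<^bsub>H\<^esub> (inv\<^bsub>H\<^esub> a \<otimes>\<^bsub>H\<^esub> b) = b"
  using assms by (simp_all add: H.m_assoc[symmetric])

lemma group_algebra_carrierD:
  assumes "f \<in> carrier KH"
  shows "a \<in> carrier H \<Longrightarrow> f a \<in> carrier K" and "finite {a \<in> carrier H. f a \<noteq> \<zero>}"
    and "f \<in> extensional (carrier H)"
  using assms by (auto simp: group_algebra_def PiE_iff)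

lemma group_algebra_carrierI:
  assumes "\<And>a. a \<in> carrier H \<Longrightarrow> f a \<in> carrier K" "f \<in> extensional (carrier H)"
    and "finite S" "\<forall>a\<in>carrier H - S. f a = \<zero>"
  shows "f \<in> carrier KH"
proof -
  have "{a \<in> carrier H. f a \<noteq> \<zero>} \<subseteq> S" using assms(4) by blast
  then have "finite {a \<in> carrier H. f a \<noteq> \<zero>}" using assms(3) finite_subset by blast
  then show ?thesis using assms(1,2) by (auto simp: group_algebra_def PiE_iff)
qed

lemma group_algebra_eqI:
  assumes "f \<in> carrier KH" "g \<in> carrier KH" "\<And>a. a \<in> carrier H \<Longrightarrow> f a = g a"
  shows "f = g"
  using assms by (intro extensionalityI[of f "carrier H"]) (auto dest: group_algebra_carrierD(3))

text \<open>A pair (a, b) with ab = x is determined by a, since b = a^-1 x. Any finite S that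
  carries the support of f may be used, so that several products can be given the same index
  set.\<close>

lemma group_algebra_mult:
  assumes "f \<in> carrier KH" "g \<in> carrier KH" "x \<in> carrier H"
    and S: "finite S" "S \<subseteq> carrier H" "\<forall>a\<in>carrier H - S. f a = \<zero>"
  shows "(f \<otimes>\<^bsub>KH\<^esub> g) x = (\<Oplus>a\<in>S. f a \<otimes> g (inv\<^bsub>H\<^esub> a \<otimes>\<^bsub>H\<^esub> x))"
proof -
  note fg = group_algebra_carrierD(1)[OF assms(1)] group_algebra_carrierD(1)[OF assms(2)]
  let ?I = "{(a, b) \<in> carrier H \<times> carrier H. a \<otimes>\<^bsub>H\<^esub> b = x \<and> f a \<noteq> \<zero> \<and> g b \<noteq> \<zero>}"
  let ?J = "{a \<in> S. f a \<noteq> \<zero> \<and> g (inv\<^bsub>H\<^esub> a \<otimes>\<^bsub>H\<^esub> x) \<noteq> \<zero>}"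
  have "bij_betw fst ?I ?J"
  proof (rule bij_betw_byWitness[where f' = "\<lambda>a. (a, inv\<^bsub>H\<^esub> a \<otimes>\<^bsub>H\<^esub> x)"])
    show "fst ` ?I \<subseteq> ?J" using S by auto
    show "(\<lambda>a. (a, inv\<^bsub>H\<^esub> a \<otimes>\<^bsub>H\<^esub> x)) ` ?J \<subseteq> ?I"
      using S assms(3) by auto
  qed (use S assms(3) in auto)
  then have "(\<Oplus>p\<in>?I. f (fst p) \<otimes> g (snd p)) = (\<Oplus>a\<in>?J. f a \<otimes> g (inv\<^bsub>H\<^esub> a \<otimes>\<^bsub>H\<^esub> x))"
    using S assms(3) fg
    by (intro finsum_bij[where h = fst]) (auto simp: subset_iff)
  also have "\<dots> = (\<Oplus>a\<in>S. f a \<otimes> g (inv\<^bsub>H\<^esub> a \<otimes>\<^bsub>H\<^esub> x))"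
    using S assms(3) fg by (intro finsum_mono_neutral) (auto simp: subset_iff)
  finally show ?thesis using assms(3) by (simp add: group_algebra_def)
qed

lemma group_algebra_add:
  "x \<in> carrier H \<Longrightarrow> (f \<oplus>\<^bsub>KH\<^esub> g) x = f x \<oplus> g x"
  by (simp add: group_algebra_def)

lemma group_algebra_zero:
  "x \<in> carrier H \<Longrightarrow> \<zero>\<^bsub>KH\<^esub> x = \<zero>"
  by (simp add: group_algebra_def)

lemma group_algebra_one:
  "x \<in> carrier H \<Longrightarrow> \<one>\<^bsub>KH\<^esub> x = (if x = \<one>\<^bsub>H\<^esub> then \<one> else \<zero>)"
  by (simp add: group_algebra_def ring_indicator_def)

lemma finite_support:
  assumes "f \<in> carrier KH"
  obtains S where "finite S" "S \<subseteq> carrier H" "\<forall>a\<in>carrier H - S. f a = \<zero>"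
  using group_algebra_carrierD(2)[OF assms] by (intro that[of "{a \<in> carrier H. f a \<noteq> \<zero>}"]) auto

lemma group_algebra_mult_support:
  assumes f: "f \<in> carrier KH" and g: "g \<in> carrier KH" and x: "x \<in> carrier H"
    and S: "finite S" "S \<subseteq> carrier H" "\<forall>a\<in>carrier H - S. f a = \<zero>"
    and S': "\<forall>a\<in>carrier H - S'. g a = \<zero>"
    and notin: "x \<notin> (\<lambda>(a, b). a \<otimes>\<^bsub>H\<^esub> b) ` (S \<times> S')"
  shows "(f \<otimes>\<^bsub>KH\<^esub> g) x = \<zero>"
proof -
  have "g (inv\<^bsub>H\<^esub> a \<otimes>\<^bsub>H\<^esub> x) = \<zero>" if "a \<in> S" for a
  proof (rule bspec[OF S'], rule DiffI)
    have "x = a \<otimes>\<^bsub>H\<^esub> (inv\<^bsub>H\<^esub> a \<otimes>\<^bsub>H\<^esub> x)"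
      using that S x by (simp add: subset_iff)
    then show "inv\<^bsub>H\<^esub> a \<otimes>\<^bsub>H\<^esub> x \<notin> S'" using notin that by force
  qed (use that S x in auto)
  moreover have "f a \<in> carrier K" if "a \<in> S" for a
    using group_algebra_carrierD(1)[OF f] that S by auto
  ultimately have "(\<Oplus>a\<in>S. f a \<otimes> g (inv\<^bsub>H\<^esub> a \<otimes>\<^bsub>H\<^esub> x)) = (\<Oplus>a\<in>S. \<zero>)"
    by (intro finsum_cong') auto
  then show ?thesis using group_algebra_mult[OF f g x S] by simp
qed

lemma group_algebra_mult_closed:
  assumes f: "f \<in> carrier KH" and g: "g \<in> carrier KH"
  shows "f \<otimes>\<^bsub>KH\<^esub> g \<in> carrier KH"
proof -
  obtain S where S: "finite S" "S \<subseteq> carrier H" "\<forall>a\<in>carrier H - S. f a = \<zero>"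
    by (rule finite_support[OF f]) blast
  obtain S' where S': "finite S'" "S' \<subseteq> carrier H" "\<forall>a\<in>carrier H - S'. g a = \<zero>"
    by (rule finite_support[OF g]) blast
  show ?thesis
  proof (rule group_algebra_carrierI)
    show "finite ((\<lambda>(a, b). a \<otimes>\<^bsub>H\<^esub> b) ` (S \<times> S'))" using S S' by auto
    show "f \<otimes>\<^bsub>KH\<^esub> g \<in> extensional (carrier H)" by (simp add: group_algebra_def)
    show "(f \<otimes>\<^bsub>KH\<^esub> g) x \<in> carrier K" if "x \<in> carrier H" for x
      unfolding group_algebra_mult[OF f g that S]
      using S group_algebra_carrierD(1)[OF f] group_algebra_carrierD(1)[OF g] that
      by (auto intro!: finsum_closed)
    show "\<forall>x\<in>carrier H - (\<lambda>(a, b). a \<otimes>\<^bsub>H\<^esub> b) ` (S \<times> S'). (f \<otimes>\<^bsub>KH\<^esub> g) x = \<zero>"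
      using group_algebra_mult_support[OF f g _ S S'(3)] by blast
  qed
qed

lemma group_algebra_add_closed:
  assumes f: "f \<in> carrier KH" and g: "g \<in> carrier KH"
  shows "f \<oplus>\<^bsub>KH\<^esub> g \<in> carrier KH"
proof -
  note fg = group_algebra_carrierD[OF f] group_algebra_carrierD[OF g]
  show ?thesis
    by (rule group_algebra_carrierI[where S = "{a \<in> carrier H. f a \<noteq> \<zero>} \<union> {a \<in> carrier H. g a \<noteq> \<zero>}"])
      (use fg in \<open>auto simp: group_algebra_def\<close>)
qed

lemma group_algebra_mult_assoc:
  assumes f: "f \<in> carrier KH" and g: "g \<in> carrier KH" and h: "h \<in> carrier KH"
  shows "f \<otimes>\<^bsub>KH\<^esub> g \<otimes>\<^bsub>KH\<^esub> h = f \<otimes>\<^bsub>KH\<^esub> (g \<otimes>\<^bsub>KH\<^esub> h)"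
proof (rule group_algebra_eqI)
  obtain S where S: "finite S" "S \<subseteq> carrier H" "\<forall>a\<in>carrier H - S. f a = \<zero>"
    by (rule finite_support[OF f]) blast
  obtain S' where S': "finite S'" "S' \<subseteq> carrier H" "\<forall>a\<in>carrier H - S'. g a = \<zero>"
    by (rule finite_support[OF g]) blast
  note fgh = group_algebra_carrierD(1)[OF f] group_algebra_carrierD(1)[OF g] group_algebra_carrierD(1)[OF h]
  let ?P = "(\<lambda>(a, b). a \<otimes>\<^bsub>H\<^esub> b) ` (S \<times> S')"
  have P: "finite ?P" "?P \<subseteq> carrier H" using S S' by auto
  fix x assume x: "x \<in> carrier H"
  have sc: "\<And>a. a \<in> S \<Longrightarrow> a \<in> carrier H" "\<And>a. a \<in> ?P \<Longrightarrow> a \<in> carrier H"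
    "\<And>a. a \<in> S' \<Longrightarrow> a \<in> carrier H" using S P S' by auto
  have "(f \<otimes>\<^bsub>KH\<^esub> g \<otimes>\<^bsub>KH\<^esub> h) x = (\<Oplus>c\<in>?P. (f \<otimes>\<^bsub>KH\<^esub> g) c \<otimes> h (inv\<^bsub>H\<^esub> c \<otimes>\<^bsub>H\<^esub> x))"
    using group_algebra_mult_support[OF f g _ S S'(3)]
    by (intro group_algebra_mult[OF group_algebra_mult_closed[OF f g] h x P]) blast
  also have "\<dots> = (\<Oplus>c\<in>?P. \<Oplus>a\<in>S. f a \<otimes> g (inv\<^bsub>H\<^esub> a \<otimes>\<^bsub>H\<^esub> c) \<otimes> h (inv\<^bsub>H\<^esub> c \<otimes>\<^bsub>H\<^esub> x))"
  proof (rule finsum_cong', goal_cases)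
    case (3 c)
    have c: "c \<in> carrier H" by (rule sc(2)[OF 3])
    show ?case unfolding group_algebra_mult[OF f g c S]
      using S x c fgh sc(1) by (intro finsum_ldistr) auto
  qed (use S S' x fgh in \<open>auto simp: subset_iff intro!: finsum_closed\<close>)
  also have "\<dots> = (\<Oplus>a\<in>S. \<Oplus>c\<in>?P. f a \<otimes> g (inv\<^bsub>H\<^esub> a \<otimes>\<^bsub>H\<^esub> c) \<otimes> h (inv\<^bsub>H\<^esub> c \<otimes>\<^bsub>H\<^esub> x))"
    using S S' P x fgh by (intro finsum_swap) (auto simp: subset_iff)
  also have "\<dots> = (\<Oplus>a\<in>S. f a \<otimes> (g \<otimes>\<^bsub>KH\<^esub> h) (inv\<^bsub>H\<^esub> a \<otimes>\<^bsub>H\<^esub> x))"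
  proof (rule finsum_cong', goal_cases)
    case (3 a)
    have a: "a \<in> carrier H" using sc 3 by auto
    \<comment> \<open>Only those c contribute for which a^-1 c lies in S', that is, c in the
      translate aS'. The substitution c = ab then turns the inner sum into the convolution of g and
      h at a^-1 x.\<close>
    have "(\<Oplus>c\<in>?P. f a \<otimes> g (inv\<^bsub>H\<^esub> a \<otimes>\<^bsub>H\<^esub> c) \<otimes> h (inv\<^bsub>H\<^esub> c \<otimes>\<^bsub>H\<^esub> x))
        = (\<Oplus>c\<in>(\<lambda>b. a \<otimes>\<^bsub>H\<^esub> b) ` S'. f a \<otimes> g (inv\<^bsub>H\<^esub> a \<otimes>\<^bsub>H\<^esub> c) \<otimes> h (inv\<^bsub>H\<^esub> c \<otimes>\<^bsub>H\<^esub> x))"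
    proof (rule finsum_mono_neutral[symmetric])
      show "f a \<otimes> g (inv\<^bsub>H\<^esub> a \<otimes>\<^bsub>H\<^esub> c) \<otimes> h (inv\<^bsub>H\<^esub> c \<otimes>\<^bsub>H\<^esub> x) = \<zero>"
        if "c \<in> ?P - (\<lambda>b. a \<otimes>\<^bsub>H\<^esub> b) ` S'" for c
      proof -
        have c: "c \<in> carrier H" using that sc(2) by blast
        have "c = a \<otimes>\<^bsub>H\<^esub> (inv\<^bsub>H\<^esub> a \<otimes>\<^bsub>H\<^esub> c)" using a c by simp
        then have "inv\<^bsub>H\<^esub> a \<otimes>\<^bsub>H\<^esub> c \<notin> S'" using that by auto
        then have "g (inv\<^bsub>H\<^esub> a \<otimes>\<^bsub>H\<^esub> c) = \<zero>" using S' a c by auto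
        then show ?thesis using a c x fgh by simp
      qed
    qed (use P 3 S' a x fgh in \<open>auto simp: subset_iff\<close>)
    also have "\<dots> = (\<Oplus>b\<in>S'. f a \<otimes> (g b \<otimes> h (inv\<^bsub>H\<^esub> b \<otimes>\<^bsub>H\<^esub> (inv\<^bsub>H\<^esub> a \<otimes>\<^bsub>H\<^esub> x))))"
    proof (rule finsum_bij[symmetric, where h = "\<lambda>b. a \<otimes>\<^bsub>H\<^esub> b"])
      show "bij_betw ((\<otimes>\<^bsub>H\<^esub>) a) S' ((\<otimes>\<^bsub>H\<^esub>) a ` S')"
        using a sc(3) by (auto simp: bij_betw_def inj_on_def)
      fix b assume "b \<in> S'"
      then have b: "b \<in> carrier H" using sc by auto
      show "f a \<otimes> (g b \<otimes> h (inv\<^bsub>H\<^esub> b \<otimes>\<^bsub>H\<^esub> (inv\<^bsub>H\<^esub> a \<otimes>\<^bsub>H\<^esub> x))) =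
        f a \<otimes> g (inv\<^bsub>H\<^esub> a \<otimes>\<^bsub>H\<^esub> (a \<otimes>\<^bsub>H\<^esub> b)) \<otimes> h (inv\<^bsub>H\<^esub> (a \<otimes>\<^bsub>H\<^esub> b) \<otimes>\<^bsub>H\<^esub> x)"
        using a b x fgh by (simp add: H.inv_mult_group H.m_assoc m_assoc)
    qed (use S' a x fgh in \<open>auto simp: subset_iff\<close>)
    also have "\<dots> = f a \<otimes> (\<Oplus>b\<in>S'. g b \<otimes> h (inv\<^bsub>H\<^esub> b \<otimes>\<^bsub>H\<^esub> (inv\<^bsub>H\<^esub> a \<otimes>\<^bsub>H\<^esub> x)))"
      using S' a x fgh by (intro finsum_rdistr[symmetric]) (auto simp: subset_iff)
    also have "\<dots> = f a \<otimes> (g \<otimes>\<^bsub>KH\<^esub> h) (inv\<^bsub>H\<^esub> a \<otimes>\<^bsub>H\<^esub> x)"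
      using a x by (subst group_algebra_mult[OF g h _ S']) auto
    finally show ?case .
  qed (use S x fgh group_algebra_carrierD(1)[OF group_algebra_mult_closed[OF g h]] in \<open>auto simp: subset_iff\<close>)
  also have "\<dots> = (f \<otimes>\<^bsub>KH\<^esub> (g \<otimes>\<^bsub>KH\<^esub> h)) x"
    by (rule group_algebra_mult[OF f group_algebra_mult_closed[OF g h] x S, symmetric])
  finally show "(f \<otimes>\<^bsub>KH\<^esub> g \<otimes>\<^bsub>KH\<^esub> h) x = (f \<otimes>\<^bsub>KH\<^esub> (g \<otimes>\<^bsub>KH\<^esub> h)) x" .
qed (use f g h in \<open>auto intro!: group_algebra_mult_closed\<close>)

lemma ring_group_algebra: "ring KH"
proof (rule ringI)
  note cl = group_algebra_mult_closed group_algebra_add_closed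
  have zero: "\<zero>\<^bsub>KH\<^esub> \<in> carrier KH"
    by (rule group_algebra_carrierI[where S = "{}"]) (auto simp: group_algebra_def)
  have one: "\<one>\<^bsub>KH\<^esub> \<in> carrier KH"
    by (rule group_algebra_carrierI[where S = "{\<one>\<^bsub>H\<^esub>}"]) (auto simp: group_algebra_def ring_indicator_def)
  note val = group_algebra_carrierD(1)
  show "abelian_group KH"
  proof (rule abelian_groupI)
    fix f assume f: "f \<in> carrier KH"
    let ?g = "\<lambda>a\<in>carrier H. \<ominus> f a"
    have g: "?g \<in> carrier KH"
      by (rule group_algebra_carrierI[where S = "{a \<in> carrier H. f a \<noteq> \<zero>}"])
        (use group_algebra_carrierD[OF f] in auto)
    have "?g \<oplus>\<^bsub>KH\<^esub> f = \<zero>\<^bsub>KH\<^esub>"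
      using f g val[OF f] by (intro group_algebra_eqI cl zero) (auto simp: group_algebra_add group_algebra_zero l_neg)
    then show "\<exists>g\<in>carrier KH. g \<oplus>\<^bsub>KH\<^esub> f = \<zero>\<^bsub>KH\<^esub>" using g by blast
  next
    fix f g h assume f: "f \<in> carrier KH" and g: "g \<in> carrier KH" and h: "h \<in> carrier KH"
    show "f \<oplus>\<^bsub>KH\<^esub> g \<oplus>\<^bsub>KH\<^esub> h = f \<oplus>\<^bsub>KH\<^esub> (g \<oplus>\<^bsub>KH\<^esub> h)"
      using f g h val[OF f] val[OF g] val[OF h]
      by (intro group_algebra_eqI cl) (simp_all add: group_algebra_add a_assoc)
    show "f \<oplus>\<^bsub>KH\<^esub> g = g \<oplus>\<^bsub>KH\<^esub> f"
      using f g val[OF f] val[OF g]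
      by (intro group_algebra_eqI cl) (simp_all add: group_algebra_add a_comm)
  qed (auto intro!: cl zero group_algebra_eqI simp: group_algebra_add group_algebra_zero val)
  show "monoid KH"
  proof (rule monoidI)
    fix f assume f: "f \<in> carrier KH"
    show "\<one>\<^bsub>KH\<^esub> \<otimes>\<^bsub>KH\<^esub> f = f"
    proof (rule group_algebra_eqI)
      fix x assume x: "x \<in> carrier H"
      have "(\<one>\<^bsub>KH\<^esub> \<otimes>\<^bsub>KH\<^esub> f) x = (\<Oplus>a\<in>{\<one>\<^bsub>H\<^esub>}. \<one>\<^bsub>KH\<^esub> a \<otimes> f (inv\<^bsub>H\<^esub> a \<otimes>\<^bsub>H\<^esub> x))"
        by (rule group_algebra_mult[OF one f x]) (auto simp: group_algebra_one)
      then show "(\<one>\<^bsub>KH\<^esub> \<otimes>\<^bsub>KH\<^esub> f) x = f x" using x val[OF f] by (simp add: group_algebra_one)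
    qed (use f one cl in auto)
    show "f \<otimes>\<^bsub>KH\<^esub> \<one>\<^bsub>KH\<^esub> = f"
    proof (rule group_algebra_eqI)
      obtain S where S: "finite S" "S \<subseteq> carrier H" "\<forall>a\<in>carrier H - S. f a = \<zero>"
        by (rule finite_support[OF f]) blast
      fix x assume x: "x \<in> carrier H"
      \<comment> \<open>x is put into the index set because \<open>finsum_delta\<close> picks out
        the term a = x, which S may miss.\<close>
      have S': "finite (insert x S)" "insert x S \<subseteq> carrier H"
        "\<forall>a\<in>carrier H - insert x S. f a = \<zero>"
        using S x by auto
      have "(f \<otimes>\<^bsub>KH\<^esub> \<one>\<^bsub>KH\<^esub>) x = (\<Oplus>a\<in>insert x S. f a \<otimes> \<one>\<^bsub>KH\<^esub> (inv\<^bsub>H\<^esub> a \<otimes>\<^bsub>H\<^esub> x))"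
        by (rule group_algebra_mult[OF f one x S'])
      also have "\<dots> = (\<Oplus>a\<in>insert x S. if a = x then f a else \<zero>)"
      proof (rule finsum_cong')
        fix a assume "a \<in> insert x S"
        then have a: "a \<in> carrier H" using S' by auto
        have "(inv\<^bsub>H\<^esub> a \<otimes>\<^bsub>H\<^esub> x = \<one>\<^bsub>H\<^esub>) = (a = x)"
          using a x by (metis H.inv_solve_left' H.one_closed H.r_one)
        then show "f a \<otimes> \<one>\<^bsub>KH\<^esub> (inv\<^bsub>H\<^esub> a \<otimes>\<^bsub>H\<^esub> x) = (if a = x then f a else \<zero>)"
          using a x val[OF f] by (auto simp: group_algebra_one)
      qed (use S' x val[OF f] in auto)
      also have "\<dots> = f x" using S' x val[OF f] by (intro finsum_delta) auto
      finally show "(f \<otimes>\<^bsub>KH\<^esub> \<one>\<^bsub>KH\<^esub>) x = f x" .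
    qed (use f one cl in auto)
  qed (auto intro!: cl one group_algebra_mult_assoc)
  fix f g h assume f: "f \<in> carrier KH" and g: "g \<in> carrier KH" and h: "h \<in> carrier KH"
  note fgh = val[OF f] val[OF g] val[OF h]
  show "(f \<oplus>\<^bsub>KH\<^esub> g) \<otimes>\<^bsub>KH\<^esub> h = f \<otimes>\<^bsub>KH\<^esub> h \<oplus>\<^bsub>KH\<^esub> g \<otimes>\<^bsub>KH\<^esub> h"
  proof (rule group_algebra_eqI)
    fix x assume x: "x \<in> carrier H"
    let ?S = "{a \<in> carrier H. f a \<noteq> \<zero>} \<union> {a \<in> carrier H. g a \<noteq> \<zero>}"
    have S: "finite ?S" "?S \<subseteq> carrier H"
      using group_algebra_carrierD(2)[OF f] group_algebra_carrierD(2)[OF g] by auto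
    have eq: "(k \<otimes>\<^bsub>KH\<^esub> h) x = (\<Oplus>a\<in>?S. k a \<otimes> h (inv\<^bsub>H\<^esub> a \<otimes>\<^bsub>H\<^esub> x))"
      if "k \<in> carrier KH" "\<forall>a\<in>carrier H - ?S. k a = \<zero>" for k
      using group_algebra_mult[OF that(1) h x S that(2)] .
    have fg0: "\<forall>a\<in>carrier H - ?S. (f \<oplus>\<^bsub>KH\<^esub> g) a = \<zero>"
      by (auto simp: group_algebra_add)
    have "((f \<oplus>\<^bsub>KH\<^esub> g) \<otimes>\<^bsub>KH\<^esub> h) x
        = (\<Oplus>a\<in>?S. f a \<otimes> h (inv\<^bsub>H\<^esub> a \<otimes>\<^bsub>H\<^esub> x) \<oplus> g a \<otimes> h (inv\<^bsub>H\<^esub> a \<otimes>\<^bsub>H\<^esub> x))"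
      unfolding eq[OF group_algebra_add_closed[OF f g] fg0] using x fgh
      by (intro finsum_cong') (auto simp: group_algebra_add l_distr)
    also have "\<dots> = (f \<otimes>\<^bsub>KH\<^esub> h) x \<oplus> (g \<otimes>\<^bsub>KH\<^esub> h) x"
      using f g x fgh by (subst (1 2) eq) (auto intro!: finsum_addf)
    finally show "((f \<oplus>\<^bsub>KH\<^esub> g) \<otimes>\<^bsub>KH\<^esub> h) x = (f \<otimes>\<^bsub>KH\<^esub> h \<oplus>\<^bsub>KH\<^esub> g \<otimes>\<^bsub>KH\<^esub> h) x"
      using x by (simp add: group_algebra_add)
  qed (use f g h cl in auto)
  show "h \<otimes>\<^bsub>KH\<^esub> (f \<oplus>\<^bsub>KH\<^esub> g) = h \<otimes>\<^bsub>KH\<^esub> f \<oplus>\<^bsub>KH\<^esub> h \<otimes>\<^bsub>KH\<^esub> g"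
  proof (rule group_algebra_eqI)
    fix x assume x: "x \<in> carrier H"
    let ?S = "{a \<in> carrier H. h a \<noteq> \<zero>}"
    have S: "finite ?S" "?S \<subseteq> carrier H"
      using group_algebra_carrierD(2)[OF h] by auto
    have eq: "(h \<otimes>\<^bsub>KH\<^esub> k) x = (\<Oplus>a\<in>?S. h a \<otimes> k (inv\<^bsub>H\<^esub> a \<otimes>\<^bsub>H\<^esub> x))" if "k \<in> carrier KH" for k
      by (rule group_algebra_mult[OF h that x S]) auto
    have "(h \<otimes>\<^bsub>KH\<^esub> (f \<oplus>\<^bsub>KH\<^esub> g)) x
        = (\<Oplus>a\<in>?S. h a \<otimes> f (inv\<^bsub>H\<^esub> a \<otimes>\<^bsub>H\<^esub> x) \<oplus> h a \<otimes> g (inv\<^bsub>H\<^esub> a \<otimes>\<^bsub>H\<^esub> x))"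
      unfolding eq[OF group_algebra_add_closed[OF f g]] using x fgh
      by (intro finsum_cong') (auto simp: group_algebra_add r_distr)
    also have "\<dots> = (h \<otimes>\<^bsub>KH\<^esub> f) x \<oplus> (h \<otimes>\<^bsub>KH\<^esub> g) x"
      using f g x fgh by (subst (1 2) eq) (auto intro!: finsum_addf)
    finally show "(h \<otimes>\<^bsub>KH\<^esub> (f \<oplus>\<^bsub>KH\<^esub> g)) x = (h \<otimes>\<^bsub>KH\<^esub> f \<oplus>\<^bsub>KH\<^esub> h \<otimes>\<^bsub>KH\<^esub> g) x"
      using x by (simp add: group_algebra_add)
  qed (use f g h cl in auto)
qed

lemma group_algebra_finsum:
  assumes "finite I" "\<And>i. i \<in> I \<Longrightarrow> f i \<in> carrier KH" "x \<in> carrier H"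
  shows "finsum KH f I x = (\<Oplus>i\<in>I. f i x)"
proof -
  interpret KH: ring KH by (rule ring_group_algebra)
  from assms(1,2) show ?thesis
  proof (induction I rule: finite_induct)
    case empty
    then show ?case using assms(3) by (simp add: group_algebra_zero)
  next
    case (insert i I)
    then have "\<And>j. j \<in> insert i I \<Longrightarrow> f j x \<in> carrier K"
      using assms(3) by (auto intro: group_algebra_carrierD(1))
    with insert show ?case using assms(3)
      by (subst KH.finsum_insert) (auto simp: group_algebra_add Pi_def)
  qed
qed

text \<open>One set S that carries the supports of the whole row i serves for all k, so the inner
  index set does not depend on k and the two sums can be interchanged.\<close>

lemma matrix_group_algebra_mult:
  assumes A: "A \<in> carrier (matrix_ring n KH)" and B: "B \<in> carrier (matrix_ring n KH)"
    and ij: "i < n" "j < n" and x: "x \<in> carrier H"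
    and S: "finite S" "S \<subseteq> carrier H"
      "\<forall>k<n. \<forall>a\<in>carrier H - S. A (i, k) a = \<zero>"
  shows "(A \<otimes>\<^bsub>matrix_ring n KH\<^esub> B) (i, j) x
    = (\<Oplus>k\<in>{..<n}. \<Oplus>a\<in>S. A (i, k) a \<otimes> B (k, j) (inv\<^bsub>H\<^esub> a \<otimes>\<^bsub>H\<^esub> x))"
proof -
  note e = matrix_ring_entry[OF A] matrix_ring_entry[OF B]
  have "(A \<otimes>\<^bsub>matrix_ring n KH\<^esub> B) (i, j) x
    = (\<Oplus>k\<in>{..<n}. (A (i, k) \<otimes>\<^bsub>KH\<^esub> B (k, j)) x)"
    using ij e by (subst matrix_ring_mult) (auto intro!: group_algebra_finsum group_algebra_mult_closed x)
  also have "\<dots> = (\<Oplus>k\<in>{..<n}. \<Oplus>a\<in>S. A (i, k) a \<otimes> B (k, j) (inv\<^bsub>H\<^esub> a \<otimes>\<^bsub>H\<^esub> x))"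
    using ij x e S
    by (intro finsum_cong' group_algebra_mult)
      (auto intro!: finsum_closed m_closed group_algebra_carrierD(1)[OF e(1)]
        group_algebra_carrierD(1)[OF e(2)])
  finally show ?thesis .
qed

end

section \<open>Dedekind finiteness of unital rings\<close>

text \<open>In a corner \<open>eRe\<close>, adding \<open>1 - e\<close> to both factors reduces to the case \<open>e = 1\<close>.\<close>

lemma (in ring) dedekind_finiteI:
  assumes "\<And>u v. u \<in> carrier R \<Longrightarrow> v \<in> carrier R \<Longrightarrow> u \<otimes> v = \<one> \<Longrightarrow> v \<otimes> u = \<one>"
  shows "dedekind_finite R"
  unfolding dedekind_finite_def
proof (intro ballI impI)
  fix e u v assume e: "e \<in> carrier R" "e \<otimes> e = e"
    and "u \<in> corner R e" "v \<in> corner R e" and uv: "u \<otimes> v = e"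
  then obtain x y where xy: "x \<in> carrier R" "u = e \<otimes> x \<otimes> e" "y \<in> carrier R" "v = e \<otimes> y \<otimes> e"
    by (auto simp: corner_def)
  then have u: "u \<in> carrier R" and v: "v \<in> carrier R" using e by auto
  let ?d = "\<one> \<ominus> e"
  have ee: "e \<otimes> (e \<otimes> z) = e \<otimes> z" if "z \<in> carrier R" for z
    using e that by (simp add: m_assoc[symmetric])
  have absorb: "e \<otimes> u = u" "u \<otimes> e = u" "e \<otimes> v = v" "v \<otimes> e = v"
    using xy e by (simp_all add: m_assoc ee)
  \<comment> \<open>With d = 1 - e the cross terms ad and db vanish because a = ae and b = eb, and d
    is idempotent.\<close>
  have key: "(a \<oplus> ?d) \<otimes> (b \<oplus> ?d) = a \<otimes> b \<oplus> ?d"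
    if "a \<in> carrier R" "b \<in> carrier R" "a \<otimes> e = a" "e \<otimes> b = b" for a b
  proof -
    have "(a \<oplus> ?d) \<otimes> (b \<oplus> ?d) = a \<otimes> b \<oplus> a \<otimes> ?d \<oplus> (?d \<otimes> b \<oplus> ?d \<otimes> ?d)"
      using that e by (simp add: l_distr r_distr a_ac)
    moreover have "a \<otimes> ?d = \<zero>" "?d \<otimes> b = \<zero>" "?d \<otimes> ?d = ?d"
      using that e by (simp_all add: a_minus_def l_distr r_distr r_minus l_minus r_neg l_neg a_assoc)
    ultimately show ?thesis using that e by simp
  qed
  have ed: "e \<oplus> ?d = \<one>"
    using a_lcomm[of e \<one> "\<ominus> e"] e by (simp add: a_minus_def r_neg)
  have "(u \<oplus> ?d) \<otimes> (v \<oplus> ?d) = \<one>"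
    using key[of u v] u v absorb uv ed by simp
  then have "(v \<oplus> ?d) \<otimes> (u \<oplus> ?d) = \<one>" using assms[of "u \<oplus> ?d" "v \<oplus> ?d"] u v e by simp
  then have "v \<otimes> u \<oplus> ?d = \<one>" using key[of v u] u v absorb by simp
  moreover note ed
  ultimately have "v \<otimes> u \<oplus> ?d = e \<oplus> ?d" by simp
  then show "v \<otimes> u = e" using u v e by (metis add.right_cancel m_closed minus_closed one_closed)
qed

text \<open>With f = 1 - vu, the relation uv = 1 gives uf = u - (uv)u = 0, and then ff = f - v(uf) =
  f. A failure of vu = 1 thus yields a nonzero idempotent, which is what both the sofic case and the
  case of characteristic zero refute.\<close>

lemma (in ring) one_sided_inverse_defect:
  assumes "u \<in> carrier R" "v \<in> carrier R" "u \<otimes> v = \<one>"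
  obtains f where "f \<in> carrier R" "f \<otimes> f = f" "u \<otimes> f = \<zero>" "f \<oplus> v \<otimes> u = \<one>"
proof
  let ?f = "\<one> \<ominus> v \<otimes> u"
  show f: "?f \<in> carrier R" using assms by simp
  have "u \<otimes> (v \<otimes> u) = u" using assms by (simp add: m_assoc[symmetric])
  then show uf: "u \<otimes> ?f = \<zero>"
    using assms by (simp add: r_distr a_minus_def r_minus r_neg)
  have "?f \<otimes> ?f = ?f \<ominus> v \<otimes> (u \<otimes> ?f)"
    using assms f by (subst (1) a_minus_def) (simp add: l_distr a_minus_def[of R "?f"] l_minus m_assoc)
  then show "?f \<otimes> ?f = ?f" using uf assms f by (simp add: a_minus_def)
  show "?f \<oplus> v \<otimes> u = \<one>" using assms by (simp add: a_minus_def a_assoc l_neg)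
qed

section \<open>Prime ideals and linear dependence\<close>

lemma (in ideal) finsum_in_ideal:
  assumes "\<And>i. i \<in> A \<Longrightarrow> f i \<in> I"
  shows "finsum R f A \<in> I"
  using assms
proof (induction A rule: infinite_finite_induct)
  case (insert x A)
  then have "f \<in> insert x A \<rightarrow> carrier R" using a_subset by blast
  with insert show ?case by (subst finsum_insert) (auto simp: a_closed)
qed (auto simp: finsum_infinite)

lemma (in ideal) ideal_add_cancel:
  assumes "a \<in> carrier R" "b \<in> I" "a \<oplus> b \<in> I"
  shows "a \<in> I"
proof -
  have b: "b \<in> carrier R" using assms(2) a_subset by blast
  have "\<ominus> b \<in> I" using I_l_closed[OF assms(2), of "\<ominus> \<one>"] b by (simp add: l_minus)
  then have "a \<oplus> b \<oplus> \<ominus> b \<in> I" by (rule additive_subgroup.a_closed[OF is_additive_subgroup assms(3)])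
  then show ?thesis using assms(1) b by (simp add: a_assoc r_neg)
qed

lemma (in ring) subring_finsum:
  assumes "subring A R" "\<And>i. i \<in> C \<Longrightarrow> f i \<in> A"
  shows "finsum R f C \<in> A"
  using assms(2)
proof (induction C rule: infinite_finite_induct)
  case (insert x C)
  then have "f \<in> insert x C \<rightarrow> carrier R" using subringE(1)[OF assms(1)] by blast
  with insert show ?case by (subst finsum_insert) (auto intro: subringE(7)[OF assms(1)])
qed (auto simp: finsum_infinite subringE(2)[OF assms(1)])

text \<open>Elimination without fractions, carried out modulo the prime ideal.\<close>

lemma (in primeideal) linear_dependence:
  assumes A: "subring A R"
    and "finite J" "finite C" "card J < card C"
    and "\<And>j i. j \<in> J \<Longrightarrow> i \<in> C \<Longrightarrow> M j i \<in> A"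
  shows "\<exists>c \<in> C \<rightarrow> A. (\<exists>i\<in>C. c i \<notin> I) \<and> (\<forall>j\<in>J. (\<Oplus>i\<in>C. c i \<otimes> M j i) \<in> I)"
  using assms(2-)
proof (induction J arbitrary: C M rule: finite_induct)
  case empty
  then have "C \<noteq> {}" by auto
  moreover have "\<one> \<notin> I" using one_imp_carrier I_notcarr by auto
  ultimately show ?case using subringE(3)[OF A] by (intro bexI[of _ "\<lambda>_. \<one>"]) auto
next
  case (insert j0 J)
  have AR: "a \<in> carrier R" if "a \<in> A" for a using that subringE(1)[OF A] by blast
  show ?case
  proof (cases "\<forall>i\<in>C. M j0 i \<in> I")
    case True
    obtain c where c: "c \<in> C \<rightarrow> A" "\<exists>i\<in>C. c i \<notin> I" "\<forall>j\<in>J. (\<Oplus>i\<in>C. c i \<otimes> M j i) \<in> I"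
      using insert.IH[of C M] insert.prems insert.hyps by auto
    have "(\<Oplus>i\<in>C. c i \<otimes> M j0 i) \<in> I"
      using True c(1) AR by (intro finsum_in_ideal I_l_closed) auto
    with c show ?thesis by blast
  next
    case False
    then obtain i0 where i0: "i0 \<in> C" "M j0 i0 \<notin> I" by auto
    define m where "m = M j0 i0"
    define C' where "C' = C - {i0}"
    \<comment> \<open>The 2 by 2 minor of the rows j0, j and the columns i0, i. It clears column i0
      with the pivot m without inverting m, and it vanishes identically for j = j0.\<close>
    define M' where "M' j i = m \<otimes> M j i \<oplus> \<ominus> (M j0 i) \<otimes> M j i0" for j i
    have C': "finite C'" "C = insert i0 C'" "i0 \<notin> C'" using i0 insert.prems by (auto simp: C'_def)
    have MA: "M j i \<in> A" if "j \<in> insert j0 J" "i \<in> C" for j i using that insert.prems by auto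
    note Mc = AR[OF MA]
    have mA: "m \<in> A" using MA i0 by (auto simp: m_def)
    then have m: "m \<in> carrier R" by (rule AR)
    have "card J < card C'" using insert.prems insert.hyps C' by simp
    moreover have "M' j i \<in> A" if "j \<in> insert j0 J" "i \<in> C'" for j i
      using that mA MA[OF that(1)] MA[of j0] C' by (auto simp: M'_def intro!: subringE(5-7)[OF A])
    ultimately obtain c' where c': "c' \<in> C' \<rightarrow> A" "\<exists>i\<in>C'. c' i \<notin> I"
        "\<forall>j\<in>J. (\<Oplus>i\<in>C'. c' i \<otimes> M' j i) \<in> I"
      using insert.IH[OF C'(1), of M'] by auto
    have cc: "c' i \<in> carrier R" if "i \<in> C'" for i using that c'(1) AR by auto
    \<comment> \<open>The entry at i0 is chosen so that in every row the combination of the M j i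
      with coefficients c equals that of the M' j i with coefficients c'. All coefficients stay in
      A.\<close>
    define c where "c i = (if i = i0 then \<Oplus>i\<in>C'. c' i \<otimes> \<ominus> (M j0 i) else m \<otimes> c' i)" for i
    have cA: "c i \<in> A" if "i \<in> C" for i
      using that c'(1) mA MA[of j0] C' by (auto simp: c_def intro!: subring_finsum[OF A] subringE(5,6)[OF A])
    note c = AR[OF cA]
    have rel: "(\<Oplus>i\<in>C. c i \<otimes> M j i) = (\<Oplus>i\<in>C'. c' i \<otimes> M' j i)" if j: "j \<in> insert j0 J" for j
    proof -
      have M: "M j i \<in> carrier R" "M j0 i \<in> carrier R" if "i \<in> C" for i using Mc j that by auto
      have "(\<Oplus>i\<in>C'. c' i \<otimes> M' j i)
          = (\<Oplus>i\<in>C'. c' i \<otimes> \<ominus> (M j0 i) \<otimes> M j i0 \<oplus> c i \<otimes> M j i)"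
      proof (rule finsum_cong')
        fix i assume i: "i \<in> C'"
        then have "i \<noteq> i0" "i \<in> C" using C' by auto
        with i show "c' i \<otimes> M' j i = c' i \<otimes> \<ominus> (M j0 i) \<otimes> M j i0 \<oplus> c i \<otimes> M j i"
          using cc[OF i] M[OF \<open>i \<in> C\<close>] M[OF i0(1)] m
          by (simp add: M'_def c_def r_distr m_assoc m_lcomm a_comm)
      qed (use M c cc C' i0 in auto)
      also have "\<dots> = (\<Oplus>i\<in>C'. c' i \<otimes> \<ominus> (M j0 i) \<otimes> M j i0) \<oplus> (\<Oplus>i\<in>C'. c i \<otimes> M j i)"
        using M c cc C' i0 by (intro finsum_addf) auto
      also have "(\<Oplus>i\<in>C'. c' i \<otimes> \<ominus> (M j0 i) \<otimes> M j i0) = c i0 \<otimes> M j i0"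
        using M cc C' by (simp add: c_def Pi_def finsum_ldistr)
      also have "c i0 \<otimes> M j i0 \<oplus> (\<Oplus>i\<in>C'. c i \<otimes> M j i) = (\<Oplus>i\<in>C. c i \<otimes> M j i)"
        unfolding C'(2) using M c C' by (intro finsum_insert[symmetric]) auto
      finally show ?thesis ..
    qed
    have "(\<Oplus>i\<in>C'. c' i \<otimes> M' j0 i) = (\<Oplus>i\<in>C'. \<zero>)"
      using cc m Mc[of j0] C'
      by (intro finsum_cong') (auto simp: M'_def m_def[symmetric] m_comm l_minus r_minus r_neg)
    then have "(\<Oplus>i\<in>C. c i \<otimes> M j0 i) \<in> I" using rel[of j0] by simp
    moreover have "(\<Oplus>i\<in>C. c i \<otimes> M j i) \<in> I" if "j \<in> J" for j using rel[of j] c'(3) that by simp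
    \<comment> \<open>Primeness enters here: neither m nor c' i lies in I, hence neither does their
      product.\<close>
    moreover have "\<exists>i\<in>C. c i \<notin> I"
    proof -
      obtain i where i: "i \<in> C'" "c' i \<notin> I" using c'(2) by blast
      then have "c i \<notin> I" using I_prime[of m "c' i"] i0(2) m cc C' by (auto simp: c_def m_def)
      then show ?thesis using i C' by blast
    qed
    ultimately show ?thesis using cA by (intro bexI[of _ c]) auto
  qed
qed

text \<open>
  An ideal that is maximal among those not containing \<open>S\<close> is prime: if \<open>a b \<in> P\<close> with \<open>a, b \<notin> P\<close>,
  then \<open>S\<close> lies in both \<open>P + (a)\<close> and \<open>P + (b)\<close>, whose product lies in \<open>P\<close>.
\<close>

lemma (in cring) primeideal_not_containing:
  assumes "finite S" "S \<subseteq> carrier R" "\<not> S \<subseteq> {\<zero>}"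
    and idem: "\<And>P. ideal P R \<Longrightarrow> (\<And>s t. s \<in> S \<Longrightarrow> t \<in> S \<Longrightarrow> s \<otimes> t \<in> P) \<Longrightarrow> S \<subseteq> P"
  shows "\<exists>P. primeideal P R \<and> \<not> S \<subseteq> P"
proof -
  let ?A = "{I. ideal I R \<and> \<not> S \<subseteq> I}"
  have "\<exists>P\<in>?A. \<forall>X\<in>?A. P \<subseteq> X \<longrightarrow> X = P"
  proof (rule subset_Zorn_nonempty)
    show "?A \<noteq> {}" using zeroideal assms(3) by auto
    fix C assume C: "C \<noteq> {}" "subset.chain ?A C"
    then have "subset.chain {I. ideal I R} C" by (auto simp: subset_chain_def)
    then have "ideal (\<Union>C) R" using chain_Union_is_ideal[of C] C by simp
    \<comment> \<open>Finiteness of S: if the union of a chain contains S, then so does one of its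
      members.\<close>
    moreover have "\<not> S \<subseteq> \<Union>C"
    proof
      assume "S \<subseteq> \<Union>C"
      then obtain I where "I \<in> C" "S \<subseteq> I"
        using finite_subset_Union_chain[OF assms(1) _ C] by blast
      then show False using C(2) by (auto simp: subset_chain_def)
    qed
    ultimately show "\<Union>C \<in> ?A" by simp
  qed
  then obtain P where P: "ideal P R" "\<not> S \<subseteq> P" and max: "\<And>X. ideal X R \<Longrightarrow> P \<subseteq> X \<Longrightarrow> X \<noteq> P \<Longrightarrow> S \<subseteq> X"
    by auto
  interpret P: ideal P R by (rule P(1))
  have sum: "\<exists>p\<in>P. \<exists>r\<in>carrier R. s = p \<oplus> r \<otimes> a"
    if a: "a \<in> carrier R" "a \<notin> P" and s: "s \<in> S" for a s
  proof -
    let ?X = "set_add R P (PIdl a)"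
    have mem: "x \<in> ?X \<longleftrightarrow> (\<exists>p\<in>P. \<exists>r\<in>carrier R. x = p \<oplus> r \<otimes> a)" for x
      by (auto simp: set_add_def' cgenideal_def)
    have "p \<in> ?X" if "p \<in> P" for p
      unfolding mem using that a P.a_subset by (intro bexI[of _ p] bexI[of _ \<zero>]) auto
    moreover have "a \<in> ?X"
      unfolding mem using a by (intro bexI[of _ \<zero>] bexI[of _ \<one>]) (auto simp: P.zero_closed)
    moreover have "ideal ?X R" by (rule add_ideals[OF P(1) cgenideal_ideal[OF a(1)]])
    ultimately have "S \<subseteq> ?X" using max[of ?X] a by blast
    then show ?thesis using s mem by blast
  qed
  have "primeideal P R"
  proof (rule primeidealI)
    show "carrier R \<noteq> P" using P assms(2) by auto
    fix a b assume ab: "a \<in> carrier R" "b \<in> carrier R" "a \<otimes> b \<in> P"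
    show "a \<in> P \<or> b \<in> P"
    proof (rule ccontr)
      assume n: "\<not> (a \<in> P \<or> b \<in> P)"
      have "S \<subseteq> P"
      proof (rule idem[OF P(1)])
        fix s t assume st: "s \<in> S" "t \<in> S"
        obtain p r where s: "p \<in> P" "r \<in> carrier R" "s = p \<oplus> r \<otimes> a" using sum[OF ab(1) _ st(1)] n by blast
        obtain p' r' where t: "p' \<in> P" "r' \<in> carrier R" "t = p' \<oplus> r' \<otimes> b" using sum[OF ab(2) _ st(2)] n by blast
        have c: "p \<in> carrier R" "p' \<in> carrier R" using s t P.a_subset by auto
        have "s \<otimes> t = p \<otimes> t \<oplus> (r \<otimes> a \<otimes> p' \<oplus> r \<otimes> r' \<otimes> (a \<otimes> b))"
          unfolding t s using c s(2) t(2) ab by (simp add: l_distr r_distr m_ac a_assoc)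
        also have "\<dots> \<in> P"
          using P.I_r_closed[OF s(1), of t] P.I_l_closed[OF t(1), of "r \<otimes> a"]
            P.I_l_closed[OF ab(3), of "r \<otimes> r'"] s(2) t(2) ab assms(2) st
          by (auto intro!: P.a_closed)
        finally show "s \<otimes> t \<in> P" .
      qed
      then show False using P(2) by blast
    qed
  qed (use P(1) is_cring in auto)
  then show ?thesis using P(2) by blast
qed

section \<open>Sofic groups\<close>

text \<open>
  \<open>S\<close> consists of the points at which \<open>\<sigma>\<close> behaves like a free action of \<open>F\<close>, and \<open>D\<close> is a maximal
  subset of \<open>S\<close> whose translates by \<open>F\<close> are disjoint, so that \<open>card S \<le> card D * (card F)\<^sup>2\<close>.
\<close>

lemma sofic_points:
  fixes H :: "('g, 'n) monoid_scheme" (structure)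
  assumes "sofic H" and F: "finite F" "F \<subseteq> carrier H" "\<one> \<in> F"
  obtains n \<sigma> S D where "S \<subseteq> {1..n}" "D \<subseteq> S" "k * n < k * card S + card D"
    and "\<And>g. g \<in> carrier H \<Longrightarrow> \<sigma> g permutes {1..n}"
    and "\<And>p g h. p \<in> S \<Longrightarrow> g \<in> F \<Longrightarrow> h \<in> F \<Longrightarrow> \<sigma> g (\<sigma> h p) = \<sigma> (g \<otimes> h) p"
    and "\<And>p g h. p \<in> S \<Longrightarrow> g \<in> F \<Longrightarrow> h \<in> F \<Longrightarrow> \<sigma> g p = \<sigma> h p \<Longrightarrow> g = h"
    and "\<And>p q g h. p \<in> D \<Longrightarrow> q \<in> D \<Longrightarrow> g \<in> F \<Longrightarrow> h \<in> F \<Longrightarrow> \<sigma> g p = \<sigma> h q \<Longrightarrow> p = q"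
proof -
  interpret group H using assms(1) by (simp add: sofic_def)
  \<comment> \<open>The quotients h^-1 g are added because at a good point \<sigma> g p = \<sigma> h
    p makes p a fixed point of \<sigma> (h^-1 g), and such fixed points are rare unless g =
    h.\<close>
  define F' where "F' = F \<union> (\<lambda>(g, h). inv h \<otimes> g) ` (F \<times> F)"
  have F': "finite F'" "F' \<subseteq> carrier H" "F \<subseteq> F'" using F by (auto simp: F'_def)
  define q m where "q = card F'" and "m = (card F)\<^sup>2"
  have m: "m > 0" using F card_gt_0_iff[of F] by (auto simp: m_def)
  \<comment> \<open>At most q^2 + q exceptional sets of at most \<epsilon> n points each are
    removed, so n - |S| < n / (km + 1), that is, kmn < (km + 1)|S|. Together with |S| \<le> m |D|
    this gives the required inequality after division by m.\<close>
  define \<epsilon> where "\<epsilon> = 1 / (real (q\<^sup>2 + q + 1) * real (k * m + 1))"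
  have \<epsilon>: "\<epsilon> > 0" unfolding \<epsilon>_def by (simp add: field_simps add_pos_nonneg)
  obtain n \<sigma> where n: "n \<ge> 1" and \<sigma>: "\<sigma> \<in> carrier H \<rightarrow> carrier (sym_group n)"
    and mult: "\<forall>g \<in> F'. \<forall>h \<in> F'.
      real (card {i \<in> {1..n}. (\<sigma> g \<otimes>\<^bsub>sym_group n\<^esub> \<sigma> h) i = \<sigma> (g \<otimes> h) i}) \<ge> (1 - \<epsilon>) * real n"
    and free: "\<forall>g \<in> F' - {\<one>}. real (card {i \<in> {1..n}. \<sigma> g i = i}) \<le> \<epsilon> * real n"
    using assms(1)[unfolded sofic_def, THEN conjunct2, rule_format, OF conjI[OF F'(2) conjI[OF F'(1) \<epsilon>]]]
    by (elim exE conjE bexE) (rule that)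
  have perm: "\<sigma> g permutes {1..n}" if "g \<in> carrier H" for g
    using funcset_mem[OF \<sigma> that] by (simp only: sym_group_carrier)
  define B where "B g h = {i \<in> {1..n}. \<sigma> g (\<sigma> h i) \<noteq> \<sigma> (g \<otimes> h) i}" for g h
  define E where "E g = {i \<in> {1..n}. \<sigma> g i = i}" for g
  have B: "real (card (B g h)) \<le> \<epsilon> * n" if "g \<in> F'" "h \<in> F'" for g h
  proof -
    let ?A = "{i \<in> {1..n}. (\<sigma> g \<otimes>\<^bsub>sym_group n\<^esub> \<sigma> h) i = \<sigma> (g \<otimes> h) i}"
    have "B g h = {1..n} - ?A" by (auto simp: B_def sym_group_mult)
    moreover have "card ({1..n} - ?A) = card {1..n} - card ?A"
      by (rule card_Diff_subset) auto
    ultimately have "card (B g h) = n - card ?A" by simp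
    moreover have "card ?A \<le> card {1..n}" by (rule card_mono) auto
    ultimately show ?thesis using mult that by (auto simp: of_nat_diff algebra_simps)
  qed
  have E: "real (card (E g)) \<le> \<epsilon> * n" if "g \<in> F' - {\<one>}" for g
    using free that by (simp add: E_def)
  define S where "S = {1..n} - ((\<Union>(g, h)\<in>F' \<times> F'. B g h) \<union> (\<Union>g\<in>F' - {\<one>}. E g))"
  have S: "S \<subseteq> {1..n}" "finite S" by (auto simp: S_def)
  have card_bad: "real n - real (card S) \<le> real (q\<^sup>2 + q) * \<epsilon> * n"
  proof -
    let ?U = "\<Union>(g, h)\<in>F' \<times> F'. B g h" and ?V = "\<Union>g\<in>F' - {\<one>}. E g"
    have "real (card ?U) \<le> (\<Sum>(g, h)\<in>F' \<times> F'. real (card (B g h)))"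
      using card_UN_le[of "F' \<times> F'" "\<lambda>(g, h). B g h"] F'
      by (simp add: case_prod_unfold of_nat_sum[symmetric] del: of_nat_sum)
    also have "\<dots> \<le> (\<Sum>(g, h)\<in>F' \<times> F'. \<epsilon> * n)" using B by (intro sum_mono) auto
    also have "\<dots> = real (q\<^sup>2) * (\<epsilon> * n)" by (simp add: q_def card_cartesian_product power2_eq_square)
    finally have U: "real (card ?U) \<le> real (q\<^sup>2) * (\<epsilon> * n)" .
    have "real (card ?V) \<le> (\<Sum>g\<in>F' - {\<one>}. real (card (E g)))"
      using card_UN_le[of "F' - {\<one>}" E] F' by (simp add: of_nat_sum[symmetric] del: of_nat_sum)
    also have "\<dots> \<le> (\<Sum>g\<in>F' - {\<one>}. \<epsilon> * n)" using E by (intro sum_mono) auto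
    also have "\<dots> \<le> real q * (\<epsilon> * n)"
    proof -
      have "card (F' - {\<one>}) \<le> q" using F' unfolding q_def by (intro card_mono) auto
      then show ?thesis using \<epsilon> by (simp add: mult_right_mono)
    qed
    finally have V: "real (card ?V) \<le> real q * (\<epsilon> * n)" .
    have "n \<le> card S + card (?U \<union> ?V)"
    proof -
      have "{1..n} \<subseteq> S \<union> (?U \<union> ?V)" unfolding S_def by blast
      moreover have "finite (S \<union> (?U \<union> ?V))" using F' by (auto simp: S_def B_def E_def)
      ultimately have "card {1..n} \<le> card (S \<union> (?U \<union> ?V))" by (intro card_mono) auto
      then show ?thesis using card_Un_le[of S "?U \<union> ?V"] by simp
    qed
    then have "real n \<le> real (card S + (card ?U + card ?V))"
      using card_Un_le[of ?U ?V] by (simp only: of_nat_le_iff)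
    then show ?thesis using U V by (simp add: algebra_simps)
  qed
  have hom: "\<sigma> g (\<sigma> h p) = \<sigma> (g \<otimes> h) p" if "p \<in> S" "g \<in> F'" "h \<in> F'" for p g h
    using that by (auto simp: S_def B_def)
  have inj: "g = h" if p: "p \<in> S" and gh: "g \<in> F" "h \<in> F" and eq: "\<sigma> g p = \<sigma> h p" for p g h
  proof -
    let ?x = "inv h \<otimes> g"
    have c: "g \<in> carrier H" "h \<in> carrier H" using gh F by auto
    have x: "?x \<in> F'" "h \<in> F'" using gh by (auto simp: F'_def)
    have "\<sigma> h (\<sigma> ?x p) = \<sigma> (h \<otimes> ?x) p" using hom p x by blast
    also have "h \<otimes> ?x = g" using c by (simp add: m_assoc[symmetric])
    finally have "\<sigma> h (\<sigma> ?x p) = \<sigma> h p" using eq by simp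
    then have "\<sigma> ?x p = p" using perm[OF c(2)] by (metis permutes_inverses(2))
    then have "?x = \<one>" using p x by (auto simp: S_def E_def)
    then show ?thesis using c by (metis inv_solve_left' l_cancel_one m_closed r_one one_closed)
  qed
  define free_set where
    "free_set D \<longleftrightarrow> D \<subseteq> S \<and> (\<forall>p\<in>D. \<forall>q\<in>D. \<forall>g\<in>F. \<forall>h\<in>F. \<sigma> g p = \<sigma> h q \<longrightarrow> p = q)" for D
  have "free_set {}" by (simp add: free_set_def)
  moreover have "card D \<le> card S" if "free_set D" for D
    using that S by (auto simp: free_set_def intro: card_mono)
  ultimately obtain D where D: "free_set D" and max: "\<And>D'. free_set D' \<Longrightarrow> card D' \<le> card D"
    using ex_has_greatest_nat[of free_set "{}" card "Suc (card S)"] by (auto simp: less_Suc_eq_le)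
  have D': "D \<subseteq> S" "finite D" using D S by (auto simp: free_set_def intro: finite_subset)
  \<comment> \<open>A point p of S outside D cannot be added to D, so \<sigma> g p = \<sigma> h r
    for some r in D and g, h in F; hence p is determined by r, g and h.\<close>
  have "S \<subseteq> (\<lambda>(p, g, h). inv_into UNIV (\<sigma> g) (\<sigma> h p)) ` (D \<times> F \<times> F)"
  proof
    fix p assume p: "p \<in> S"
    have "\<exists>r\<in>D. \<exists>g\<in>F. \<exists>h\<in>F. \<sigma> g p = \<sigma> h r"
    proof (cases "p \<in> D")
      case True
      then show ?thesis using F(3) by blast
    next
      case False
      then have "\<not> free_set (insert p D)" using max[of "insert p D"] D' by auto
      then obtain a b g h where ab: "a \<in> insert p D" "b \<in> insert p D" "g \<in> F" "h \<in> F"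
        "\<sigma> g a = \<sigma> h b" "a \<noteq> b" using D' p by (auto simp: free_set_def)
      then show ?thesis using D unfolding free_set_def by (metis insert_iff)
    qed
    then obtain r g h where r: "r \<in> D" "g \<in> F" "h \<in> F" "\<sigma> g p = \<sigma> h r" by blast
    have "inj (\<sigma> g)" using perm r F by (intro permutes_inj) auto
    then have "p = inv_into UNIV (\<sigma> g) (\<sigma> h r)" using r(4) by (metis inv_f_f)
    then show "p \<in> (\<lambda>(p, g, h). inv_into UNIV (\<sigma> g) (\<sigma> h p)) ` (D \<times> F \<times> F)"
      using r by force
  qed
  then have "card S \<le> card (D \<times> F \<times> F)"
    using D' F by (meson finite_SigmaI surj_card_le)
  then have SD: "card S \<le> card D * m" by (simp add: card_cartesian_product m_def power2_eq_square)
  have small: "real (q\<^sup>2 + q) * \<epsilon> * real (k * m + 1) < 1"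
  proof -
    have "real (q\<^sup>2 + q) * \<epsilon> * real (k * m + 1) = real (q\<^sup>2 + q) / real (q\<^sup>2 + q + 1)"
      unfolding \<epsilon>_def using add_pos_nonneg[of 1 "real k * real m"] by simp
    moreover have "real x / real y < 1" if "x < y" for x y :: nat
      using that by (simp add: divide_simps)
    from this[of "q\<^sup>2 + q" "q\<^sup>2 + q + 1"]
    have "real (q\<^sup>2 + q) / real (q\<^sup>2 + q + 1) < 1" by (simp only: less_add_one)
    ultimately show ?thesis by (simp only:)
  qed
  have "real n * (1 - real (q\<^sup>2 + q) * \<epsilon>) * real (k * m + 1) > real n * real (k * m)"
  proof -
    have "real n * (real (q\<^sup>2 + q) * \<epsilon> * real (k * m + 1)) < real n * 1"
      using small n by (intro mult_strict_left_mono) auto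
    then show ?thesis by (simp add: algebra_simps)
  qed
  moreover have "real (card S) * real (k * m + 1) \<ge> real n * (1 - real (q\<^sup>2 + q) * \<epsilon>) * real (k * m + 1)"
    using card_bad by (intro mult_right_mono) (auto simp: algebra_simps)
  ultimately have "real n * real (k * m) < real (card S) * real (k * m + 1)" by linarith
  then have "real (n * (k * m)) < real (card S * (k * m + 1))" by (simp only: of_nat_mult)
  then have "n * (k * m) < card S * (k * m + 1)" by (simp only: of_nat_less_iff)
  also have "\<dots> \<le> (k * card S + card D) * m" using SD by (simp add: algebra_simps)
  finally have "(k * n) * m < (k * card S + card D) * m" by (simp add: algebra_simps)
  then have "k * n < k * card S + card D" by simp
  moreover have "D \<subseteq> S" by (fact D'(1))
  moreover have "\<sigma> g (\<sigma> h p) = \<sigma> (g \<otimes> h) p" if "p \<in> S" "g \<in> F" "h \<in> F" for p g h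
    using hom that F'(3) by blast
  moreover have "p = r" if "p \<in> D" "r \<in> D" "g \<in> F" "h \<in> F" "\<sigma> g p = \<sigma> h r" for p r g h
    using D that unfolding free_set_def by blast
  ultimately show thesis using that S(1) perm inj by blast
qed

section \<open>Matrices over the group algebra acting on the points of a sofic approximation\<close>

context cring_group
begin

lemma matrix_nonzero:
  assumes A: "A \<in> carrier (matrix_ring k KH)" "A \<noteq> \<zero>\<^bsub>matrix_ring k KH\<^esub>"
  obtains i j g where "i < k" "j < k" "g \<in> carrier H" "A (i, j) g \<noteq> \<zero>"
proof -
  have zero: "\<zero>\<^bsub>matrix_ring k KH\<^esub> \<in> carrier (matrix_ring k KH)"
    using ring.ring_matrix_ring[OF ring_group_algebra] by (rule ring.ring_simprules(2))
  have "\<exists>i<k. \<exists>j<k. \<exists>g\<in>carrier H. A (i, j) g \<noteq> \<zero>"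
  proof (rule ccontr)
    assume c: "\<not> (\<exists>i<k. \<exists>j<k. \<exists>g\<in>carrier H. A (i, j) g \<noteq> \<zero>)"
    have "A = \<zero>\<^bsub>matrix_ring k KH\<^esub>"
    proof (rule matrix_ring_eqI[OF A(1) zero])
      fix i j assume ij: "i < k" "j < k"
      show "A (i, j) = \<zero>\<^bsub>matrix_ring k KH\<^esub> (i, j)"
        using c ij matrix_ring_entry[OF A(1) ij] matrix_ring_entry[OF zero ij]
        by (intro group_algebra_eqI) (auto simp: matrix_ring_zero group_algebra_zero)
    qed
    then show False using A(2) by simp
  qed
  then show thesis using that by blast
qed

lemma matrix_support:
  assumes "A \<in> carrier (matrix_ring k KH)"
  obtains S where "finite S" "S \<subseteq> carrier H"
    "\<forall>i<k. \<forall>j<k. \<forall>a\<in>carrier H - S. A (i, j) a = \<zero>"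
proof (rule that[of "\<Union>(i, j)\<in>{..<k} \<times> {..<k}. {a \<in> carrier H. A (i, j) a \<noteq> \<zero>}"])
  show "finite (\<Union>(i, j)\<in>{..<k} \<times> {..<k}. {a \<in> carrier H. A (i, j) a \<noteq> \<zero>})"
    using group_algebra_carrierD(2)[OF matrix_ring_entry[OF assms]] by auto
qed auto

lemma matrix_entry_closed:
  "A \<in> carrier (matrix_ring k KH) \<Longrightarrow> i < k \<Longrightarrow> j < k \<Longrightarrow> a \<in> carrier H \<Longrightarrow> A (i, j) a \<in> carrier K"
  by (rule group_algebra_carrierD(1)[OF matrix_ring_entry])

text \<open>
  The matrix, with rows and columns indexed by pairs of a point and an index below \<open>k\<close>, by which
  \<open>A\<close> acts when the group elements act through \<open>\<sigma>\<close>.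
\<close>

definition sofic_matrix ::
    "'c set \<Rightarrow> ('c \<Rightarrow> nat \<Rightarrow> nat) \<Rightarrow> (nat \<times> nat \<Rightarrow> 'c \<Rightarrow> 'a) \<Rightarrow> nat \<times> nat \<Rightarrow> nat \<times> nat \<Rightarrow> 'a"
  where "sofic_matrix F \<sigma> A = (\<lambda>(q, a) (p, b). \<Oplus>g\<in>F. if \<sigma> g p = q then A (a, b) g else \<zero>)"

lemma sofic_matrix_closed:
  assumes "A \<in> carrier (matrix_ring k KH)" "F \<subseteq> carrier H" "a < k" "b < k"
  shows "sofic_matrix F \<sigma> A (q, a) (p, b) \<in> carrier K"
  using matrix_entry_closed[OF assms(1,3,4)] assms(2)
  by (auto simp: sofic_matrix_def subset_iff intro!: finsum_closed)

text \<open>Over the point p the map \<sigma> respects products of two elements of F, so collecting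
  the terms by x = gh produces the convolution. The right-hand side is the entry of
  \<open>sofic_matrix\<close> for AB with F replaced by FF, since AB need not be supported in
  F.\<close>

lemma sofic_matrix_mult:
  assumes A: "A \<in> carrier (matrix_ring k KH)" and B: "B \<in> carrier (matrix_ring k KH)"
    and F: "finite F" "F \<subseteq> carrier H"
    and suppA: "\<forall>i<k. \<forall>j<k. \<forall>a\<in>carrier H - F. A (i, j) a = \<zero>"
    and suppB: "\<forall>i<k. \<forall>j<k. \<forall>a\<in>carrier H - F. B (i, j) a = \<zero>"
    and ab: "a < k" "b < k"
    and pt: "\<And>g. g \<in> F \<Longrightarrow> \<sigma> g p \<in> N" "finite N"
    and hom: "\<And>g h. g \<in> F \<Longrightarrow> h \<in> F \<Longrightarrow> \<sigma> g (\<sigma> h p) = \<sigma> (g \<otimes>\<^bsub>H\<^esub> h) p"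
  shows "(\<Oplus>s\<in>N \<times> {..<k}. sofic_matrix F \<sigma> A (r, a) s \<otimes> sofic_matrix F \<sigma> B s (p, b))
    = (\<Oplus>x\<in>(\<lambda>(g, h). g \<otimes>\<^bsub>H\<^esub> h) ` (F \<times> F).
        if \<sigma> x p = r then (A \<otimes>\<^bsub>matrix_ring k KH\<^esub> B) (a, b) x else \<zero>)"
proof -
  let ?X = "(\<lambda>(g, h). g \<otimes>\<^bsub>H\<^esub> h) ` (F \<times> F)"
  have X: "finite ?X" "?X \<subseteq> carrier H" using F by auto
  have Ac: "A (i, j) g \<in> carrier K" and Bc: "B (i, j) g \<in> carrier K"
    if "i < k" "j < k" "g \<in> carrier H" for i j g
    using matrix_entry_closed[OF A that] matrix_entry_closed[OF B that] by auto
  have Fc: "g \<in> carrier H" if "g \<in> F" for g using that F by auto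
  have Xc: "g \<in> carrier H" if "g \<in> ?X" for g using that X by blast
  note closed = sofic_matrix_closed[OF A F(2)] sofic_matrix_closed[OF B F(2)]
  define T where "T c g h = (if \<sigma> (g \<otimes>\<^bsub>H\<^esub> h) p = r then A (a, c) g \<otimes> B (c, b) h else \<zero>)" for c g h
  have Tc: "T c g h \<in> carrier K" if "c < k" "g \<in> F" "h \<in> F" for c g h
    using that Ac Bc ab Fc by (simp add: T_def)
  have "(\<Oplus>s\<in>N \<times> {..<k}. sofic_matrix F \<sigma> A (r, a) s \<otimes> sofic_matrix F \<sigma> B s (p, b))
      = (\<Oplus>q\<in>N. \<Oplus>c\<in>{..<k}. sofic_matrix F \<sigma> A (r, a) (q, c) \<otimes> sofic_matrix F \<sigma> B (q, c) (p, b))"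
    using closed ab pt by (subst finsum_Sigma) (auto intro!: finsum_cong')
  also have "\<dots> = (\<Oplus>c\<in>{..<k}. \<Oplus>q\<in>N. sofic_matrix F \<sigma> A (r, a) (q, c) \<otimes> sofic_matrix F \<sigma> B (q, c) (p, b))"
    using closed ab pt by (intro finsum_swap) auto
  also have "\<dots> = (\<Oplus>c\<in>{..<k}. \<Oplus>h\<in>F. \<Oplus>g\<in>F. T c g h)"
  proof (rule finsum_cong', goal_cases)
    case (3 c)
    then have c: "c < k" by simp
    have "(\<Oplus>q\<in>N. sofic_matrix F \<sigma> A (r, a) (q, c) \<otimes> sofic_matrix F \<sigma> B (q, c) (p, b))
        = (\<Oplus>q\<in>N. \<Oplus>h\<in>F. sofic_matrix F \<sigma> A (r, a) (q, c) \<otimes> (if \<sigma> h p = q then B (c, b) h else \<zero>))"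
      using closed(1)[OF ab(1) c] Bc[OF c ab(2)] Fc F(1)
      by (intro finsum_cong') (auto simp: sofic_matrix_def[of F \<sigma> B] intro!: finsum_rdistr)
    also have "\<dots> = (\<Oplus>h\<in>F. \<Oplus>q\<in>N. sofic_matrix F \<sigma> A (r, a) (q, c) \<otimes> (if \<sigma> h p = q then B (c, b) h else \<zero>))"
      using closed(1)[OF ab(1) c] Bc[OF c ab(2)] Fc F(1) pt by (intro finsum_swap) auto
    also have "\<dots> = (\<Oplus>h\<in>F. sofic_matrix F \<sigma> A (r, a) (\<sigma> h p, c) \<otimes> B (c, b) h)"
    proof (rule finsum_cong', goal_cases)
      case (3 h)
      have "(\<Oplus>q\<in>N. sofic_matrix F \<sigma> A (r, a) (q, c) \<otimes> (if \<sigma> h p = q then B (c, b) h else \<zero>))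
          = (\<Oplus>q\<in>N. if q = \<sigma> h p then sofic_matrix F \<sigma> A (r, a) (q, c) \<otimes> B (c, b) h else \<zero>)"
        using closed(1)[OF ab(1) c] Bc[OF c ab(2)] Fc 3 by (intro finsum_cong') auto
      also have "\<dots> = sofic_matrix F \<sigma> A (r, a) (\<sigma> h p, c) \<otimes> B (c, b) h"
        using closed(1)[OF ab(1) c] Bc[OF c ab(2)] Fc 3 pt by (intro finsum_delta) auto
      finally show ?case .
    qed (use closed(1)[OF ab(1) c] Bc[OF c ab(2)] Fc in auto)
    also have "\<dots> = (\<Oplus>h\<in>F. \<Oplus>g\<in>F. T c g h)"
    proof (rule finsum_cong', goal_cases)
      case (3 h)
      have "sofic_matrix F \<sigma> A (r, a) (\<sigma> h p, c) \<otimes> B (c, b) h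
          = (\<Oplus>g\<in>F. (if \<sigma> g (\<sigma> h p) = r then A (a, c) g else \<zero>) \<otimes> B (c, b) h)"
        using Ac[OF ab(1) c] Bc[OF c ab(2)] Fc F(1) 3
        by (simp add: sofic_matrix_def) (intro finsum_ldistr, auto)
      also have "\<dots> = (\<Oplus>g\<in>F. T c g h)"
        using Tc[OF c] Bc[OF c ab(2)] Fc 3 hom by (intro finsum_cong') (auto simp: T_def)
      finally show ?case .
    qed (use Tc[OF c] in auto)
    finally show ?case .
  qed (use Tc in \<open>auto intro!: finsum_closed\<close>)
  also have "\<dots> = (\<Oplus>c\<in>{..<k}. \<Oplus>g\<in>F. \<Oplus>h\<in>F. T c g h)"
    using Tc F by (intro finsum_cong' finsum_swap) (auto intro!: finsum_closed)
  also have "\<dots> = (\<Oplus>c\<in>{..<k}. \<Oplus>g\<in>F. \<Oplus>x\<in>?X.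
      if \<sigma> x p = r then A (a, c) g \<otimes> B (c, b) (inv\<^bsub>H\<^esub> g \<otimes>\<^bsub>H\<^esub> x) else \<zero>)"
  proof (rule finsum_cong', goal_cases)
    case (3 c)
    then have c: "c < k" by simp
    show ?case
    proof (rule finsum_cong', goal_cases)
      case (3 g)
      then have g: "g \<in> F" "g \<in> carrier H" using Fc by auto
      let ?f = "\<lambda>x. if \<sigma> x p = r then A (a, c) g \<otimes> B (c, b) (inv\<^bsub>H\<^esub> g \<otimes>\<^bsub>H\<^esub> x) else \<zero>"
      have f: "?f x \<in> carrier K" if "x \<in> carrier H" for x
        using Ac[OF ab(1) c] Bc[OF c ab(2)] g that by simp
      \<comment> \<open>Substitution x = gh. The elements of \<open>?X\<close> outside gF contribute
        zero, because there g^-1 x is outside F and B vanishes at it.\<close>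
      have "(\<Oplus>h\<in>F. T c g h) = (\<Oplus>x\<in>(\<lambda>h. g \<otimes>\<^bsub>H\<^esub> h) ` F. ?f x)"
      proof (rule finsum_bij)
        show "bij_betw ((\<otimes>\<^bsub>H\<^esub>) g) F ((\<otimes>\<^bsub>H\<^esub>) g ` F)"
          using g Fc by (auto simp: bij_betw_def inj_on_def)
      qed (use g Fc Ac[OF ab(1) c] Bc[OF c ab(2)] in \<open>auto simp: T_def\<close>)
      also have "\<dots> = (\<Oplus>x\<in>?X. ?f x)"
      proof (rule finsum_mono_neutral)
        fix x assume x: "x \<in> ?X - (\<lambda>h. g \<otimes>\<^bsub>H\<^esub> h) ` F"
        then have xc: "x \<in> carrier H" using Xc by blast
        have "x = g \<otimes>\<^bsub>H\<^esub> (inv\<^bsub>H\<^esub> g \<otimes>\<^bsub>H\<^esub> x)" using g xc by simp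
        then have "inv\<^bsub>H\<^esub> g \<otimes>\<^bsub>H\<^esub> x \<notin> F" using x by blast
        then have "B (c, b) (inv\<^bsub>H\<^esub> g \<otimes>\<^bsub>H\<^esub> x) = \<zero>" using suppB c ab g xc by simp
        then show "?f x = \<zero>" using Ac[OF ab(1) c] g by simp
      qed (use g Fc Ac[OF ab(1) c] Bc[OF c ab(2)] X in auto)
      finally show ?case .
    qed (use Ac[OF ab(1) c] Bc[OF c ab(2)] Fc Xc in \<open>auto intro!: finsum_closed\<close>)
  qed (use Ac[OF ab(1)] Bc[OF _ ab(2)] Fc Xc in \<open>auto intro!: finsum_closed\<close>)
  also have "\<dots> = (\<Oplus>c\<in>{..<k}. \<Oplus>x\<in>?X. \<Oplus>g\<in>F.
      if \<sigma> x p = r then A (a, c) g \<otimes> B (c, b) (inv\<^bsub>H\<^esub> g \<otimes>\<^bsub>H\<^esub> x) else \<zero>)"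
    using Ac[OF ab(1)] Bc[OF _ ab(2)] Fc Xc F X
    by (intro finsum_cong' finsum_swap) (auto intro!: finsum_closed)
  also have "\<dots> = (\<Oplus>x\<in>?X. \<Oplus>c\<in>{..<k}. \<Oplus>g\<in>F.
      if \<sigma> x p = r then A (a, c) g \<otimes> B (c, b) (inv\<^bsub>H\<^esub> g \<otimes>\<^bsub>H\<^esub> x) else \<zero>)"
    using Ac[OF ab(1)] Bc[OF _ ab(2)] Fc Xc F X
    by (intro finsum_swap) (auto intro!: finsum_closed)
  also have "\<dots> = (\<Oplus>x\<in>?X. if \<sigma> x p = r then (A \<otimes>\<^bsub>matrix_ring k KH\<^esub> B) (a, b) x else \<zero>)"
  proof (rule finsum_cong', goal_cases)
    case 2
    then show ?case using Xc matrix_entry_closed[OF ring.ring_simprules(5)[OF ring.ring_matrix_ring[OF ring_group_algebra]] ab] A B by auto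
  next
    case (3 x)
    have "(A \<otimes>\<^bsub>matrix_ring k KH\<^esub> B) (a, b) x
        = (\<Oplus>c\<in>{..<k}. \<Oplus>g\<in>F. A (a, c) g \<otimes> B (c, b) (inv\<^bsub>H\<^esub> g \<otimes>\<^bsub>H\<^esub> x))"
      using suppA ab Xc[OF 3] F by (intro matrix_group_algebra_mult A B) auto
    then show ?case by simp
  qed simp
  finally show ?thesis .
qed

text \<open>
  If \<open>u v = 1\<close> but \<open>f = 1 - v u\<close> is not zero, then \<open>f\<close> is idempotent, so some prime ideal \<open>P\<close> does
  not contain all its coefficients. The columns of the matrix of \<open>v\<close> at the points of \<open>S\<close> together with
  one column of the matrix of \<open>f\<close> at each point of \<open>D\<close> are more numerous than the rows, hence dependent
  modulo \<open>P\<close>. As \<open>u v = 1\<close> and \<open>u f = 0\<close>, applying \<open>u\<close> kills the coefficients at the columns of \<open>v\<close>,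
  and the columns of \<open>f\<close> have disjoint supports.
\<close>

theorem sofic_stably_finite:
  assumes "sofic H"
  shows "stably_finite KH"
  unfolding stably_finite_def
proof (intro allI impI)
  fix k :: nat assume k: "k \<ge> 1"
  let ?M = "matrix_ring k KH"
  interpret KH: ring KH by (rule ring_group_algebra)
  interpret M: ring ?M by (rule KH.ring_matrix_ring)
  show "dedekind_finite ?M"
  proof (rule M.dedekind_finiteI, rule ccontr)
    fix u v assume u: "u \<in> carrier ?M" and v: "v \<in> carrier ?M" and uv: "u \<otimes>\<^bsub>?M\<^esub> v = \<one>\<^bsub>?M\<^esub>"
      and "v \<otimes>\<^bsub>?M\<^esub> u \<noteq> \<one>\<^bsub>?M\<^esub>"
    obtain f where f: "f \<in> carrier ?M" and ff: "f \<otimes>\<^bsub>?M\<^esub> f = f"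
      and uf: "u \<otimes>\<^bsub>?M\<^esub> f = \<zero>\<^bsub>?M\<^esub>" and f1: "f \<oplus>\<^bsub>?M\<^esub> v \<otimes>\<^bsub>?M\<^esub> u = \<one>\<^bsub>?M\<^esub>"
      using M.one_sided_inverse_defect[OF u v uv] by blast
    have f0: "f \<noteq> \<zero>\<^bsub>?M\<^esub>" using u v \<open>v \<otimes>\<^bsub>?M\<^esub> u \<noteq> \<one>\<^bsub>?M\<^esub>\<close> f1 by auto
    obtain Fu where Fu: "finite Fu" "Fu \<subseteq> carrier H" "\<forall>i<k. \<forall>j<k. \<forall>a\<in>carrier H - Fu. u (i, j) a = \<zero>"
      by (rule matrix_support[OF u])
    obtain Fv where Fv: "finite Fv" "Fv \<subseteq> carrier H" "\<forall>i<k. \<forall>j<k. \<forall>a\<in>carrier H - Fv. v (i, j) a = \<zero>"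
      by (rule matrix_support[OF v])
    obtain Ff where Ff: "finite Ff" "Ff \<subseteq> carrier H" "\<forall>i<k. \<forall>j<k. \<forall>a\<in>carrier H - Ff. f (i, j) a = \<zero>"
      by (rule matrix_support[OF f])
    define F where "F = insert \<one>\<^bsub>H\<^esub> (Fu \<union> Fv \<union> Ff)"
    have F: "finite F" "F \<subseteq> carrier H" "\<one>\<^bsub>H\<^esub> \<in> F" using Fu Fv Ff by (auto simp: F_def)
    have supp: "\<forall>i<k. \<forall>j<k. \<forall>a\<in>carrier H - F. u (i, j) a = \<zero>"
      "\<forall>i<k. \<forall>j<k. \<forall>a\<in>carrier H - F. v (i, j) a = \<zero>"
      "\<forall>i<k. \<forall>j<k. \<forall>a\<in>carrier H - F. f (i, j) a = \<zero>"
      using Fu Fv Ff by (auto simp: F_def)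
    let ?S = "(\<lambda>(i, j, g). f (i, j) g) ` ({..<k} \<times> {..<k} \<times> F)"
    have fc: "f (i, j) g \<in> carrier K" if "i < k" "j < k" "g \<in> carrier H" for i j g
      using matrix_entry_closed[OF f that] .
    have "\<exists>P. primeideal P K \<and> \<not> ?S \<subseteq> P"
    proof (rule primeideal_not_containing)
      show "\<not> ?S \<subseteq> {\<zero>}"
      proof
        assume S0: "?S \<subseteq> {\<zero>}"
        obtain i j g where ij: "i < k" "j < k" "g \<in> carrier H" "f (i, j) g \<noteq> \<zero>"
          by (rule matrix_nonzero[OF f f0])
        then have "g \<in> F" using supp(3) by blast
        then have "f (i, j) g \<in> ?S" using ij by (intro image_eqI[of _ _ "(i, j, g)"]) auto
        then show False using S0 ij(4) by blast
      qed
      fix P assume P: "ideal P K" and prod: "\<And>s t. s \<in> ?S \<Longrightarrow> t \<in> ?S \<Longrightarrow> s \<otimes> t \<in> P"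
      interpret P: ideal P K by (rule P)
      have prod': "f (i, c) g \<otimes> f (c, j) h \<in> P"
        if "i < k" "j < k" "c < k" "g \<in> F" "h \<in> carrier H" for i j c g h
      proof (cases "h \<in> F")
        case True
        then show ?thesis using that by (intro prod) force+
      next
        case False
        then have "f (c, j) h = \<zero>" using supp that by auto
        then show ?thesis using fc[of i c g] that F P.zero_closed by auto
      qed
      \<comment> \<open>As f = ff, each coefficient of f is a sum of products of two coefficients of
        f.\<close>
      show "?S \<subseteq> P"
      proof clarify
        fix i j g assume ij: "i < k" "j < k" and g: "g \<in> F"
        have "f (i, j) g = (\<Oplus>c\<in>{..<k}. \<Oplus>a\<in>F. f (i, c) a \<otimes> f (c, j) (inv\<^bsub>H\<^esub> a \<otimes>\<^bsub>H\<^esub> g))"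
          using matrix_group_algebra_mult[OF f f ij _ F(1,2), of g] supp ij g F ff by auto
        also have "\<dots> \<in> P"
          using ij g F by (intro P.finsum_in_ideal prod') auto
        finally show "f (i, j) g \<in> P" .
      qed
    qed (use fc F in auto)
    then obtain P a0 b0 g0 where P: "primeideal P K"
      and 0: "a0 < k" "b0 < k" "g0 \<in> F" "f (a0, b0) g0 \<notin> P" by auto
    interpret P: primeideal P K by (rule P)
    obtain n \<sigma> S D where S: "S \<subseteq> {1..n}" "D \<subseteq> S" "k * n < k * card S + card D"
      and perm: "\<And>g. g \<in> carrier H \<Longrightarrow> \<sigma> g permutes {1..n}"
      and hom: "\<And>p g h. p \<in> S \<Longrightarrow> g \<in> F \<Longrightarrow> h \<in> F \<Longrightarrow> \<sigma> g (\<sigma> h p) = \<sigma> (g \<otimes>\<^bsub>H\<^esub> h) p"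
      and free: "\<And>p g h. p \<in> S \<Longrightarrow> g \<in> F \<Longrightarrow> h \<in> F \<Longrightarrow> \<sigma> g p = \<sigma> h p \<Longrightarrow> g = h"
      and disj: "\<And>p q g h. p \<in> D \<Longrightarrow> q \<in> D \<Longrightarrow> g \<in> F \<Longrightarrow> h \<in> F \<Longrightarrow> \<sigma> g p = \<sigma> h q \<Longrightarrow> p = q"
      by (rule sofic_points[OF assms F]) blast
    have fin: "finite S" "finite D" using S by (auto intro: finite_subset)
    let ?J = "{1..n} \<times> {..<k}"
    \<comment> \<open>The disjoint sum keeps apart a column of v and the column of f over the same
      point. For f only the column index b0 is used, that of the coefficient outside P.\<close>
    let ?C = "(S \<times> {..<k}) <+> D"
    define X where "X = (\<lambda>(g, h). g \<otimes>\<^bsub>H\<^esub> h) ` (F \<times> F)"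
    have X: "finite X" "X \<subseteq> carrier H" using F by (auto simp: X_def)
    have "\<one>\<^bsub>H\<^esub> \<otimes>\<^bsub>H\<^esub> \<one>\<^bsub>H\<^esub> \<in> X" using F(3) unfolding X_def by force
    then have X1: "\<one>\<^bsub>H\<^esub> \<in> X" by simp
    \<comment> \<open>\<sigma> need not send the identity to the identity; at a good point this
      follows from the relation for the product of the identity with itself, since \<sigma> of the
      identity is injective.\<close>
    have \<sigma>1: "\<sigma> \<one>\<^bsub>H\<^esub> p = p" if "p \<in> S" for p
    proof -
      have "\<sigma> \<one>\<^bsub>H\<^esub> (\<sigma> \<one>\<^bsub>H\<^esub> p) = \<sigma> \<one>\<^bsub>H\<^esub> p" using hom[OF that F(3) F(3)] by simp
      then show ?thesis using permutes_inj[OF perm[OF H.one_closed]] by (auto dest: injD)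
    qed
    define Q where "Q s i = (case i of Inl t \<Rightarrow> sofic_matrix F \<sigma> v s t
      | Inr j \<Rightarrow> sofic_matrix F \<sigma> f s (j, b0))" for s i
    have Qc: "Q s i \<in> carrier K" if "s \<in> ?J" "i \<in> ?C" for s i
      using that 0 sofic_matrix_closed[OF v F(2)] sofic_matrix_closed[OF f F(2)]
      by (auto simp: Q_def)
    have Uc: "sofic_matrix F \<sigma> u s t \<in> carrier K" if "s \<in> ?J" "t \<in> ?J" for s t
      using that sofic_matrix_closed[OF u F(2)] by auto
    have "card ?J < card ?C"
      using S(3) fin by (simp add: card_Plus mult.commute)
    then obtain c where c: "c \<in> ?C \<rightarrow> carrier K" "\<exists>i\<in>?C. c i \<notin> P"
      "\<forall>s\<in>?J. (\<Oplus>i\<in>?C. c i \<otimes> Q s i) \<in> P"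
      using P.linear_dependence[OF carrier_is_subring, of ?J ?C Q] Qc fin by auto
    have cc: "c i \<in> carrier K" if "i \<in> ?C" for i using that c(1) by blast
    have N: "(\<Oplus>s\<in>?J. sofic_matrix F \<sigma> u t s \<otimes> Q s i) = (if i = Inl t then \<one> else \<zero>)"
      if t: "t \<in> ?J" and i: "i \<in> ?C" for t i
    proof -
      obtain r a where ra: "t = (r, a)" "a < k" using t by auto
      have pts: "\<sigma> g p \<in> {1..n}" if "g \<in> F" "p \<in> S" for g p
        using permutes_in_image[OF perm] that S(1) F(2) by (metis subsetD)
      show ?thesis
      proof (cases i)
        case (Inl pb)
        then obtain p b where pb: "pb = (p, b)" "p \<in> S" "b < k" using i by auto
        have "(\<Oplus>s\<in>?J. sofic_matrix F \<sigma> u (r, a) s \<otimes> sofic_matrix F \<sigma> v s (p, b))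
            = (\<Oplus>x\<in>X. if \<sigma> x p = r then \<one>\<^bsub>?M\<^esub> (a, b) x else \<zero>)"
          unfolding X_def uv[symmetric]
          using pb ra hom pts by (intro sofic_matrix_mult[OF u v F(1,2) supp(1,2)]) auto
        also have "\<dots> = (\<Oplus>x\<in>X. if x = \<one>\<^bsub>H\<^esub> then (if i = Inl t then \<one> else \<zero>) else \<zero>)"
          using \<sigma>1[OF pb(2)] X ra pb Inl
          by (intro finsum_cong') (auto simp: matrix_ring_one group_algebra_one group_algebra_zero subset_iff)
        also have "\<dots> = (if i = Inl t then \<one> else \<zero>)"
          using X X1 by (intro finsum_delta) auto
        finally show ?thesis using Inl ra pb by (simp add: Q_def)
      next
        case (Inr j)
        then have j: "j \<in> S" using i S by auto
        have "(\<Oplus>s\<in>?J. sofic_matrix F \<sigma> u (r, a) s \<otimes> sofic_matrix F \<sigma> f s (j, b0))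
            = (\<Oplus>x\<in>X. if \<sigma> x j = r then \<zero>\<^bsub>?M\<^esub> (a, b0) x else \<zero>)"
          unfolding X_def uf[symmetric]
          using j ra hom pts 0 by (intro sofic_matrix_mult[OF u f F(1,2) supp(1,3)]) auto
        also have "\<dots> = (\<Oplus>x\<in>X. \<zero>)"
          using X ra 0 by (intro finsum_cong') (auto simp: matrix_ring_zero group_algebra_zero subset_iff)
        finally show ?thesis using Inr ra by (simp add: Q_def)
      qed
    qed
    have inl: "c (Inl t) \<in> P" if t: "t \<in> S \<times> {..<k}" for t
    proof -
      have tJ: "t \<in> ?J" and tC: "Inl t \<in> ?C" using t S(1) by auto
      have "c (Inl t) = (\<Oplus>i\<in>?C. if i = Inl t then c i else \<zero>)"
        using tC cc fin by (intro finsum_delta[symmetric]) auto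
      also have "\<dots> = (\<Oplus>i\<in>?C. \<Oplus>s\<in>?J. sofic_matrix F \<sigma> u t s \<otimes> (c i \<otimes> Q s i))"
      proof (rule finsum_cong')
        fix i assume i: "i \<in> ?C"
        have "(\<Oplus>s\<in>?J. sofic_matrix F \<sigma> u t s \<otimes> (c i \<otimes> Q s i))
            = (\<Oplus>s\<in>?J. c i \<otimes> (sofic_matrix F \<sigma> u t s \<otimes> Q s i))"
          using i cc Qc Uc tJ by (intro finsum_cong') (auto simp: m_lcomm)
        also have "\<dots> = c i \<otimes> (\<Oplus>s\<in>?J. sofic_matrix F \<sigma> u t s \<otimes> Q s i)"
          using i cc[OF i] Qc Uc tJ by (intro finsum_rdistr[symmetric]) auto
        also have "\<dots> = (if i = Inl t then c i else \<zero>)" using N[OF tJ i] cc[OF i] by auto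
        finally show "(if i = Inl t then c i else \<zero>)
            = (\<Oplus>s\<in>?J. sofic_matrix F \<sigma> u t s \<otimes> (c i \<otimes> Q s i))" ..
      qed (use cc Qc Uc tJ in \<open>auto intro!: finsum_closed\<close>)
      also have "\<dots> = (\<Oplus>s\<in>?J. \<Oplus>i\<in>?C. sofic_matrix F \<sigma> u t s \<otimes> (c i \<otimes> Q s i))"
        using cc Qc Uc tJ fin by (intro finsum_swap) auto
      also have "\<dots> = (\<Oplus>s\<in>?J. sofic_matrix F \<sigma> u t s \<otimes> (\<Oplus>i\<in>?C. c i \<otimes> Q s i))"
        using cc Qc Uc tJ fin
        by (intro finsum_cong' finsum_rdistr[symmetric]) (auto intro!: finsum_closed)
      also have "\<dots> \<in> P"
      proof (rule P.finsum_in_ideal)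
        fix s assume "s \<in> ?J"
        then show "sofic_matrix F \<sigma> u t s \<otimes> (\<Oplus>i\<in>?C. c i \<otimes> Q s i) \<in> P"
          using P.I_l_closed[OF bspec[OF c(3)] Uc[OF tJ]] by blast
      qed
      finally show ?thesis .
    qed
    have inr: "c (Inr j) \<in> P" if j: "j \<in> D" for j
    proof -
      \<comment> \<open>In this row the column of f over a point i of D has the entry f (a0, b0) g0
        if i = j, and 0 otherwise: disjointness of the translates gives i = j, and freeness at j
        then gives g = g0. So the row isolates \<open>c (Inr j)\<close> modulo P.\<close>
      let ?s = "(\<sigma> g0 j, a0)"
      have jS: "j \<in> S" using j S by auto
      have s: "?s \<in> ?J"
        using permutes_in_image[OF perm] 0(1,3) jS S(1) F(2)
        by (metis SigmaI lessThan_iff subsetD)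
      have Q: "Q ?s (Inr i) = (if i = j then f (a0, b0) g0 else \<zero>)" if "i \<in> D" for i
      proof -
        have "Q ?s (Inr i) = (\<Oplus>g\<in>F. if g = g0 then (if i = j then f (a0, b0) g else \<zero>) else \<zero>)"
          unfolding Q_def sofic_matrix_def sum.case prod.case
        proof (rule finsum_cong')
          fix g assume g: "g \<in> F"
          have "(\<sigma> g i = \<sigma> g0 j) = (g = g0 \<and> i = j)"
            using free[OF jS] disj[OF that j] g 0(3) by metis
          then show "(if \<sigma> g i = \<sigma> g0 j then f (a0, b0) g else \<zero>)
              = (if g = g0 then (if i = j then f (a0, b0) g else \<zero>) else \<zero>)"
            by simp
        qed (use fc[OF 0(1,2)] F in auto)
        also have "\<dots> = (if i = j then f (a0, b0) g0 else \<zero>)"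
          using 0 fc[OF 0(1,2)] F by (intro finsum_delta) auto
        finally show ?thesis .
      qed
      have f0c: "f (a0, b0) g0 \<in> carrier K" using fc 0 F by auto
      let ?C' = "?C - {Inr j}"
      have jC: "Inr j \<in> ?C" "?C = insert (Inr j) ?C'" using j by auto
      have rest: "(\<Oplus>i\<in>?C'. c i \<otimes> Q ?s i) \<in> P"
      proof (rule P.finsum_in_ideal)
        fix i assume i: "i \<in> ?C'"
        show "c i \<otimes> Q ?s i \<in> P"
        proof (cases i)
          case (Inl t)
          then show ?thesis using i inl Qc[OF s, of i] by (intro P.I_r_closed) auto
        next
          case (Inr j')
          then have "Q ?s i = \<zero>" using Q i by auto
          then show ?thesis using i cc[of i] P.zero_closed by simp
        qed
      qed
      have "(\<Oplus>i\<in>?C. c i \<otimes> Q ?s i) = c (Inr j) \<otimes> Q ?s (Inr j) \<oplus> (\<Oplus>i\<in>?C'. c i \<otimes> Q ?s i)"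
        using cc Qc[OF s] fin j by (subst jC(2), intro finsum_insert) auto
      then have "c (Inr j) \<otimes> f (a0, b0) g0 \<oplus> (\<Oplus>i\<in>?C'. c i \<otimes> Q ?s i) \<in> P"
        using bspec[OF c(3) s] Q[OF j] by (simp only: if_True refl)
      then have "c (Inr j) \<otimes> f (a0, b0) g0 \<in> P"
        using P.ideal_add_cancel[OF _ rest] cc[OF jC(1)] f0c by blast
      then show ?thesis using P.I_prime[OF cc[OF jC(1)] f0c] 0 by blast
    qed
    show False using c(2) inl inr by auto
  qed
qed

end

section \<open>Idempotents of trace zero over the complex numbers\<close>

text \<open>The inner product on finitely supported functions, linear in the first argument. Summing
  over the support of that argument avoids an ambient index set; \<open>ip_sum\<close> exchanges it
  for any convenient finite set.\<close>

definition ip :: "('i \<Rightarrow> complex) \<Rightarrow> ('i \<Rightarrow> complex) \<Rightarrow> complex"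
  where "ip \<alpha> \<beta> = (\<Sum>p | \<alpha> p \<noteq> 0. \<alpha> p * cnj (\<beta> p))"

definition nrm :: "('i \<Rightarrow> complex) \<Rightarrow> real"
  where "nrm \<alpha> = L2_set (\<lambda>p. cmod (\<alpha> p)) {p. \<alpha> p \<noteq> 0}"

abbreviation fin_supp :: "('i \<Rightarrow> complex) \<Rightarrow> bool"
  where "fin_supp \<alpha> \<equiv> finite {p. \<alpha> p \<noteq> 0}"

lemma ip_sum:
  assumes "finite S" "fin_supp \<alpha>" "\<And>p. p \<notin> S \<Longrightarrow> \<alpha> p = 0 \<or> \<beta> p = 0"
  shows "ip \<alpha> \<beta> = (\<Sum>p\<in>S. \<alpha> p * cnj (\<beta> p))"
proof -
  have "ip \<alpha> \<beta> = (\<Sum>p\<in>S \<union> {p. \<alpha> p \<noteq> 0}. \<alpha> p * cnj (\<beta> p))"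
    unfolding ip_def using assms by (intro sum.mono_neutral_left) auto
  also have "\<dots> = (\<Sum>p\<in>S. \<alpha> p * cnj (\<beta> p))"
    using assms by (intro sum.mono_neutral_right) auto
  finally show ?thesis .
qed

lemma nrm_sum:
  assumes "finite S" "\<And>p. p \<notin> S \<Longrightarrow> \<alpha> p = 0"
  shows "(nrm \<alpha>)\<^sup>2 = (\<Sum>p\<in>S. (cmod (\<alpha> p))\<^sup>2)"
proof -
  have "{p. \<alpha> p \<noteq> 0} \<subseteq> S" using assms(2) by auto
  then have "(\<Sum>p | \<alpha> p \<noteq> 0. (cmod (\<alpha> p))\<^sup>2) = (\<Sum>p\<in>S. (cmod (\<alpha> p))\<^sup>2)"
    using assms by (intro sum.mono_neutral_left) auto
  then show ?thesis by (simp add: nrm_def L2_set_def sum_nonneg)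
qed

lemma nrm_nonneg [simp]: "nrm \<alpha> \<ge> 0"
  by (simp add: nrm_def)

lemma ip_self: "ip \<alpha> \<alpha> = of_real ((nrm \<alpha>)\<^sup>2)"
  by (simp add: ip_def nrm_def L2_set_def sum_nonneg complex_norm_square del: of_real_power)

lemma ip_commute:
  assumes "fin_supp \<alpha>" "fin_supp \<beta>"
  shows "ip \<beta> \<alpha> = cnj (ip \<alpha> \<beta>)"
proof -
  let ?S = "{p. \<alpha> p \<noteq> 0} \<union> {p. \<beta> p \<noteq> 0}"
  have "ip \<beta> \<alpha> = (\<Sum>p\<in>?S. \<beta> p * cnj (\<alpha> p))" "ip \<alpha> \<beta> = (\<Sum>p\<in>?S. \<alpha> p * cnj (\<beta> p))"
    using assms by (auto intro!: ip_sum)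
  then show ?thesis by (simp add: mult.commute)
qed

lemma norm_ip_le:
  assumes "fin_supp \<alpha>" "fin_supp \<beta>"
  shows "cmod (ip \<alpha> \<beta>) \<le> nrm \<alpha> * nrm \<beta>"
proof -
  let ?S = "{p. \<alpha> p \<noteq> 0} \<union> {p. \<beta> p \<noteq> 0}"
  have "ip \<alpha> \<beta> = (\<Sum>p\<in>?S. \<alpha> p * cnj (\<beta> p))" using assms by (auto intro!: ip_sum)
  then have "cmod (ip \<alpha> \<beta>) \<le> (\<Sum>p\<in>?S. \<bar>cmod (\<alpha> p)\<bar> * \<bar>cmod (\<beta> p)\<bar>)"
    using norm_sum[of "\<lambda>p. \<alpha> p * cnj (\<beta> p)" ?S] by (simp add: norm_mult)
  also have "\<dots> \<le> L2_set (\<lambda>p. cmod (\<alpha> p)) ?S * L2_set (\<lambda>p. cmod (\<beta> p)) ?S"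
    by (rule L2_set_mult_ineq)
  also have "L2_set (\<lambda>p. cmod (\<alpha> p)) ?S = nrm \<alpha>"
    unfolding nrm_def L2_set_def using assms by (subst sum.mono_neutral_right[of ?S "{p. \<alpha> p \<noteq> 0}"]) auto
  also have "L2_set (\<lambda>p. cmod (\<beta> p)) ?S = nrm \<beta>"
    unfolding nrm_def L2_set_def using assms by (subst sum.mono_neutral_right[of ?S "{p. \<beta> p \<noteq> 0}"]) auto
  finally show ?thesis .
qed

lemma norm_le_nrm:
  assumes "fin_supp \<alpha>"
  shows "cmod (\<alpha> p) \<le> nrm \<alpha>"
proof (cases "\<alpha> p = 0")
  case False
  then show ?thesis
    unfolding nrm_def using assms member_le_L2_set[of "{p. \<alpha> p \<noteq> 0}" p "\<lambda>p. cmod (\<alpha> p)"] by simp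
qed simp

text \<open>Approximates the orthogonal projection of \<open>\<delta>\<close> to the closure of \<open>L\<close>.\<close>

lemma approximate_projection:
  assumes L: "\<And>\<alpha>. \<alpha> \<in> L \<Longrightarrow> fin_supp \<alpha>" "L \<noteq> {}"
    and lin: "\<And>\<alpha> \<beta> t. \<alpha> \<in> L \<Longrightarrow> \<beta> \<in> L \<Longrightarrow> (\<lambda>p. \<alpha> p + t * \<beta> p) \<in> L"
    and \<delta>: "fin_supp \<delta>" and \<epsilon>: "\<epsilon> > 0"
  shows "\<exists>\<alpha>\<in>L. \<forall>\<beta>\<in>L. cmod (ip \<beta> \<delta> - ip \<beta> \<alpha>) \<le> \<epsilon> * nrm \<beta>"
proof -
  define X where "X = (\<lambda>\<alpha>. (nrm (\<lambda>p. \<delta> p - \<alpha> p))\<^sup>2) ` L"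
  have X: "X \<noteq> {}" "bdd_below X" using L by (auto simp: X_def intro!: bdd_belowI[of _ 0])
  \<comment> \<open>A near-minimizer of the distance from \<delta> to L; as L need not be complete,
    there may be no minimizer.\<close>
  then obtain \<alpha> where \<alpha>: "\<alpha> \<in> L" and less: "(nrm (\<lambda>p. \<delta> p - \<alpha> p))\<^sup>2 < Inf X + \<epsilon>\<^sup>2"
    using cInf_lessD[of X "Inf X + \<epsilon>\<^sup>2"] \<epsilon> by (auto simp: X_def)
  show ?thesis
  proof (intro bexI[OF _ \<alpha>] ballI)
    fix \<beta> assume \<beta>: "\<beta> \<in> L"
    let ?S = "{p. \<alpha> p \<noteq> 0} \<union> {p. \<beta> p \<noteq> 0} \<union> {p. \<delta> p \<noteq> 0}"
    have S: "finite ?S" using L(1)[OF \<alpha>] L(1)[OF \<beta>] \<delta> by simp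
    define z where "z = ip \<beta> \<delta> - ip \<beta> \<alpha>"
    define N where "N = (nrm \<beta>)\<^sup>2"
    have z: "z = (\<Sum>p\<in>?S. \<beta> p * cnj (\<delta> p - \<alpha> p))"
    proof -
      have "ip \<beta> \<delta> = (\<Sum>p\<in>?S. \<beta> p * cnj (\<delta> p))" "ip \<beta> \<alpha> = (\<Sum>p\<in>?S. \<beta> p * cnj (\<alpha> p))"
        using S L(1)[OF \<beta>] by (auto intro!: ip_sum)
      then show ?thesis by (simp add: z_def sum_subtractf algebra_simps)
    qed
    show "cmod (ip \<beta> \<delta> - ip \<beta> \<alpha>) \<le> \<epsilon> * nrm \<beta>"
    proof (cases "N = 0")
      case True
      then have "\<beta> p = 0" for p using norm_le_nrm[OF L(1)[OF \<beta>], of p] by (simp add: N_def)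
      then show ?thesis using \<epsilon> by (simp add: ip_def)
    next
      case False
      then have N: "N > 0" by (simp add: N_def)
      \<comment> \<open>The value at which the distance from \<delta> to \<alpha> + t \<beta> is
        least. It lowers the squared distance by |z|^2 / N, which is therefore below
        \<epsilon>^2.\<close>
      define t where "t = cnj z / of_real N"
      have "(\<lambda>p. \<alpha> p + t * \<beta> p) \<in> L" by (rule lin[OF \<alpha> \<beta>])
      then have "Inf X \<le> (nrm (\<lambda>p. \<delta> p - (\<alpha> p + t * \<beta> p)))\<^sup>2"
        using X by (auto simp: X_def intro!: cInf_lower)
      also have "\<dots> = (\<Sum>p\<in>?S. (cmod (\<delta> p - (\<alpha> p + t * \<beta> p)))\<^sup>2)"
        using S by (intro nrm_sum) auto
      also have "\<dots> = (\<Sum>p\<in>?S. (cmod (\<delta> p - \<alpha> p))\<^sup>2 - 2 * Re (t * (\<beta> p * cnj (\<delta> p - \<alpha> p)))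
          + (cmod t)\<^sup>2 * (cmod (\<beta> p))\<^sup>2)"
      proof (rule sum.cong[OF refl])
        fix p
        have "(cmod (x - y))\<^sup>2 = (cmod x)\<^sup>2 - 2 * Re (y * cnj x) + (cmod y)\<^sup>2" for x y :: complex
          by (simp only: cmod_power2) (simp add: power2_eq_square algebra_simps)
        from this[of "\<delta> p - \<alpha> p" "t * \<beta> p"]
        show "(cmod (\<delta> p - (\<alpha> p + t * \<beta> p)))\<^sup>2 = (cmod (\<delta> p - \<alpha> p))\<^sup>2
          - 2 * Re (t * (\<beta> p * cnj (\<delta> p - \<alpha> p))) + (cmod t)\<^sup>2 * (cmod (\<beta> p))\<^sup>2"
          by (simp add: norm_mult power_mult_distrib mult.assoc diff_diff_eq)
      qed
      also have "\<dots> = (\<Sum>p\<in>?S. (cmod (\<delta> p - \<alpha> p))\<^sup>2) - 2 * Re (t * z) + (cmod t)\<^sup>2 * N"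
      proof -
        have "N = (\<Sum>p\<in>?S. (cmod (\<beta> p))\<^sup>2)" unfolding N_def using S by (intro nrm_sum) auto
        moreover have "Re (t * z) = (\<Sum>p\<in>?S. Re (t * (\<beta> p * cnj (\<delta> p - \<alpha> p))))"
          unfolding z by (simp only: sum_distrib_left Re_sum)
        ultimately show ?thesis
          by (simp only: sum.distrib sum_subtractf sum_distrib_left)
      qed
      also have "(\<Sum>p\<in>?S. (cmod (\<delta> p - \<alpha> p))\<^sup>2) = (nrm (\<lambda>p. \<delta> p - \<alpha> p))\<^sup>2"
        using S by (intro nrm_sum[symmetric]) auto
      also have "t * z = of_real ((cmod z)\<^sup>2 / N)"
        by (simp only: t_def of_real_divide complex_norm_square times_divide_eq_left mult.commute[of "cnj z"])
      also have "cmod t = cmod z / N" using N by (simp add: t_def norm_divide)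
      finally have "Inf X \<le> (nrm (\<lambda>p. \<delta> p - \<alpha> p))\<^sup>2 - (cmod z)\<^sup>2 / N"
        using N by (simp add: power_divide power2_eq_square)
      with less have "(cmod z)\<^sup>2 / N < \<epsilon>\<^sup>2" by simp
      then have "(cmod z)\<^sup>2 < \<epsilon>\<^sup>2 * N" using N by (simp add: divide_simps)
      also have "\<dots> = (\<epsilon> * nrm \<beta>)\<^sup>2" by (simp add: N_def power_mult_distrib)
      finally have "cmod z < \<epsilon> * nrm \<beta>"
        by (rule power_less_imp_less_base) (use \<epsilon> in simp)
      then show ?thesis by (simp add: z_def)
    qed
  qed
qed

text \<open>
  Kaplansky's theorem: let \<open>L\<close> be the space of columns fixed by \<open>e\<close>, and \<open>\<alpha>\<^sub>j\<close> an approximate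
  projection of the \<open>j\<close>-th basis vector to \<open>L\<close>. Since \<open>L\<close> is invariant under right translations, the
  matrix with columns \<open>\<alpha>\<^sub>j\<close> is approximately self-adjoint, and its trace is close both to the trace of
  \<open>e\<close> and to the sum of the squared norms of the \<open>\<alpha>\<^sub>j\<close>.
\<close>

lemma (in group) idempotent_trace_zero:
  fixes e :: "nat \<Rightarrow> nat \<Rightarrow> 'a \<Rightarrow> complex"
  assumes F: "finite F" "F \<subseteq> carrier G"
    and supp: "\<And>i j x. i < k \<Longrightarrow> j < k \<Longrightarrow> x \<in> carrier G - F \<Longrightarrow> e i j x = 0"
    and idem: "\<And>i j x. i < k \<Longrightarrow> j < k \<Longrightarrow> x \<in> carrier G \<Longrightarrow>
      e i j x = (\<Sum>c<k. \<Sum>a\<in>F. e i c a * e c j (inv a \<otimes> x))"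
    and trace: "(\<Sum>i<k. e i i \<one>) = 0"
    and ij: "i0 < k" "j0 < k" "g0 \<in> carrier G"
  shows "e i0 j0 g0 = 0"
proof -
  define \<Omega> where "\<Omega> = {..<k} \<times> carrier G"
  define L where "L = {\<alpha>. fin_supp \<alpha> \<and> (\<forall>p. p \<notin> \<Omega> \<longrightarrow> \<alpha> p = 0) \<and>
    (\<forall>i<k. \<forall>x\<in>carrier G. \<alpha> (i, x) = (\<Sum>c<k. \<Sum>a\<in>F. e i c a * \<alpha> (c, inv a \<otimes> x)))}"
  \<comment> \<open>Right translation by g. It commutes with left convolution by e, so it preserves
    L, and it only permutes coordinates, so it preserves \<open>ip\<close>.\<close>
  define R where "R g \<alpha> = (\<lambda>(i, x). if x \<in> carrier G then \<alpha> (i, x \<otimes> inv g) else 0)"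
    for g and \<alpha> :: "nat \<times> 'a \<Rightarrow> complex"
  have cancel: "x \<otimes> inv g \<otimes> g = x" "x \<otimes> g \<otimes> inv g = x" if "x \<in> carrier G" "g \<in> carrier G" for x g
    using that by (simp_all add: m_assoc)
  have L_fin: "fin_supp \<alpha>" if "\<alpha> \<in> L" for \<alpha> using that by (simp add: L_def)
  have L_lin: "(\<lambda>p. \<alpha> p + t * \<beta> p) \<in> L" if "\<alpha> \<in> L" "\<beta> \<in> L" for \<alpha> \<beta> t
  proof -
    have "{p. \<alpha> p + t * \<beta> p \<noteq> 0} \<subseteq> {p. \<alpha> p \<noteq> 0} \<union> {p. \<beta> p \<noteq> 0}" by auto
    then have "fin_supp (\<lambda>p. \<alpha> p + t * \<beta> p)" using that by (auto simp: L_def intro: finite_subset)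
    then show ?thesis using that
      by (simp add: L_def sum.distrib distrib_left sum_distrib_left mult.left_commute)
  qed
  have R_supp: "{p. R g \<alpha> p \<noteq> 0} = (\<lambda>(i, x). (i, x \<otimes> g)) ` {p. \<alpha> p \<noteq> 0}"
    if "\<forall>p. p \<notin> \<Omega> \<longrightarrow> \<alpha> p = 0" "g \<in> carrier G" for g \<alpha>
  proof (intro equalityI subsetI)
    fix p assume "p \<in> {p. R g \<alpha> p \<noteq> 0}"
    then obtain i x where p: "p = (i, x)" "x \<in> carrier G" "\<alpha> (i, x \<otimes> inv g) \<noteq> 0"
      by (cases p) (auto simp: R_def split: if_splits)
    then show "p \<in> (\<lambda>(i, x). (i, x \<otimes> g)) ` {p. \<alpha> p \<noteq> 0}"
      using cancel that by (intro image_eqI[of _ _ "(i, x \<otimes> inv g)"]) auto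
  next
    fix p assume "p \<in> (\<lambda>(i, x). (i, x \<otimes> g)) ` {p. \<alpha> p \<noteq> 0}"
    then obtain i x where p: "p = (i, x \<otimes> g)" "\<alpha> (i, x) \<noteq> 0" by auto
    then have "x \<in> carrier G" using that by (auto simp: \<Omega>_def)
    then show "p \<in> {p. R g \<alpha> p \<noteq> 0}" using p that cancel by (simp add: R_def)
  qed
  have R_ip: "ip (R g \<alpha>) (R g \<beta>) = ip \<alpha> \<beta>"
    if "\<forall>p. p \<notin> \<Omega> \<longrightarrow> \<alpha> p = 0" "g \<in> carrier G" for g \<alpha> \<beta>
    unfolding ip_def R_supp[OF that]
  proof (subst sum.reindex)
    have sub: "p \<in> \<Omega>" if "\<alpha> p \<noteq> 0" for p using that \<open>\<forall>p. p \<notin> \<Omega> \<longrightarrow> \<alpha> p = 0\<close> by blast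
    show "inj_on (\<lambda>(i, x). (i, x \<otimes> g)) {p. \<alpha> p \<noteq> 0}"
      using that(2) sub by (force simp: inj_on_def \<Omega>_def)
    show "(\<Sum>p | \<alpha> p \<noteq> 0. ((\<lambda>p. R g \<alpha> p * cnj (R g \<beta> p)) \<circ> (\<lambda>(i, x). (i, x \<otimes> g))) p)
        = (\<Sum>p | \<alpha> p \<noteq> 0. \<alpha> p * cnj (\<beta> p))"
      using that(2) sub cancel by (intro sum.cong) (auto simp: R_def \<Omega>_def)
  qed
  have R_nrm: "nrm (R g \<alpha>) = nrm \<alpha>" if "\<forall>p. p \<notin> \<Omega> \<longrightarrow> \<alpha> p = 0" "g \<in> carrier G" for g \<alpha>
  proof -
    have "complex_of_real ((nrm (R g \<alpha>))\<^sup>2) = of_real ((nrm \<alpha>)\<^sup>2)"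
      using R_ip[OF that] by (simp only: ip_self[symmetric])
    then show ?thesis by (simp only: of_real_eq_iff power2_eq_iff_nonneg nrm_nonneg)
  qed
  have R_L: "R g \<alpha> \<in> L" if \<alpha>: "\<alpha> \<in> L" and g: "g \<in> carrier G" for g \<alpha>
  proof -
    have \<alpha>0: "\<forall>p. p \<notin> \<Omega> \<longrightarrow> \<alpha> p = 0" using \<alpha> by (simp add: L_def)
    have "fin_supp (R g \<alpha>)" unfolding R_supp[OF \<alpha>0 g] using L_fin[OF \<alpha>] by simp
    moreover have "R g \<alpha> p = 0" if "p \<notin> \<Omega>" for p
      using that \<alpha>0 g by (cases p) (auto simp: R_def \<Omega>_def)
    moreover have "R g \<alpha> (i, x) = (\<Sum>c<k. \<Sum>a\<in>F. e i c a * R g \<alpha> (c, inv a \<otimes> x))"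
      if "i < k" "x \<in> carrier G" for i x
    proof -
      have "R g \<alpha> (i, x) = (\<Sum>c<k. \<Sum>a\<in>F. e i c a * \<alpha> (c, inv a \<otimes> (x \<otimes> inv g)))"
        using \<alpha> that g by (simp add: R_def L_def)
      also have "\<dots> = (\<Sum>c<k. \<Sum>a\<in>F. e i c a * R g \<alpha> (c, inv a \<otimes> x))"
        using F that g by (intro sum.cong) (auto simp: R_def m_assoc subset_iff)
      finally show ?thesis .
    qed
    ultimately show ?thesis by (simp add: L_def)
  qed
  \<comment> \<open>The columns of e, cut off outside \<Omega>. They lie in L because ee =
    e.\<close>
  define E where "E j = (\<lambda>(i, x). if (i, x) \<in> \<Omega> then e i j x else 0)" for j
  have E_supp: "{p. E j p \<noteq> 0} \<subseteq> {..<k} \<times> F" if "j < k" for j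
  proof clarify
    fix i x assume "E j (i, x) \<noteq> 0"
    then have "i < k" "x \<in> carrier G" "e i j x \<noteq> 0" by (auto simp: E_def \<Omega>_def split: if_splits)
    then show "i \<in> {..<k} \<and> x \<in> F" using supp[OF _ that, of i x] by blast
  qed
  have E_L: "E j \<in> L" if "j < k" for j
  proof -
    have "fin_supp (E j)" using E_supp[OF that] F by (meson finite_SigmaI finite_lessThan finite_subset)
    moreover have "E j (i, x) = (\<Sum>c<k. \<Sum>a\<in>F. e i c a * E j (c, inv a \<otimes> x))"
      if "i < k" "x \<in> carrier G" for i x
    proof -
      have "E j (i, x) = (\<Sum>c<k. \<Sum>a\<in>F. e i c a * e c j (inv a \<otimes> x))"
        using idem[OF that(1) \<open>j < k\<close> that(2)] that by (simp add: E_def \<Omega>_def)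
      also have "\<dots> = (\<Sum>c<k. \<Sum>a\<in>F. e i c a * E j (c, inv a \<otimes> x))"
        using F that by (intro sum.cong) (auto simp: E_def \<Omega>_def subset_iff)
      finally show ?thesis .
    qed
    ultimately show ?thesis by (auto simp: L_def E_def)
  qed
  \<comment> \<open>The three summands bound, in units of \<epsilon>, the errors made in
    \<open>d1\<close>, \<open>d2\<close> and \<open>d3\<close> on the way from the trace of e to the
    sum of the squared norms. None of them depends on \<epsilon>.\<close>
  define C1 where "C1 = (\<Sum>j<k. nrm (E j)) + 4 * (\<Sum>j<k. \<Sum>i<k. \<Sum>g\<in>F. cmod (e i j g)) + 2 * k"
  have key: "cmod (e i0 j0 g0) \<le> nrm (E j0) * (sqrt (\<epsilon> * C1) + \<epsilon>)" if \<epsilon>: "0 < \<epsilon>" "\<epsilon> < 1" for \<epsilon>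
  proof -
    define \<delta> where "\<delta> j p = (if p = (j, \<one>) then 1 else 0 :: complex)" for j and p :: "nat \<times> 'a"
    have \<delta>_supp: "{p. \<delta> j p \<noteq> 0} = {(j, \<one>)}" for j by (auto simp: \<delta>_def)
    have "\<exists>\<alpha>\<in>L. \<forall>\<beta>\<in>L. cmod (ip \<beta> (\<delta> j) - ip \<beta> \<alpha>) \<le> \<epsilon> * nrm \<beta>" for j
      using E_L[OF ij(1)] L_fin L_lin \<epsilon>(1)
      by (intro approximate_projection) (auto simp: \<delta>_supp)
    then obtain \<alpha> where \<alpha>: "\<And>j. \<alpha> j \<in> L"
      and proj: "\<And>j \<beta>. \<beta> \<in> L \<Longrightarrow> cmod (ip \<beta> (\<delta> j) - ip \<beta> (\<alpha> j)) \<le> \<epsilon> * nrm \<beta>"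
      by metis
    have \<alpha>0: "\<forall>p. p \<notin> \<Omega> \<longrightarrow> \<beta> p = 0" if "\<beta> \<in> L" for \<beta> using that by (simp add: L_def)
    have ip\<delta>: "ip \<beta> (\<delta> j) = \<beta> (j, \<one>)" if "\<beta> \<in> L" for \<beta> j
    proof -
      have "ip \<beta> (\<delta> j) = (\<Sum>p\<in>{(j, \<one>)}. \<beta> p * cnj (\<delta> j p))"
        using L_fin[OF that] by (intro ip_sum) (auto simp: \<delta>_def)
      then show ?thesis by (simp add: \<delta>_def)
    qed
    \<comment> \<open>For g = 1 this is \<open>proj\<close>, and translating \<beta> by g^-1 reduces
      the general case to it. So the translates of \<alpha> j almost reproduce the values of the
      elements of L.\<close>
    have approx: "cmod (\<beta> (j, g) - ip \<beta> (R g (\<alpha> j))) \<le> \<epsilon> * nrm \<beta>"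
      if \<beta>: "\<beta> \<in> L" and g: "g \<in> carrier G" for \<beta> j g
    proof -
      let ?\<beta> = "R (inv g) \<beta>"
      have "R g ?\<beta> = \<beta>"
      proof
        fix p show "R g ?\<beta> p = \<beta> p"
          using \<alpha>0[OF \<beta>] g cancel by (cases p) (auto simp: R_def \<Omega>_def)
      qed
      then have "ip ?\<beta> (\<alpha> j) = ip \<beta> (R g (\<alpha> j))"
        using R_ip[of ?\<beta> g "\<alpha> j"] \<alpha>0[OF R_L[OF \<beta>, of "inv g"]] g by simp
      moreover have "?\<beta> (j, \<one>) = \<beta> (j, g)" using g by (simp add: R_def)
      moreover have "nrm ?\<beta> = nrm \<beta>" using R_nrm[OF \<alpha>0[OF \<beta>]] g by simp
      ultimately show ?thesis
        using proj[OF R_L[OF \<beta>, of "inv g"], of j] ip\<delta>[OF R_L[OF \<beta>, of "inv g"], of j] g by simp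
    qed
    have R1: "R \<one> (\<alpha> j) = \<alpha> j" for j
    proof
      fix p show "R \<one> (\<alpha> j) p = \<alpha> j p" using \<alpha>0[OF \<alpha>, of j] by (cases p) (auto simp: R_def \<Omega>_def)
    qed
    have diag: "cmod (\<alpha> j (j, \<one>) - of_real ((nrm (\<alpha> j))\<^sup>2)) \<le> \<epsilon> * nrm (\<alpha> j)" for j
      using approx[OF \<alpha>[of j] one_closed, of j] by (simp only: R1 ip_self)
    \<comment> \<open>A value of \<alpha> j is at most its norm, so \<open>diag\<close> bounds the
      squared norm by 1 + \<epsilon> times the norm.\<close>
    have bound: "nrm (\<alpha> j) \<le> 2" for j
    proof (cases "nrm (\<alpha> j) = 0")
      case False
      then have pos: "nrm (\<alpha> j) > 0" using nrm_nonneg[of "\<alpha> j"] by linarith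
      have "(nrm (\<alpha> j))\<^sup>2 = cmod (of_real ((nrm (\<alpha> j))\<^sup>2))" by (simp add: norm_power)
      also have "\<dots> \<le> cmod (\<alpha> j (j, \<one>)) + cmod (\<alpha> j (j, \<one>) - of_real ((nrm (\<alpha> j))\<^sup>2))"
        by (subst norm_minus_commute) (rule norm_triangle_sub)
      also have "\<dots> \<le> nrm (\<alpha> j) + \<epsilon> * nrm (\<alpha> j)"
        by (intro add_mono diag norm_le_nrm L_fin \<alpha>)
      finally have "nrm (\<alpha> j) * nrm (\<alpha> j) \<le> (1 + \<epsilon>) * nrm (\<alpha> j)"
        by (simp add: power2_eq_square algebra_simps)
      then have "nrm (\<alpha> j) \<le> 1 + \<epsilon>" using pos by simp
      then show ?thesis using \<epsilon> by simp
    qed simp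
    \<comment> \<open>Both numbers approximate the inner product of \<alpha> i with the translate of
      \<alpha> j by g^-1, each with error at most 2 \<epsilon> by \<open>bound\<close>.\<close>
    have sym: "cmod (cnj (\<alpha> j (i, g)) - \<alpha> i (j, inv g)) \<le> 4 * \<epsilon>" if g: "g \<in> carrier G" for i j g
    proof -
      have "ip (\<alpha> j) (R g (\<alpha> i)) = cnj (ip (R g (\<alpha> i)) (\<alpha> j))"
        using L_fin[OF \<alpha>[of j]] L_fin[OF R_L[OF \<alpha>[of i] g]] by (intro ip_commute) auto
      also have "ip (R g (\<alpha> i)) (\<alpha> j) = ip (\<alpha> i) (R (inv g) (\<alpha> j))"
      proof -
        have "R (inv g) (R g (\<alpha> i)) = \<alpha> i"
        proof
          fix p show "R (inv g) (R g (\<alpha> i)) p = \<alpha> i p"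
            using \<alpha>0[OF \<alpha>, of i] g cancel by (cases p) (auto simp: R_def \<Omega>_def)
        qed
        then show ?thesis
          using R_ip[of "R g (\<alpha> i)" "inv g" "\<alpha> j"] \<alpha>0[OF R_L[OF \<alpha>[of i] g]] g by simp
      qed
      finally have eq: "cnj (ip (\<alpha> j) (R g (\<alpha> i))) = ip (\<alpha> i) (R (inv g) (\<alpha> j))" by simp
      have 1: "cmod (cnj (\<alpha> j (i, g)) - cnj (ip (\<alpha> j) (R g (\<alpha> i)))) \<le> \<epsilon> * nrm (\<alpha> j)"
        using approx[OF \<alpha>[of j] g, of i] by (simp only: complex_cnj_diff[symmetric] complex_mod_cnj)
      have 2: "cmod (\<alpha> i (j, inv g) - ip (\<alpha> i) (R (inv g) (\<alpha> j))) \<le> \<epsilon> * nrm (\<alpha> i)"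
        using approx[OF \<alpha>[of i] inv_closed[OF g], of j] .
      have "cmod (cnj (\<alpha> j (i, g)) - \<alpha> i (j, inv g)) \<le> \<epsilon> * nrm (\<alpha> j) + \<epsilon> * nrm (\<alpha> i)"
        by (rule norm_diff_triangle_le[OF 1]) (use 2 in \<open>simp add: eq norm_minus_commute\<close>)
      also have "\<dots> \<le> \<epsilon> * 2 + \<epsilon> * 2"
        using bound[of i] bound[of j] \<epsilon> by (intro add_mono mult_left_mono) auto
      finally show ?thesis by simp
    qed
    have ipE: "ip (E j) (\<alpha> j) = (\<Sum>i<k. \<Sum>g\<in>F. e i j g * cnj (\<alpha> j (i, g)))" if j: "j < k" for j
    proof -
      have "ip (E j) (\<alpha> j) = (\<Sum>p\<in>{..<k} \<times> F. E j p * cnj (\<alpha> j p))"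
        using F L_fin[OF E_L[OF j]] E_supp[OF j] by (intro ip_sum) auto
      also have "\<dots> = (\<Sum>i<k. \<Sum>g\<in>F. E j (i, g) * cnj (\<alpha> j (i, g)))"
        by (simp add: sum.cartesian_product)
      also have "\<dots> = (\<Sum>i<k. \<Sum>g\<in>F. e i j g * cnj (\<alpha> j (i, g)))"
        using F by (intro sum.cong) (auto simp: E_def \<Omega>_def)
      finally show ?thesis .
    qed
    \<comment> \<open>Membership of \<alpha> i in L, read at the identity, expresses its diagonal
      value by sums that match those in \<open>ipE\<close> up to the error in
      \<open>sym\<close>.\<close>
    have tr_\<alpha>: "(\<Sum>i<k. \<alpha> i (i, \<one>)) = (\<Sum>j<k. \<Sum>i<k. \<Sum>g\<in>F. e i j g * \<alpha> i (j, inv g))"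
    proof -
      have "\<alpha> i (i, \<one>) = (\<Sum>j<k. \<Sum>g\<in>F. e i j g * \<alpha> i (j, inv g))" if "i < k" for i
      proof -
        have "\<alpha> i (i, \<one>) = (\<Sum>j<k. \<Sum>g\<in>F. e i j g * \<alpha> i (j, inv g \<otimes> \<one>))"
          using \<alpha>[of i] that by (simp add: L_def)
        also have "\<dots> = (\<Sum>j<k. \<Sum>g\<in>F. e i j g * \<alpha> i (j, inv g))"
          using F by (intro sum.cong) (auto simp: subset_iff)
        finally show ?thesis .
      qed
      then have "(\<Sum>i<k. \<alpha> i (i, \<one>)) = (\<Sum>i<k. \<Sum>j<k. \<Sum>g\<in>F. e i j g * \<alpha> i (j, inv g))" by simp
      also have "\<dots> = (\<Sum>j<k. \<Sum>i<k. \<Sum>g\<in>F. e i j g * \<alpha> i (j, inv g))" by (rule sum.swap)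
      finally show ?thesis .
    qed
    have tr_E: "(\<Sum>j<k. E j (j, \<one>)) = 0"
      using trace by (simp add: E_def \<Omega>_def)
    have d1: "cmod ((\<Sum>j<k. E j (j, \<one>)) - (\<Sum>j<k. ip (E j) (\<alpha> j))) \<le> \<epsilon> * (\<Sum>j<k. nrm (E j))"
    proof -
      have "cmod (E j (j, \<one>) - ip (E j) (\<alpha> j)) \<le> \<epsilon> * nrm (E j)" if "j < k" for j
        using approx[OF E_L[OF that] one_closed, of j] by (simp only: R1)
      then have "cmod (\<Sum>j<k. E j (j, \<one>) - ip (E j) (\<alpha> j)) \<le> (\<Sum>j<k. \<epsilon> * nrm (E j))"
        by (intro sum_norm_le) auto
      then show ?thesis by (simp add: sum_subtractf sum_distrib_left)
    qed
    have d2: "cmod ((\<Sum>j<k. ip (E j) (\<alpha> j)) - (\<Sum>i<k. \<alpha> i (i, \<one>)))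
        \<le> \<epsilon> * (4 * (\<Sum>j<k. \<Sum>i<k. \<Sum>g\<in>F. cmod (e i j g)))"
    proof -
      have "(\<Sum>j<k. ip (E j) (\<alpha> j)) - (\<Sum>i<k. \<alpha> i (i, \<one>))
          = (\<Sum>j<k. \<Sum>i<k. \<Sum>g\<in>F. e i j g * (cnj (\<alpha> j (i, g)) - \<alpha> i (j, inv g)))"
        unfolding tr_\<alpha> by (simp add: ipE sum_subtractf right_diff_distrib)
      also have "cmod \<dots> \<le> (\<Sum>j<k. \<Sum>i<k. \<Sum>g\<in>F. cmod (e i j g) * (4 * \<epsilon>))"
        using sym F by (intro sum_norm_le) (auto simp: norm_mult intro!: mult_left_mono)
      also have "\<dots> = \<epsilon> * (4 * (\<Sum>j<k. \<Sum>i<k. \<Sum>g\<in>F. cmod (e i j g)))"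
        by (simp add: sum_distrib_left mult_ac)
      finally show ?thesis .
    qed
    have d3: "cmod ((\<Sum>i<k. \<alpha> i (i, \<one>)) - (\<Sum>i<k. of_real ((nrm (\<alpha> i))\<^sup>2))) \<le> \<epsilon> * (2 * k)"
    proof -
      have "cmod (\<Sum>i<k. \<alpha> i (i, \<one>) - of_real ((nrm (\<alpha> i))\<^sup>2)) \<le> (\<Sum>i<k. \<epsilon> * 2)"
        using diag bound \<epsilon> by (intro sum_norm_le) (meson less_imp_le mult_left_mono order_trans)
      then show ?thesis by (simp add: sum_subtractf mult_ac)
    qed
    have "(\<Sum>i<k. (nrm (\<alpha> i))\<^sup>2) = cmod ((\<Sum>j<k. E j (j, \<one>)) - (\<Sum>i<k. of_real ((nrm (\<alpha> i))\<^sup>2)))"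
      unfolding tr_E by (simp add: of_real_sum[symmetric] sum_nonneg del: of_real_sum of_real_power)
    also have "\<dots> \<le> \<epsilon> * C1"
      using norm_diff_triangle_le[OF norm_diff_triangle_le[OF d1 d2] d3]
      by (simp add: C1_def algebra_simps)
    finally have sum_le: "(\<Sum>i<k. (nrm (\<alpha> i))\<^sup>2) \<le> \<epsilon> * C1" .
    have "(nrm (\<alpha> i0))\<^sup>2 \<le> (\<Sum>i<k. (nrm (\<alpha> i))\<^sup>2)"
      using ij by (intro member_le_sum) auto
    then have small: "nrm (\<alpha> i0) \<le> sqrt (\<epsilon> * C1)"
      using sum_le by (intro real_le_rsqrt) linarith
    \<comment> \<open>The entry is close to the inner product of a column of e with a translate of
      \<alpha> i0, whose norm tends to zero with \<epsilon>.\<close>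
    have "cmod (e i0 j0 g0) = cmod (E j0 (i0, g0))" using ij by (simp add: E_def \<Omega>_def)
    also have "\<dots> \<le> cmod (ip (E j0) (R g0 (\<alpha> i0))) + cmod (E j0 (i0, g0) - ip (E j0) (R g0 (\<alpha> i0)))"
      by (rule norm_triangle_sub)
    also have "\<dots> \<le> nrm (E j0) * nrm (R g0 (\<alpha> i0)) + \<epsilon> * nrm (E j0)"
      using ij by (intro add_mono norm_ip_le approx L_fin E_L R_L \<alpha>)
    also have "nrm (R g0 (\<alpha> i0)) = nrm (\<alpha> i0)" using R_nrm[OF \<alpha>0[OF \<alpha>]] ij by simp
    also have "nrm (E j0) * nrm (\<alpha> i0) + \<epsilon> * nrm (E j0) \<le> nrm (E j0) * (sqrt (\<epsilon> * C1) + \<epsilon>)"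
      using small by (simp add: distrib_left mult_left_mono mult.commute)
    finally show ?thesis .
  qed
  have "((\<lambda>\<epsilon>. nrm (E j0) * (sqrt (\<epsilon> * C1) + \<epsilon>)) \<longlongrightarrow> nrm (E j0) * (sqrt (0 * C1) + 0)) (at_right 0)"
    by (intro tendsto_intros)
  moreover have "\<forall>\<^sub>F \<epsilon> in at_right 0. cmod (e i0 j0 g0) \<le> nrm (E j0) * (sqrt (\<epsilon> * C1) + \<epsilon>)"
    using eventually_at_right_less[of 0] eventually_at_right[of 0 "1::real" "\<lambda>x. x < 1"] key
    by (auto simp: eventually_at_right_field intro!: exI[of _ 1])
  ultimately have "cmod (e i0 j0 g0) \<le> nrm (E j0) * (sqrt (0 * C1) + 0)"
    by (intro tendsto_lowerbound) auto
  then show ?thesis by simp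
qed

section \<open>Homomorphisms to the complex numbers\<close>

text \<open>Homomorphisms on a subring are encoded as total functions that are constrained only on
  A; \<open>hom_zero\<close> and \<open>hom_minus\<close> recover the values at zero and at
  negatives.\<close>

definition complex_hom_on :: "('a, 'm) ring_scheme \<Rightarrow> 'a set \<Rightarrow> ('a \<Rightarrow> complex) \<Rightarrow> bool"
  where "complex_hom_on R A \<psi> \<longleftrightarrow> \<psi> \<one>\<^bsub>R\<^esub> = 1 \<and>
    (\<forall>a\<in>A. \<forall>b\<in>A. \<psi> (a \<oplus>\<^bsub>R\<^esub> b) = \<psi> a + \<psi> b \<and> \<psi> (a \<otimes>\<^bsub>R\<^esub> b) = \<psi> a * \<psi> b)"

lemma complex_hom_onD:
  assumes "complex_hom_on R A \<psi>" "a \<in> A" "b \<in> A"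
  shows "\<psi> (a \<oplus>\<^bsub>R\<^esub> b) = \<psi> a + \<psi> b" "\<psi> (a \<otimes>\<^bsub>R\<^esub> b) = \<psi> a * \<psi> b"
  using assms by (auto simp: complex_hom_on_def)

text \<open>This form survives the adjunction of an element. The extension of a homomorphism has to
  keep a leading coefficient and a further element nonzero; in a domain both conditions are met by
  separating their product from zero.\<close>

definition complex_separated :: "('a, 'm) ring_scheme \<Rightarrow> 'a set \<Rightarrow> bool"
  where "complex_separated R A \<longleftrightarrow>
    (\<forall>b\<in>A - {\<zero>\<^bsub>R\<^esub>}. \<exists>\<psi>. complex_hom_on R A \<psi> \<and> \<psi> b \<noteq> 0)"

text \<open>Polynomials are lists of coefficients, starting with the constant one.\<close>

primrec horner :: "('a, 'm) ring_scheme \<Rightarrow> 'a \<Rightarrow> 'a list \<Rightarrow> 'a" where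
  "horner R x [] = \<zero>\<^bsub>R\<^esub>"
| "horner R x (a # p) = a \<oplus>\<^bsub>R\<^esub> x \<otimes>\<^bsub>R\<^esub> horner R x p"

primrec complex_horner :: "('a \<Rightarrow> complex) \<Rightarrow> complex \<Rightarrow> 'a list \<Rightarrow> complex" where
  "complex_horner \<psi> t [] = 0"
| "complex_horner \<psi> t (a # p) = \<psi> a + t * complex_horner \<psi> t p"

text \<open>Lists are not normalized: zeros may stand at the end, so a length only bounds a degree,
  and \<open>pseudo_remainder\<close> can reach a prescribed length by padding.\<close>

fun list_add :: "('a, 'm) ring_scheme \<Rightarrow> 'a list \<Rightarrow> 'a list \<Rightarrow> 'a list" where
  "list_add R [] q = q"
| "list_add R p [] = p"
| "list_add R (a # p) (b # q) = (a \<oplus>\<^bsub>R\<^esub> b) # list_add R p q"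

abbreviation list_smult :: "('a, 'm) ring_scheme \<Rightarrow> 'a \<Rightarrow> 'a list \<Rightarrow> 'a list"
  where "list_smult R c \<equiv> map (\<lambda>a. c \<otimes>\<^bsub>R\<^esub> a)"

primrec list_mult :: "('a, 'm) ring_scheme \<Rightarrow> 'a list \<Rightarrow> 'a list \<Rightarrow> 'a list" where
  "list_mult R [] q = []"
| "list_mult R (a # p) q = list_add R (list_smult R a q) (\<zero>\<^bsub>R\<^esub> # list_mult R p q)"

lemma length_list_add: "length (list_add R p q) = max (length p) (length q)"
  by (induction R p q rule: list_add.induct) auto

lemma complex_horner_poly: "complex_horner \<psi> t p = poly (Poly (map \<psi> p)) t"
  by (induction p) auto

lemma complex_horner_append:
  "complex_horner \<psi> t (p @ q) = complex_horner \<psi> t p + t ^ length p * complex_horner \<psi> t q"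
  by (induction p) (auto simp: algebra_simps)

lemma complex_horner_zero: "(\<And>a. a \<in> set p \<Longrightarrow> \<psi> a = 0) \<Longrightarrow> complex_horner \<psi> t p = 0"
  by (induction p) auto

lemma complex_horner_replicate: "\<psi> z = 0 \<Longrightarrow> complex_horner \<psi> t (replicate n z) = 0"
  by (induction n) auto

section \<open>Polynomials over a subring A, their values at x, and the ring A[x]\<close>

locale subring_of_cring = cring R + subring A R for A and R (structure)
begin

lemma A_subset: "a \<in> A \<Longrightarrow> a \<in> carrier R" using subset by blast

lemmas A_closed = subringE(2,3,5,6,7)[OF subring_axioms]

lemma hom_zero: "complex_hom_on R A \<psi> \<Longrightarrow> \<psi> \<zero> = 0"
  using A_closed(1) unfolding complex_hom_on_def by (metis add_cancel_right_right l_zero zero_closed)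

lemma hom_minus: "complex_hom_on R A \<psi> \<Longrightarrow> a \<in> A \<Longrightarrow> \<psi> (\<ominus> a) = - \<psi> a"
  using hom_zero[of \<psi>] A_closed(3)[of a] A_subset[of a] unfolding complex_hom_on_def
  by (metis add_eq_0_iff r_neg)

lemma pow_in: "a \<in> A \<Longrightarrow> a [^] (n::nat) \<in> A"
  by (induction n) (auto simp: A_closed)

lemma hom_finsum:
  assumes "complex_hom_on R A \<psi>" "finite C" "\<And>i. i \<in> C \<Longrightarrow> f i \<in> A"
  shows "\<psi> (finsum R f C) = (\<Sum>i\<in>C. \<psi> (f i))"
  using assms(2,3)
proof (induction C rule: finite_induct)
  case (insert x C)
  then have "finsum R f C \<in> A" by (intro subring_finsum[OF subring_axioms]) auto
  with insert assms(1) A_subset show ?case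
    by (subst finsum_insert) (auto simp: complex_hom_on_def)
qed (use hom_zero[OF assms(1)] in auto)

lemma list_add_in: "p \<in> lists A \<Longrightarrow> q \<in> lists A \<Longrightarrow> list_add R p q \<in> lists A"
proof (induction p arbitrary: q)
  case (Cons a p)
  then show ?case by (cases q) (simp_all add: A_closed)
qed simp

lemma list_smult_in: "c \<in> A \<Longrightarrow> p \<in> lists A \<Longrightarrow> list_smult R c p \<in> lists A"
  by (induction p) (auto simp: A_closed)

lemma list_mult_in: "p \<in> lists A \<Longrightarrow> q \<in> lists A \<Longrightarrow> list_mult R p q \<in> lists A"
proof (induction p)
  case (Cons a p)
  then have "list_smult R a q \<in> lists A" "\<zero> # list_mult R p q \<in> lists A"
    using list_smult_in A_closed(1) by auto
  then show ?case using list_add_in by simp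
qed simp

context
  fixes x assumes x: "x \<in> carrier R"
begin

lemma horner_closed: "p \<in> lists A \<Longrightarrow> horner R x p \<in> carrier R"
  by (induction p) (auto simp: x A_subset)

lemma horner_add:
  "p \<in> lists A \<Longrightarrow> q \<in> lists A \<Longrightarrow> horner R x (list_add R p q) = horner R x p \<oplus> horner R x q"
proof (induction p arbitrary: q)
  case Nil
  then show ?case using horner_closed by simp
next
  case IH: (Cons a p)
  then have P: "horner R x p \<in> carrier R" "a \<in> carrier R" using horner_closed A_subset by auto
  show ?case
  proof (cases q)
    case Nil
    then show ?thesis using P x by simp
  next
    case (Cons b r)
    then have "horner R x r \<in> carrier R" "b \<in> carrier R" "r \<in> lists A"
      using horner_closed A_subset \<open>q \<in> lists A\<close> by auto
    then show ?thesis using P x Cons \<open>a # p \<in> lists A\<close>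
      by (simp add: IH.IH r_distr a_ac)
  qed
qed

lemma horner_smult:
  "c \<in> A \<Longrightarrow> p \<in> lists A \<Longrightarrow> horner R x (list_smult R c p) = c \<otimes> horner R x p"
  by (induction p) (auto simp: x A_subset horner_closed r_distr m_lcomm)

lemma horner_mult:
  "p \<in> lists A \<Longrightarrow> q \<in> lists A \<Longrightarrow> horner R x (list_mult R p q) = horner R x p \<otimes> horner R x q"
proof (induction p)
  case (Cons a p)
  then have "horner R x (list_mult R (a # p) q)
      = a \<otimes> horner R x q \<oplus> (\<zero> \<oplus> x \<otimes> (horner R x p \<otimes> horner R x q))"
    by (simp add: horner_add horner_smult list_smult_in list_mult_in A_closed del: in_lists_conv_set)
  also have "\<dots> = horner R x (a # p) \<otimes> horner R x q"
    using Cons x A_subset horner_closed by (simp add: l_distr m_assoc)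
  finally show ?case .
qed (auto simp: horner_closed)

lemma horner_append:
  "p \<in> lists A \<Longrightarrow> q \<in> lists A \<Longrightarrow>
    horner R x (p @ q) = horner R x p \<oplus> x [^] length p \<otimes> horner R x q"
  by (induction p) (auto simp: x A_subset horner_closed r_distr m_ac a_assoc nat_pow_Suc2)

lemma horner_zero: "(\<And>a. a \<in> set p \<Longrightarrow> a = \<zero>) \<Longrightarrow> horner R x p = \<zero>"
proof (induction p)
  case (Cons a p)
  have "a = \<zero>" by (rule Cons.prems) simp
  moreover have "horner R x p = \<zero>" by (rule Cons.IH, rule Cons.prems) simp
  ultimately show ?case using x by simp
qed simp

lemma horner_replicate: "horner R x (replicate n \<zero>) = \<zero>"
  by (rule horner_zero) simp

lemma horner_finsum:
  "p \<in> lists A \<Longrightarrow> horner R x p = (\<Oplus>k\<in>{..<length p}. p ! k \<otimes> x [^] k)"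
proof (induction p rule: rev_induct)
  case (snoc a p)
  then have p: "p \<in> lists A" and a: "a \<in> A" by auto
  have nth: "p ! k \<in> carrier R" if "k < length p" for k using that p A_subset by auto
  have "(\<Oplus>k\<in>{..<length (p @ [a])}. (p @ [a]) ! k \<otimes> x [^] k)
      = a \<otimes> x [^] length p \<oplus> (\<Oplus>k\<in>{..<length p}. (p @ [a]) ! k \<otimes> x [^] k)"
    using a nth x A_subset by (simp add: lessThan_Suc, subst finsum_insert) (auto simp: nth_append)
  also have "(\<Oplus>k\<in>{..<length p}. (p @ [a]) ! k \<otimes> x [^] k) = horner R x p"
    unfolding snoc.IH[OF p] using nth x by (intro finsum_cong') (auto simp: nth_append)
  finally show ?case
    using p a x A_subset horner_closed[OF p] by (subst horner_append) (auto simp: m_comm a_comm)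
qed simp

lemma complex_horner_add:
  assumes "complex_hom_on R A \<psi>"
  shows "p \<in> lists A \<Longrightarrow> q \<in> lists A \<Longrightarrow>
    complex_horner \<psi> t (list_add R p q) = complex_horner \<psi> t p + complex_horner \<psi> t q"
proof (induction p arbitrary: q)
  case IH: (Cons a p)
  then show ?case
    using assms by (cases q) (auto simp: complex_hom_on_def algebra_simps)
qed simp

lemma complex_horner_smult:
  assumes "complex_hom_on R A \<psi>" "c \<in> A"
  shows "p \<in> lists A \<Longrightarrow> complex_horner \<psi> t (list_smult R c p) = \<psi> c * complex_horner \<psi> t p"
  using assms by (induction p) (auto simp: complex_hom_on_def algebra_simps)

lemma complex_horner_mult:
  assumes "complex_hom_on R A \<psi>"
  shows "p \<in> lists A \<Longrightarrow> q \<in> lists A \<Longrightarrow>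
    complex_horner \<psi> t (list_mult R p q) = complex_horner \<psi> t p * complex_horner \<psi> t q"
proof (induction p)
  case (Cons a p)
  then have "list_smult R a q \<in> lists A" "\<zero> # list_mult R p q \<in> lists A"
    using list_smult_in list_mult_in A_closed(1) by auto
  then show ?case
    using Cons assms by (simp add: complex_horner_add complex_horner_smult hom_zero algebra_simps
      del: in_lists_conv_set)
qed simp

definition "adjoin = horner R x ` lists A"

lemma subring_adjoin: "subring adjoin R"
proof (rule subringI)
  show "adjoin \<subseteq> carrier R" unfolding adjoin_def using horner_closed by blast
  show "\<one> \<in> adjoin" unfolding adjoin_def
    by (rule image_eqI[of _ _ "[\<one>]"]) (auto simp: x A_closed)
  fix y z assume "y \<in> adjoin" "z \<in> adjoin"
  then obtain p q where pq: "p \<in> lists A" "q \<in> lists A" "y = horner R x p" "z = horner R x q"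
    by (auto simp: adjoin_def)
  show "y \<otimes> z \<in> adjoin"
    unfolding adjoin_def pq(3,4) horner_mult[OF pq(1,2), symmetric] by (intro imageI list_mult_in pq)
  show "y \<oplus> z \<in> adjoin"
    unfolding adjoin_def pq(3,4) horner_add[OF pq(1,2), symmetric] by (intro imageI list_add_in pq)
next
  fix y assume "y \<in> adjoin"
  then obtain p where p: "p \<in> lists A" "y = horner R x p" by (auto simp: adjoin_def)
  have "\<ominus> y = horner R x (list_smult R (\<ominus> \<one>) p)"
    using p A_closed horner_closed[OF p(1)] by (simp add: horner_smult l_minus)
  then show "\<ominus> y \<in> adjoin"
    unfolding adjoin_def using list_smult_in[OF _ p(1)] A_closed by blast
qed

lemma mem_adjoin: "x \<in> adjoin" "A \<subseteq> adjoin"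
proof -
  show "x \<in> adjoin" unfolding adjoin_def
    by (rule image_eqI[of _ _ "[\<zero>, \<one>]"]) (use x A_closed in auto)
  show "A \<subseteq> adjoin"
  proof
    fix a assume "a \<in> A"
    then show "a \<in> adjoin" unfolding adjoin_def
      using x A_subset by (intro image_eqI[of _ _ "[a]"]) auto
  qed
qed

text \<open>Sending the value of p at x to its value at t under \<psi> is well defined: two
  polynomials with the same value at x differ by a relation of x, and by \<open>rel\<close> the
  number t satisfies every such relation.\<close>

lemma hom_extension:
  assumes \<psi>: "complex_hom_on R A \<psi>"
    and rel: "\<And>p. p \<in> lists A \<Longrightarrow> horner R x p = \<zero> \<Longrightarrow> complex_horner \<psi> t p = 0"
  shows "\<exists>\<psi>'. complex_hom_on R adjoin \<psi>' \<and>
    (\<forall>p\<in>lists A. \<psi>' (horner R x p) = complex_horner \<psi> t p)"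
proof -
  have unique: "complex_horner \<psi> t p = complex_horner \<psi> t q"
    if "p \<in> lists A" "q \<in> lists A" "horner R x p = horner R x q" for p q
  proof -
    let ?q = "list_smult R (\<ominus> \<one>) q"
    have m1: "\<ominus> \<one> \<in> A" by (intro A_closed)
    have q: "?q \<in> lists A" by (rule list_smult_in[OF m1 that(2)])
    have "horner R x (list_add R p ?q) = \<zero>"
      using that q m1 horner_closed[OF that(2)]
      by (simp add: horner_add horner_smult l_minus r_neg del: in_lists_conv_set)
    then have "complex_horner \<psi> t (list_add R p ?q) = 0"
      by (intro rel list_add_in that q)
    moreover have "\<psi> (\<ominus> \<one>) = -1"
      using hom_minus[OF \<psi> A_closed(2)] \<psi> by (simp add: complex_hom_on_def)
    ultimately show ?thesis
      using complex_horner_add[OF \<psi> that(1) q] complex_horner_smult[OF \<psi> m1 that(2)] by simp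
  qed
  define \<psi>' where "\<psi>' y = complex_horner \<psi> t (SOME p. p \<in> lists A \<and> horner R x p = y)" for y
  have \<psi>': "\<psi>' (horner R x p) = complex_horner \<psi> t p" if "p \<in> lists A" for p
    unfolding \<psi>'_def
    by (rule someI2[of "\<lambda>q. q \<in> lists A \<and> horner R x q = horner R x p" p])
      (use that unique in blast)+
  have "\<psi>' \<one> = 1"
    using \<psi>'[of "[\<one>]"] x A_closed(2) \<psi> by (simp add: complex_hom_on_def)
  moreover have "\<psi>' (y \<oplus> z) = \<psi>' y + \<psi>' z \<and> \<psi>' (y \<otimes> z) = \<psi>' y * \<psi>' z"
    if "y \<in> adjoin" "z \<in> adjoin" for y z
  proof -
    obtain p q where pq: "p \<in> lists A" "q \<in> lists A" "y = horner R x p" "z = horner R x q"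
      using \<open>y \<in> adjoin\<close> \<open>z \<in> adjoin\<close> by (auto simp: adjoin_def)
    show ?thesis
      using \<psi>'[OF list_add_in[OF pq(1,2)]] \<psi>'[OF list_mult_in[OF pq(1,2)]] \<psi>'[OF pq(1)] \<psi>'[OF pq(2)]
      by (simp only: pq(3,4) horner_add[OF pq(1,2)] horner_mult[OF pq(1,2)]
        complex_horner_add[OF \<psi> pq(1,2)] complex_horner_mult[OF \<psi> pq(1,2)])
  qed
  ultimately have "complex_hom_on R adjoin \<psi>'" by (simp add: complex_hom_on_def)
  then show ?thesis using \<psi>' by blast
qed

text \<open>Pseudo-division by a relation of x with leading coefficient a. Each step is a polynomial
  identity over A, so one exponent M and one remainder r' serve for the value at x and for all
  \<psi> and t under which the relation still holds.\<close>

lemma pseudo_remainder: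
  assumes p: "p @ [a] \<in> lists A" "horner R x (p @ [a]) = \<zero>"
  shows "r \<in> lists A \<Longrightarrow> \<exists>M r'. r' \<in> lists A \<and> length r' = length p \<and>
    a [^] M \<otimes> horner R x r = horner R x r' \<and>
    (\<forall>\<psi> t. complex_hom_on R A \<psi> \<and> complex_horner \<psi> t (p @ [a]) = 0 \<longrightarrow>
      \<psi> a ^ M * complex_horner \<psi> t r = complex_horner \<psi> t r')"
proof (induction "length r" arbitrary: r rule: less_induct)
  case less
  have pa: "p \<in> lists A" "a \<in> A" using p by auto
  show ?case
  proof (cases "length r \<le> length p")
    case True
    let ?z = "replicate (length p - length r) \<zero>"
    have z: "?z \<in> lists A" using A_closed(1) by (auto simp: in_lists_conv_set)
    show ?thesis
    proof (intro exI[of _ "0::nat"] exI[of _ "r @ ?z"] conjI allI impI)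
      show "a [^] (0::nat) \<otimes> horner R x r = horner R x (r @ ?z)"
        using horner_append[OF less.prems z] horner_closed[OF less.prems] x
        by (simp add: horner_replicate)
      fix \<psi> t assume "complex_hom_on R A \<psi> \<and> complex_horner \<psi> t (p @ [a]) = 0"
      then show "\<psi> a ^ 0 * complex_horner \<psi> t r = complex_horner \<psi> t (r @ ?z)"
        using hom_zero[of \<psi>] by (simp add: complex_horner_append complex_horner_replicate)
    qed (use True less.prems z in auto)
  next
    case False
    then obtain r0 d where r: "r = r0 @ [d]" by (cases r rule: rev_cases) auto
    then have r0: "r0 \<in> lists A" "d \<in> A" "length p \<le> length r0" using less.prems False by auto
    define m where "m = length r0 - length p"
    let ?z = "replicate m \<zero>"
    \<comment> \<open>With n the length of p, this is a r - d X^m (p + a X^n). The two terms of top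
      degree cancel and are left out, which makes the list shorter than r.\<close>
    define r1 where "r1 = list_add R (list_smult R a r0) (list_smult R (\<ominus> d) (?z @ p))"
    have z: "?z \<in> lists A" "?z @ p \<in> lists A" using A_closed(1) pa(1) by (auto simp: in_lists_conv_set)
    have d: "\<ominus> d \<in> A" by (rule A_closed(3)[OF r0(2)])
    have in1: "list_smult R a r0 \<in> lists A" "list_smult R (\<ominus> d) (?z @ p) \<in> lists A"
      using list_smult_in r0 pa z d by blast+
    have r1: "r1 \<in> lists A" unfolding r1_def by (rule list_add_in[OF in1])
    have "length r1 < length r" by (simp add: r1_def length_list_add r m_def r0(3))
    then obtain M r' where M: "r' \<in> lists A" "length r' = length p"
      "a [^] M \<otimes> horner R x r1 = horner R x r'"
      "\<And>\<psi> t. complex_hom_on R A \<psi> \<Longrightarrow> complex_horner \<psi> t (p @ [a]) = 0 \<Longrightarrow>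
        \<psi> a ^ M * complex_horner \<psi> t r1 = complex_horner \<psi> t r'"
      using less.hyps[OF _ r1] by blast
    note c = horner_closed[OF pa(1)] horner_closed[OF r0(1)] A_subset[OF pa(2)] A_subset[OF r0(2)] x
    have hp: "horner R x p = \<ominus> (x [^] length p \<otimes> a)"
      using p(2) pa c by (subst (asm) horner_append) (auto simp: minus_equality)
    have "horner R x r1 = a \<otimes> horner R x r0 \<oplus> \<ominus> d \<otimes> (x [^] m \<otimes> horner R x p)"
      unfolding r1_def horner_add[OF in1] horner_smult[OF pa(2) r0(1)] horner_smult[OF d z(2)]
        horner_append[OF z(1) pa(1)]
      using c by (simp add: horner_replicate)
    also have "\<dots> = a \<otimes> horner R x r0 \<oplus> a \<otimes> (x [^] (m + length p) \<otimes> d)"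
      using c by (simp add: hp l_minus r_minus nat_pow_mult[symmetric] m_ac)
    also have "\<dots> = a \<otimes> horner R x r"
      using c r0 by (simp add: r horner_append m_def r_distr)
    finally have "a [^] Suc M \<otimes> horner R x r = horner R x r'"
      using M(3) c horner_closed[OF less.prems] by (simp add: m_assoc)
    moreover have "\<psi> a ^ Suc M * complex_horner \<psi> t r = complex_horner \<psi> t r'"
      if \<psi>: "complex_hom_on R A \<psi>" and t: "complex_horner \<psi> t (p @ [a]) = 0" for \<psi> t
    proof -
      have cp: "complex_horner \<psi> t p = - (t ^ length p * \<psi> a)"
        using t by (simp add: complex_horner_append add_eq_0_iff2)
      have "complex_horner \<psi> t r1 = \<psi> a * complex_horner \<psi> t r0
          + (- \<psi> d) * (t ^ m * complex_horner \<psi> t p)"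
        unfolding r1_def complex_horner_add[OF \<psi> in1] complex_horner_smult[OF \<psi> pa(2) r0(1)]
          complex_horner_smult[OF \<psi> d z(2)] hom_minus[OF \<psi> r0(2)]
        using hom_zero[OF \<psi>] by (simp add: complex_horner_append complex_horner_replicate)
      also have "\<dots> = \<psi> a * (complex_horner \<psi> t r0 + t ^ (m + length p) * \<psi> d)"
        by (simp add: cp power_add algebra_simps)
      also have "\<dots> = \<psi> a * complex_horner \<psi> t r"
        using r0(3) by (simp add: r m_def complex_horner_append)
      finally show ?thesis using M(4)[OF \<psi> t] by (simp add: mult.assoc mult.left_commute)
    qed
    ultimately show ?thesis using M(1,2) by blast
  qed
qed

end

end

text \<open>
  If \<open>x\<close> is transcendental over \<open>A\<close>, a homomorphism extends to \<open>A[x]\<close> with any value at \<open>x\<close>. Otherwise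
  let \<open>a\<close> be the leading coefficient of a shortest polynomial that vanishes at \<open>x\<close>. A homomorphism that
  does not vanish at \<open>a\<close> extends, by pseudo-division. Comparing dimensions gives a multiple \<open>d\<close> of \<open>b\<close> in
  \<open>A[x]\<close> with \<open>0 \<noteq> d \<in> A\<close>, and if the homomorphism does not vanish at \<open>d\<close>, it does not vanish at \<open>b\<close>.
\<close>

lemma (in domain) complex_separated_adjoin:
  assumes A: "subring A R" and sep: "complex_separated R A" and x: "x \<in> carrier R"
  shows "complex_separated R (horner R x ` lists A)"
  unfolding complex_separated_def
proof
  interpret S: subring_of_cring A R
    using A is_cring by (simp add: subring_of_cring_def)
  fix b assume "b \<in> horner R x ` lists A - {\<zero>}"
  then obtain q where q: "q \<in> lists A" "b = horner R x q" and b0: "b \<noteq> \<zero>" by auto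
  have b: "b \<in> carrier R" using S.horner_closed[OF x q(1)] q(2) by simp
  note ext = S.hom_extension[OF x, unfolded S.adjoin_def[OF x]]
  show "\<exists>\<psi>. complex_hom_on R (horner R x ` lists A) \<psi> \<and> \<psi> b \<noteq> 0"
  proof (cases "\<forall>p\<in>lists A. horner R x p = \<zero> \<longrightarrow> set p \<subseteq> {\<zero>}")
    case True
    obtain c where c: "c \<in> set q" "c \<noteq> \<zero>" using S.horner_zero[OF x, of q] q b0 by blast
    then obtain \<psi> where \<psi>: "complex_hom_on R A \<psi>" "\<psi> c \<noteq> 0"
      using sep q(1) unfolding complex_separated_def by blast
    obtain k where k: "k < length q" "q ! k = c" using c(1) by (auto simp: in_set_conv_nth)
    have "coeff (Poly (map \<psi> q)) k = \<psi> c" using k by (simp add: nth_default_nth)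
    then have "Poly (map \<psi> q) \<noteq> 0" using \<psi>(2) by (metis coeff_0)
    \<comment> \<open>Since x satisfies no nontrivial relation, any t is admissible; one is taken at
      which the nonzero image of q does not vanish.\<close>
    then obtain t where t: "complex_horner \<psi> t q \<noteq> 0"
      unfolding complex_horner_poly using poly_all_0_iff_0 by blast
    have "complex_horner \<psi> t p = 0" if "p \<in> lists A" "horner R x p = \<zero>" for p
      using True that S.hom_zero[OF \<psi>(1)] by (intro complex_horner_zero) blast
    from ext[OF \<psi>(1) this] show ?thesis using q t by metis
  next
    case False
    define rel where "rel p \<longleftrightarrow> p \<in> lists A \<and> horner R x p = \<zero> \<and> \<not> set p \<subseteq> {\<zero>}" for p
    have "\<exists>p. rel p" using False by (auto simp: rel_def)
    then obtain p where p: "rel p" and min: "\<And>r. rel r \<Longrightarrow> length p \<le> length r"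
      using ex_has_least_nat[of rel _ length] by blast
    have "p \<noteq> []" using p by (auto simp: rel_def)
    then obtain p0 a where pa: "p = p0 @ [a]" by (cases p rule: rev_cases) auto
    then have p0: "p0 \<in> lists A" "a \<in> A" using p by (auto simp: rel_def)
    have aR: "a \<in> carrier R" by (rule S.A_subset[OF p0(2)])
    have a0: "a \<noteq> \<zero>"
    proof
      assume "a = \<zero>"
      then have "horner R x p = horner R x p0"
        using S.horner_append[OF x p0(1), of "[\<zero>]"] S.A_closed(1) x S.horner_closed[OF x p0(1)]
        by (simp add: pa)
      then have "rel p0" using p p0 \<open>a = \<zero>\<close> by (auto simp: rel_def pa)
      then show False using min[of p0] by (simp add: pa)
    qed
    have short: "\<forall>c\<in>set r. c = \<zero>" if "r \<in> lists A" "length r \<le> length p0" "horner R x r = \<zero>" for r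
      using min[of r] that by (auto simp: rel_def pa)
    define n where "n = length p0"
    \<comment> \<open>For n = 0 the relation would say that the constant a is zero.\<close>
    have n: "n > 0" using p a0 aR x by (cases p0) (auto simp: rel_def pa n_def)
    have hp: "p0 @ [a] \<in> lists A" "horner R x (p0 @ [a]) = \<zero>" using p by (auto simp: rel_def pa)
    note rem = S.pseudo_remainder[OF x hp]
    \<comment> \<open>The elements b, xb, ..., x^(n-1) b and 1, written as polynomials. Their
      pseudo-remainders have n coefficients each, so these n + 1 lists are linearly dependent over
      A.\<close>
    define y where "y i = (if i < n then replicate i \<zero> @ q else [\<one>])" for i
    have yA: "y i \<in> lists A" for i
      using q(1) S.A_closed(1,2) by (auto simp: y_def in_lists_conv_set)
    have hy: "horner R x (y i) = (if i < n then x [^] i \<otimes> b else \<one>)" for i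
    proof -
      have z: "replicate i \<zero> \<in> lists A" using S.A_closed(1) by (auto simp: in_lists_conv_set)
      show ?thesis
        using x b q(2) S.horner_append[OF x z q(1)] by (simp add: y_def S.horner_replicate[OF x])
    qed
    have "\<forall>i. \<exists>M r'. r' \<in> lists A \<and> length r' = n \<and> a [^] (M::nat) \<otimes> horner R x (y i) = horner R x r'"
      using rem[OF yA] unfolding n_def by blast
    then obtain M r' where r': "\<And>i. r' i \<in> lists A" "\<And>i. length (r' i) = n"
      "\<And>i. a [^] (M i :: nat) \<otimes> horner R x (y i) = horner R x (r' i)" by metis
    have rA: "r' i ! j \<in> A" if "j < n" for i j
      using r'(1,2)[of i] that by (auto simp: in_lists_conv_set)
    interpret Z: primeideal "{\<zero>}" R by (rule zeroprimeideal)
    obtain c where c: "c \<in> {..n} \<rightarrow> A" "\<exists>i\<in>{..n}. c i \<noteq> \<zero>"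
      "\<forall>j\<in>{..<n}. (\<Oplus>i\<in>{..n}. c i \<otimes> r' i ! j) = \<zero>"
      using Z.linear_dependence[OF A, of "{..<n}" "{..n}" "\<lambda>j i. r' i ! j"] rA by auto
    have cA: "c i \<in> A" if "i \<le> n" for i using c(1) that by auto
    have cR: "c i \<in> carrier R" if "i \<le> n" for i using cA S.A_subset that by blast
    have rR: "r' i ! j \<in> carrier R" if "j < n" for i j using rA S.A_subset that by blast
    have hrc: "horner R x (r' i) \<in> carrier R" for i by (rule S.horner_closed[OF x r'(1)])
    \<comment> \<open>The powers of a from the pseudo-division are absorbed, which turns the
      dependence of the remainders into one of the elements themselves.\<close>
    define d where "d i = c i \<otimes> a [^] M i" for i
    have dA: "d i \<in> A" if "i \<le> n" for i
      unfolding d_def using cA[OF that] S.pow_in[OF p0(2)] by (rule S.A_closed(4))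
    have dR: "d i \<in> carrier R" if "i \<le> n" for i using dA S.A_subset that by blast
    have "(\<Oplus>i\<in>{..n}. d i \<otimes> horner R x (y i)) = (\<Oplus>i\<in>{..n}. \<Oplus>j\<in>{..<n}. c i \<otimes> r' i ! j \<otimes> x [^] j)"
    proof (rule finsum_cong')
      fix i assume i: "i \<in> {..n}"
      have "d i \<otimes> horner R x (y i) = c i \<otimes> horner R x (r' i)"
        using i cR aR S.horner_closed[OF x yA] by (simp add: d_def r'(3)[symmetric] m_assoc)
      also have "\<dots> = (\<Oplus>j\<in>{..<n}. c i \<otimes> (r' i ! j \<otimes> x [^] j))"
        unfolding S.horner_finsum[OF x r'(1)] r'(2) using i cR rR x by (intro finsum_rdistr) auto
      also have "\<dots> = (\<Oplus>j\<in>{..<n}. c i \<otimes> r' i ! j \<otimes> x [^] j)"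
        using i cR rR x by (intro finsum_cong') (auto simp: m_assoc)
      finally show "d i \<otimes> horner R x (y i) = (\<Oplus>j\<in>{..<n}. c i \<otimes> r' i ! j \<otimes> x [^] j)" .
    qed (use cR rR x in \<open>auto intro!: finsum_closed\<close>)
    also have "\<dots> = (\<Oplus>j\<in>{..<n}. \<Oplus>i\<in>{..n}. c i \<otimes> r' i ! j \<otimes> x [^] j)"
      using cR rR x by (intro finsum_swap) auto
    also have "\<dots> = (\<Oplus>j\<in>{..<n}. \<zero>)"
    proof (rule finsum_cong')
      fix j assume j: "j \<in> {..<n}"
      have "(\<Oplus>i\<in>{..n}. c i \<otimes> r' i ! j \<otimes> x [^] j) = (\<Oplus>i\<in>{..n}. c i \<otimes> r' i ! j) \<otimes> x [^] j"
        using j cR rR x by (intro finsum_ldistr[symmetric]) auto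
      then show "(\<Oplus>i\<in>{..n}. c i \<otimes> r' i ! j \<otimes> x [^] j) = \<zero>" using c(3) j x by simp
    qed auto
    finally have total: "(\<Oplus>i\<in>{..n}. d i \<otimes> horner R x (y i)) = \<zero>" by simp
    define w where "w = map d [0..<n]"
    have w: "w \<in> lists A" using dA by (auto simp: w_def)
    have hw: "b \<otimes> horner R x w = (\<Oplus>i\<in>{..<n}. d i \<otimes> horner R x (y i))"
    proof -
      have "horner R x w = (\<Oplus>i\<in>{..<n}. d i \<otimes> x [^] i)"
        unfolding S.horner_finsum[OF x w] using dR x by (intro finsum_cong') (auto simp: w_def)
      then have "b \<otimes> horner R x w = (\<Oplus>i\<in>{..<n}. b \<otimes> (d i \<otimes> x [^] i))"
        using dR x b by (simp add: finsum_rdistr Pi_def)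
      also have "\<dots> = (\<Oplus>i\<in>{..<n}. d i \<otimes> horner R x (y i))"
        using dR x b by (intro finsum_cong') (auto simp: hy m_ac)
      finally show ?thesis .
    qed
    have "{..n} = insert n {..<n}" by auto
    then have "(\<Oplus>i\<in>{..n}. d i \<otimes> horner R x (y i)) = d n \<otimes> horner R x (y n) \<oplus> b \<otimes> horner R x w"
      unfolding hw using dR S.horner_closed[OF x yA] by simp
    then have bw: "d n \<oplus> b \<otimes> horner R x w = \<zero>" using total dR by (simp add: hy)
    have wR: "horner R x w \<in> carrier R" by (rule S.horner_closed[OF x w])
    have apow: "a [^] (m::nat) \<noteq> \<zero>" for m
      using a0 aR by (induction m) (auto simp: integral_iff)
    \<comment> \<open>Otherwise b w(x) = 0, so w is a relation shorter than the minimal one; then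
      all d i vanish, and with them all c i.\<close>
    have dn: "d n \<noteq> \<zero>"
    proof
      assume d0: "d n = \<zero>"
      then have "horner R x w = \<zero>" using bw b wR b0 by (simp add: integral_iff)
      then have "\<forall>e\<in>set w. e = \<zero>" using w by (intro short) (auto simp: w_def n_def)
      then have "d i = \<zero>" if "i \<le> n" for i using that d0 by (cases "i = n") (auto simp: w_def)
      then have "c i = \<zero>" if "i \<le> n" for i using that cR aR apow by (simp add: d_def integral_iff)
      then show False using c(2) by auto
    qed
    \<comment> \<open>One product takes care of two conditions: \<psi> a has to be nonzero for the
      extension to x, and \<psi> (d n) for the value at b.\<close>
    have "a \<otimes> d n \<in> A - {\<zero>}"
      using dn a0 aR dR S.A_closed(4)[OF p0(2) dA[OF order_refl]] by (simp add: integral_iff)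
    then obtain \<psi> where \<psi>: "complex_hom_on R A \<psi>" "\<psi> (a \<otimes> d n) \<noteq> 0"
      using sep unfolding complex_separated_def by blast
    then have \<psi>a: "\<psi> a \<noteq> 0" "\<psi> (d n) \<noteq> 0"
      using p0(2) dA[of n] by (auto simp: complex_hom_on_def)
    have "coeff (Poly (map \<psi> p)) n = \<psi> a" by (simp add: pa n_def nth_default_append)
    \<comment> \<open>As \<psi> a is nonzero, the image of the minimal relation keeps its positive
      degree and so has a complex root.\<close>
    then have "n \<le> degree (Poly (map \<psi> p))" using \<psi>a by (intro le_degree) simp
    then have "\<not> constant (poly (Poly (map \<psi> p)))" using n by (simp add: constant_degree)
    then obtain t where t: "complex_horner \<psi> t (p0 @ [a]) = 0"
      unfolding complex_horner_poly pa using fundamental_theorem_of_algebra by blast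
    \<comment> \<open>The pseudo-remainder of a relation vanishes at x and is shorter than the
      minimal relation, so all its coefficients are zero. Hence t satisfies every relation of
      x.\<close>
    have "complex_horner \<psi> t r = 0" if r: "r \<in> lists A" "horner R x r = \<zero>" for r
    proof -
      obtain m s where s: "s \<in> lists A" "length s = length p0" "a [^] (m::nat) \<otimes> horner R x r = horner R x s"
        "\<psi> a ^ m * complex_horner \<psi> t r = complex_horner \<psi> t s"
        using rem[OF r(1)] \<psi>(1) t by blast
      then have "\<forall>e\<in>set s. e = \<zero>" using r aR by (intro short) auto
      then have "complex_horner \<psi> t s = 0"
        using S.hom_zero[OF \<psi>(1)] by (intro complex_horner_zero) auto
      then show ?thesis using s(4) \<psi>a by simp
    qed
    from ext[OF \<psi>(1) this] obtain \<psi>' where \<psi>': "complex_hom_on R (horner R x ` lists A) \<psi>'"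
      and val: "\<And>p. p \<in> lists A \<Longrightarrow> \<psi>' (horner R x p) = complex_horner \<psi> t p" by blast
    have "\<psi>' (d n \<oplus> b \<otimes> horner R x w) = \<psi>' (d n) + \<psi>' b * \<psi>' (horner R x w)"
    proof -
      have sub: "subring (horner R x ` lists A) R"
        using S.subring_adjoin[OF x] unfolding S.adjoin_def[OF x] .
      have dn: "d n \<in> horner R x ` lists A"
        by (rule image_eqI[of _ _ "[d n]"]) (use dR[of n] dA[of n] x in auto)
      have bw: "b \<in> horner R x ` lists A" "horner R x w \<in> horner R x ` lists A"
        using q w by auto
      show ?thesis
        using complex_hom_onD(1)[OF \<psi>' dn subringE(6)[OF sub bw]] complex_hom_onD(2)[OF \<psi>' bw] by simp
    qed
    moreover have "\<psi>' \<zero> = 0" using val[of "[]"] by simp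
    moreover have "\<psi>' (d n) = \<psi> (d n)" using val[of "[d n]"] dA[of n] dR[of n] x by simp
    ultimately have "\<psi>' b \<noteq> 0" using bw \<psi>a by auto
    then show ?thesis using \<psi>' by blast
  qed
qed

text \<open>In characteristic zero an integer k is determined by k times one, so the multiples of
  one form a copy of the integers, and a single embedding keeps every nonzero element
  nonzero.\<close>

lemma (in domain) complex_separated_int:
  assumes "char_zero R"
  shows "subring (range (\<lambda>k::int. [k] \<cdot> \<one>)) R" "complex_separated R (range (\<lambda>k::int. [k] \<cdot> \<one>))"
proof -
  let ?A = "range (\<lambda>k::int. [k] \<cdot> \<one>)"
  have add: "[k] \<cdot> \<one> \<oplus> [l] \<cdot> \<one> = [(k + l)] \<cdot> \<one>" for k l :: int
    by (simp add: add.int_pow_mult)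
  have minus: "\<ominus> ([k] \<cdot> \<one>) = [(- k)] \<cdot> \<one>" for k :: int
    by (simp add: add.int_pow_neg)
  have mult: "[k] \<cdot> \<one> \<otimes> [l] \<cdot> \<one> = [(k * l)] \<cdot> \<one>" for k l :: int
    by (simp add: add_pow_ldistr_int add.int_pow_pow mult.commute)
  have nz: "k = 0" if "[k] \<cdot> \<one> = \<zero>" for k :: int
  proof (rule ccontr)
    assume "k \<noteq> 0"
    have "[\<bar>k\<bar>] \<cdot> \<one> = \<zero>" using that minus[of k] by (cases "k \<ge> 0") auto
    then have "[nat \<bar>k\<bar>] \<cdot> \<one> = \<zero>" by (simp add: add_pow_int_ge)
    then show False using assms \<open>k \<noteq> 0\<close> unfolding char_zero_def by (metis zero_less_abs_iff zero_less_nat_eq)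
  qed
  have inj: "k = l" if "[k] \<cdot> \<one> = [l] \<cdot> \<one>" for k l :: int
  proof -
    have "[(k - l)] \<cdot> \<one> = \<zero>" using that add[of k "- l"] minus[of l] r_neg[of "[l] \<cdot> \<one>"] by simp
    then show ?thesis using nz[of "k - l"] by simp
  qed
  show "subring ?A R"
  proof (rule subringI)
    show "\<one> \<in> ?A" by (rule image_eqI[of _ _ 1]) auto
  qed (auto simp: add minus mult)
  define \<psi> :: "'a \<Rightarrow> complex" where "\<psi> y = of_int (THE k. y = [k] \<cdot> \<one>)" for y
  have \<psi>: "\<psi> ([k] \<cdot> \<one>) = of_int k" for k :: int
    unfolding \<psi>_def using inj by (subst the_equality[of _ k]) auto
  have "\<psi> \<one> = 1" using \<psi>[of 1] by simp
  then have hom: "complex_hom_on R ?A \<psi>"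
    by (auto simp: complex_hom_on_def add mult \<psi>)
  show "complex_separated R ?A"
    unfolding complex_separated_def
  proof
    fix b assume "b \<in> ?A - {\<zero>}"
    then obtain k :: int where k: "b = [k] \<cdot> \<one>" "b \<noteq> \<zero>" by auto
    then have "k \<noteq> 0" by (auto simp: add_pow_int_ge)
    then show "\<exists>\<psi>. complex_hom_on R ?A \<psi> \<and> \<psi> b \<noteq> 0" using hom \<psi>[of k] k by auto
  qed
qed

text \<open>Induction over S: the integral multiples of one are the base, and the elements of S are
  adjoined one at a time.\<close>

lemma (in domain) ex_complex_separated:
  assumes "char_zero R" "finite S" "S \<subseteq> carrier R"
  shows "\<exists>A. subring A R \<and> S \<subseteq> A \<and> complex_separated R A"
  using assms(2,3)
proof (induction S rule: finite_induct)
  case empty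
  then show ?case using complex_separated_int[OF assms(1)] by blast
next
  case (insert x S)
  then obtain A where A: "subring A R" "S \<subseteq> A" "complex_separated R A" by auto
  interpret S: subring_of_cring A R
    using A is_cring by (simp add: subring_of_cring_def)
  have x: "x \<in> carrier R" using insert.prems by simp
  show ?case
    using S.subring_adjoin[OF x] S.mem_adjoin[OF x] complex_separated_adjoin[OF A(1,3) x] A(2)
    unfolding S.adjoin_def[OF x] by blast
qed

section \<open>Integral domains of characteristic zero\<close>

context cring_group
begin

text \<open>Kaplansky's trace. Only the coefficients at the group identity enter; unlike the sum of
  the full diagonal entries, which lie in a noncommutative ring in general, it takes equal values on
  AB and BA.\<close>

definition matrix_trace :: "nat \<Rightarrow> (nat \<times> nat \<Rightarrow> 'c \<Rightarrow> 'a) \<Rightarrow> 'a"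
  where "matrix_trace k A = (\<Oplus>i\<in>{..<k}. A (i, i) \<one>\<^bsub>H\<^esub>)"

lemma matrix_trace_add:
  assumes "A \<in> carrier (matrix_ring k KH)" "B \<in> carrier (matrix_ring k KH)"
  shows "matrix_trace k (A \<oplus>\<^bsub>matrix_ring k KH\<^esub> B) = matrix_trace k A \<oplus> matrix_trace k B"
proof -
  have "matrix_trace k (A \<oplus>\<^bsub>matrix_ring k KH\<^esub> B)
      = (\<Oplus>i\<in>{..<k}. A (i, i) \<one>\<^bsub>H\<^esub> \<oplus> B (i, i) \<one>\<^bsub>H\<^esub>)"
    unfolding matrix_trace_def
    using matrix_entry_closed[OF assms(1)] matrix_entry_closed[OF assms(2)]
    by (intro finsum_cong') (auto simp: matrix_ring_add group_algebra_add)
  also have "\<dots> = matrix_trace k A \<oplus> matrix_trace k B"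
    unfolding matrix_trace_def
    using matrix_entry_closed[OF assms(1)] matrix_entry_closed[OF assms(2)]
    by (intro finsum_addf) auto
  finally show ?thesis .
qed

lemma matrix_trace_closed:
  "A \<in> carrier (matrix_ring k KH) \<Longrightarrow> matrix_trace k A \<in> carrier K"
  unfolding matrix_trace_def by (auto intro!: finsum_closed matrix_entry_closed)

text \<open>The coefficient of a product at the identity pairs a with a^-1, which becomes symmetric
  in the factors on exchanging the two. The finite set S is closed under inversion so that this
  exchange is a bijection of S.\<close>

lemma matrix_trace_commute:
  assumes A: "A \<in> carrier (matrix_ring k KH)" and B: "B \<in> carrier (matrix_ring k KH)"
  shows "matrix_trace k (A \<otimes>\<^bsub>matrix_ring k KH\<^esub> B) = matrix_trace k (B \<otimes>\<^bsub>matrix_ring k KH\<^esub> A)"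
proof -
  obtain SA where SA: "finite SA" "SA \<subseteq> carrier H" "\<forall>i<k. \<forall>j<k. \<forall>a\<in>carrier H - SA. A (i, j) a = \<zero>"
    by (rule matrix_support[OF A])
  obtain SB where SB: "finite SB" "SB \<subseteq> carrier H" "\<forall>i<k. \<forall>j<k. \<forall>a\<in>carrier H - SB. B (i, j) a = \<zero>"
    by (rule matrix_support[OF B])
  define S where "S = (SA \<union> SB) \<union> (\<lambda>g. inv\<^bsub>H\<^esub> g) ` (SA \<union> SB)"
  have S: "finite S" "S \<subseteq> carrier H" using SA SB by (auto simp: S_def)
  have Sc: "g \<in> carrier H" if "g \<in> S" for g using that S by blast
  have Sinv: "inv\<^bsub>H\<^esub> g \<in> S" if "g \<in> S" for g
    using that SA(2) SB(2) by (auto simp: S_def subset_iff)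
  have supp: "\<forall>i<k. \<forall>j<k. \<forall>a\<in>carrier H - S. A (i, j) a = \<zero>" "\<forall>i<k. \<forall>j<k. \<forall>a\<in>carrier H - S. B (i, j) a = \<zero>"
    using SA SB by (auto simp: S_def)
  note Ac = matrix_entry_closed[OF A] and Bc = matrix_entry_closed[OF B]
  have bij: "bij_betw (\<lambda>g. inv\<^bsub>H\<^esub> g) S S"
    using Sinv Sc by (intro bij_betw_byWitness[where f' = "\<lambda>g. inv\<^bsub>H\<^esub> g"]) auto
  have "matrix_trace k (A \<otimes>\<^bsub>matrix_ring k KH\<^esub> B)
      = (\<Oplus>i\<in>{..<k}. \<Oplus>c\<in>{..<k}. \<Oplus>a\<in>S. A (i, c) a \<otimes> B (c, i) (inv\<^bsub>H\<^esub> a \<otimes>\<^bsub>H\<^esub> \<one>\<^bsub>H\<^esub>))"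
    unfolding matrix_trace_def using Ac Bc Sc S supp
    by (intro finsum_cong' matrix_group_algebra_mult[OF A B]) (auto intro!: finsum_closed)
  also have "\<dots> = (\<Oplus>i\<in>{..<k}. \<Oplus>c\<in>{..<k}. \<Oplus>a\<in>S. B (c, i) a \<otimes> A (i, c) (inv\<^bsub>H\<^esub> a \<otimes>\<^bsub>H\<^esub> \<one>\<^bsub>H\<^esub>))"
  proof (rule finsum_cong', goal_cases)
    case i: (3 i)
    show ?case
    proof (rule finsum_cong', goal_cases)
      case c: (3 c)
      show ?case
        by (rule finsum_bij[OF bij]) (use i c Ac Bc Sc in \<open>auto simp: m_comm\<close>)
    qed (use i Ac Bc Sc in \<open>auto intro!: finsum_closed\<close>)
  qed (use Ac Bc Sc in \<open>auto intro!: finsum_closed\<close>)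
  also have "\<dots> = (\<Oplus>c\<in>{..<k}. \<Oplus>i\<in>{..<k}. \<Oplus>a\<in>S. B (c, i) a \<otimes> A (i, c) (inv\<^bsub>H\<^esub> a \<otimes>\<^bsub>H\<^esub> \<one>\<^bsub>H\<^esub>))"
    using Ac Bc Sc by (intro finsum_swap) (auto intro!: finsum_closed)
  also have "\<dots> = matrix_trace k (B \<otimes>\<^bsub>matrix_ring k KH\<^esub> A)"
    unfolding matrix_trace_def using Ac Bc Sc S supp
    by (intro finsum_cong' matrix_group_algebra_mult[OF B A, symmetric])
      (auto intro!: finsum_closed matrix_entry_closed ring.ring_simprules(5)[OF ring.ring_matrix_ring[OF ring_group_algebra]] A B)
  finally show ?thesis .
qed

text \<open>The idempotent \<open>1 - v u\<close> has trace zero because \<open>u v = 1\<close>.\<close>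

theorem char_zero_stably_finite:
  assumes "domain K" "char_zero K"
  shows "stably_finite KH"
  unfolding stably_finite_def
proof (intro allI impI)
  fix k :: nat assume k: "k \<ge> 1"
  let ?M = "matrix_ring k KH"
  interpret domain K by (rule assms(1))
  interpret KH: ring KH by (rule ring_group_algebra)
  interpret M: ring ?M by (rule KH.ring_matrix_ring)
  show "dedekind_finite ?M"
  proof (rule M.dedekind_finiteI, rule ccontr)
    fix u v assume u: "u \<in> carrier ?M" and v: "v \<in> carrier ?M" and uv: "u \<otimes>\<^bsub>?M\<^esub> v = \<one>\<^bsub>?M\<^esub>"
      and "v \<otimes>\<^bsub>?M\<^esub> u \<noteq> \<one>\<^bsub>?M\<^esub>"
    obtain f where f: "f \<in> carrier ?M" and ff: "f \<otimes>\<^bsub>?M\<^esub> f = f"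
      and f1: "f \<oplus>\<^bsub>?M\<^esub> v \<otimes>\<^bsub>?M\<^esub> u = \<one>\<^bsub>?M\<^esub>"
      using M.one_sided_inverse_defect[OF u v uv] by blast
    have f0: "f \<noteq> \<zero>\<^bsub>?M\<^esub>" using u v \<open>v \<otimes>\<^bsub>?M\<^esub> u \<noteq> \<one>\<^bsub>?M\<^esub>\<close> f1 by auto
    have tr: "matrix_trace k f = \<zero>"
    proof -
      have "matrix_trace k f \<oplus> matrix_trace k (v \<otimes>\<^bsub>?M\<^esub> u) = matrix_trace k \<one>\<^bsub>?M\<^esub>"
        using matrix_trace_add[OF f M.m_closed[OF v u]] f1 by simp
      also have "matrix_trace k (v \<otimes>\<^bsub>?M\<^esub> u) = matrix_trace k \<one>\<^bsub>?M\<^esub>"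
        using matrix_trace_commute[OF u v] uv by simp
      finally show ?thesis using matrix_trace_closed[OF f] matrix_trace_closed[OF M.one_closed]
        by (metis add.r_cancel_one)
    qed
    obtain F where F: "finite F" "F \<subseteq> carrier H" "\<forall>i<k. \<forall>j<k. \<forall>a\<in>carrier H - F. f (i, j) a = \<zero>"
      by (rule matrix_support[OF f])
    obtain i0 j0 g0 where ij0: "i0 < k" "j0 < k" "g0 \<in> carrier H" "f (i0, j0) g0 \<noteq> \<zero>"
      by (rule matrix_nonzero[OF f f0])
    let ?S = "(\<lambda>(i, j, g). f (i, j) g) ` ({..<k} \<times> {..<k} \<times> F)"
    have "finite ?S" "?S \<subseteq> carrier K" using F matrix_entry_closed[OF f] by auto
    then obtain A where A: "subring A K" "?S \<subseteq> A" "complex_separated K A"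
      using ex_complex_separated[OF assms(2)] by blast
    interpret S: subring_of_cring A K
      using A is_cring by (simp add: subring_of_cring_def)
    have fA: "f (i, j) x \<in> A" if "i < k" "j < k" "x \<in> carrier H" for i j x
    proof (cases "x \<in> F")
      case True
      then have "f (i, j) x \<in> ?S" using that by force
      then show ?thesis using A(2) by blast
    qed (use F that S.A_closed(1) in auto)
    \<comment> \<open>The images of the coefficients under \<psi> form a complex idempotent of trace
      zero, and \<psi> is chosen so that one of its coefficients is nonzero.\<close>
    obtain \<psi> where \<psi>: "complex_hom_on K A \<psi>" "\<psi> (f (i0, j0) g0) \<noteq> 0"
      using A(3) fA[OF ij0(1-3)] ij0(4) unfolding complex_separated_def by blast
    have "\<psi> (f (i0, j0) g0) = 0"
    proof (rule H.idempotent_trace_zero[OF F(1,2), of k "\<lambda>i j x. \<psi> (f (i, j) x)"])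
      fix i j x assume ijx: "i < k" "j < k" "x \<in> carrier H"
      have in_H: "inv\<^bsub>H\<^esub> a \<otimes>\<^bsub>H\<^esub> x \<in> carrier H" "a \<in> carrier H" if "a \<in> F" for a
        using that F ijx by auto
      have "f (i, j) x = (\<Oplus>c\<in>{..<k}. \<Oplus>a\<in>F. f (i, c) a \<otimes> f (c, j) (inv\<^bsub>H\<^esub> a \<otimes>\<^bsub>H\<^esub> x))"
        using matrix_group_algebra_mult[OF f f ijx F(1,2)] F(3) ijx ff by simp
      also have "\<psi> \<dots> = (\<Sum>c<k. \<psi> (\<Oplus>a\<in>F. f (i, c) a \<otimes> f (c, j) (inv\<^bsub>H\<^esub> a \<otimes>\<^bsub>H\<^esub> x)))"
        using ijx in_H fA
        by (intro S.hom_finsum[OF \<psi>(1)]) (auto intro!: subring_finsum[OF A(1)] S.A_closed(4))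
      also have "\<dots> = (\<Sum>c<k. \<Sum>a\<in>F. \<psi> (f (i, c) a \<otimes> f (c, j) (inv\<^bsub>H\<^esub> a \<otimes>\<^bsub>H\<^esub> x)))"
        using ijx in_H fA F
        by (intro sum.cong refl S.hom_finsum[OF \<psi>(1)]) (auto intro!: S.A_closed(4))
      also have "\<dots> = (\<Sum>c<k. \<Sum>a\<in>F. \<psi> (f (i, c) a) * \<psi> (f (c, j) (inv\<^bsub>H\<^esub> a \<otimes>\<^bsub>H\<^esub> x)))"
        using ijx in_H fA \<psi>(1) by (intro sum.cong refl) (simp add: complex_hom_on_def)
      finally show "\<psi> (f (i, j) x) = (\<Sum>c<k. \<Sum>a\<in>F. \<psi> (f (i, c) a) * \<psi> (f (c, j) (inv\<^bsub>H\<^esub> a \<otimes>\<^bsub>H\<^esub> x)))" .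
    next
      fix i j x assume "i < k" "j < k" "x \<in> carrier H - F"
      then show "\<psi> (f (i, j) x) = 0" using F(3) S.hom_zero[OF \<psi>(1)] by simp
    next
      have "(\<Sum>i<k. \<psi> (f (i, i) \<one>\<^bsub>H\<^esub>)) = \<psi> (matrix_trace k f)"
        unfolding matrix_trace_def using fA by (intro S.hom_finsum[OF \<psi>(1), symmetric]) auto
      then show "(\<Sum>i<k. \<psi> (f (i, i) \<one>\<^bsub>H\<^esub>)) = 0" using tr S.hom_zero[OF \<psi>(1)] by simp
    qed (use ij0 in auto)
    then show False using \<psi>(2) by simp
  qed
qed

end

section \<open>Ample groupoids\<close>

context groupoid
begin

lemma dom_ginv: "a \<in> carrier G \<Longrightarrow> dom_of G (ginv G a) = ran_of G a"
  by (simp add: dom_of_def ran_of_def ginv_ginv)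

lemma ran_ginv: "a \<in> carrier G \<Longrightarrow> ran_of G (ginv G a) = dom_of G a"
  by (simp add: dom_of_def ran_of_def ginv_ginv)

lemma composable_ginv:
  "a \<in> carrier G \<Longrightarrow> (ginv G a, a) \<in> composable G" "a \<in> carrier G \<Longrightarrow> (a, ginv G a) \<in> composable G"
  by (simp_all add: composable_def ginv_closed dom_ginv ran_ginv)

lemma dom_closed: "a \<in> carrier G \<Longrightarrow> dom_of G a \<in> carrier G"
  using comp_closed[OF composable_ginv(1)] by (simp add: dom_of_def)

lemma dom_unit: "a \<in> carrier G \<Longrightarrow> dom_of G a \<in> unit_space G"
  by (simp add: unit_space_def)

lemma ran_unit: "a \<in> carrier G \<Longrightarrow> ran_of G a \<in> unit_space G"
  using dom_unit[OF ginv_closed] by (simp add: dom_ginv)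

lemma unit_spaceD:
  assumes "x \<in> unit_space G"
  shows "x \<in> carrier G" "dom_of G x = x" "ran_of G x = x"
proof -
  obtain a where a: "a \<in> carrier G" "x = dom_of G a" using assms by (auto simp: unit_space_def)
  show "x \<in> carrier G" using a dom_closed by simp
  show "dom_of G x = x" using dom_comp[OF composable_ginv(1)[OF a(1)]] a by (simp add: dom_of_def)
  show "ran_of G x = x"
    using ran_comp[OF composable_ginv(1)[OF a(1)]] a ran_ginv[OF a(1)] by (simp add: dom_of_def)
qed

lemma ginv_comp_cancel:
  assumes "(a, b) \<in> composable G"
  shows "ginv G a \<odot> (a \<odot> b) = b"
proof -
  have ab: "a \<in> carrier G" "b \<in> carrier G" "dom_of G a = ran_of G b"
    using assms by (auto simp: composable_def)
  have "ginv G a \<odot> (a \<odot> b) = ginv G a \<odot> a \<odot> b"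
    using comp_assoc[OF composable_ginv(1)[OF ab(1)] assms] by simp
  also have "\<dots> = b" using ab ran_comp_self[of b] by (simp add: dom_of_def[symmetric])
  finally show ?thesis .
qed

lemma comp_ginv_cancel:
  assumes "a \<in> carrier G" "c \<in> carrier G" "ran_of G a = ran_of G c"
  shows "a \<odot> (ginv G a \<odot> c) = c"
  using ginv_comp_cancel[of "ginv G a" c] assms
  by (simp add: composable_def ginv_closed dom_ginv ginv_ginv)

text \<open>The factorizations of x are parametrized by their left factors, the arrows with the same
  range as x. This turns convolution into a sum over one arrow, as in a group algebra.\<close>

lemma comp_eq_iff:
  assumes "a \<in> carrier G" "x \<in> carrier G"
  shows "(a, b) \<in> composable G \<and> a \<odot> b = x \<longleftrightarrow> ran_of G a = ran_of G x \<and> b = ginv G a \<odot> x"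
proof
  assume "(a, b) \<in> composable G \<and> a \<odot> b = x"
  then show "ran_of G a = ran_of G x \<and> b = ginv G a \<odot> x"
    using ran_comp[of a b] ginv_comp_cancel[of a b] by auto
next
  assume r: "ran_of G a = ran_of G x \<and> b = ginv G a \<odot> x"
  have c: "(ginv G a, x) \<in> composable G"
    using assms r by (simp add: composable_def ginv_closed dom_ginv)
  show "(a, b) \<in> composable G \<and> a \<odot> b = x"
    using r assms comp_ginv_cancel[of a x] comp_closed[OF c] ran_comp[OF c] ran_ginv[OF assms(1)]
    by (auto simp: composable_def)
qed

lemma group_isotropy:
  assumes x: "x \<in> unit_space G"
  shows "group (isotropy_group G x)"
proof (rule groupI)
  note xx = unit_spaceD[OF x]
  show "\<one>\<^bsub>isotropy_group G x\<^esub> \<in> carrier (isotropy_group G x)"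
    using xx by (simp add: isotropy_group_def)
  fix a assume a: "a \<in> carrier (isotropy_group G x)"
  then show "\<one>\<^bsub>isotropy_group G x\<^esub> \<otimes>\<^bsub>isotropy_group G x\<^esub> a = a"
    using ran_comp_self[of a] by (auto simp: isotropy_group_def)
  show "\<exists>b\<in>carrier (isotropy_group G x). b \<otimes>\<^bsub>isotropy_group G x\<^esub> a = \<one>\<^bsub>isotropy_group G x\<^esub>"
    using a by (intro bexI[of _ "ginv G a"])
      (auto simp: isotropy_group_def dom_of_def[symmetric] dom_ginv ran_ginv ginv_closed)
  fix b assume b: "b \<in> carrier (isotropy_group G x)"
  then have ab: "(a, b) \<in> composable G" using a by (simp add: isotropy_group_def composable_def)
  show "a \<otimes>\<^bsub>isotropy_group G x\<^esub> b \<in> carrier (isotropy_group G x)"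
    using a b comp_closed[OF ab] dom_comp[OF ab] ran_comp[OF ab] by (simp add: isotropy_group_def)
  fix c assume c: "c \<in> carrier (isotropy_group G x)"
  then have bc: "(b, c) \<in> composable G" using b by (simp add: isotropy_group_def composable_def)
  show "a \<otimes>\<^bsub>isotropy_group G x\<^esub> b \<otimes>\<^bsub>isotropy_group G x\<^esub> c
      = a \<otimes>\<^bsub>isotropy_group G x\<^esub> (b \<otimes>\<^bsub>isotropy_group G x\<^esub> c)"
    using comp_assoc[OF ab bc] by (simp add: isotropy_group_def)
qed

end

section \<open>Continuity and openness of the structure maps, and products of bisections\<close>

context topological_groupoid
begin

lemma topspace_unit: "topspace (unit_topology G T) = unit_space G"
  using unit_spaceD(1) by (auto simp: unit_topology_def topspace_eq)

lemma continuous_map_comp: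
  assumes "continuous_map X T f" "continuous_map X T g"
    and "\<And>x. x \<in> topspace X \<Longrightarrow> dom_of G (f x) = ran_of G (g x)"
  shows "continuous_map X T (\<lambda>x. f x \<odot> g x)"
proof -
  have "f x \<in> carrier G \<and> g x \<in> carrier G" if "x \<in> topspace X" for x
    using that assms(1,2) topspace_eq by (auto simp: continuous_map_def)
  then have "continuous_map X (subtopology (prod_topology T T) (composable G)) (\<lambda>x. (f x, g x))"
    using assms by (auto simp: continuous_map_in_subtopology continuous_map_paired composable_def)
  from continuous_map_compose[OF this continuous_comp] show ?thesis by (simp add: o_def)
qed

lemma continuous_dom: "continuous_map T (unit_topology G T) (dom_of G)"
proof -
  have "continuous_map T T (\<lambda>a. ginv G a \<odot> a)"
    using continuous_ginv by (intro continuous_map_comp) (auto simp: topspace_eq dom_ginv)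
  then have "continuous_map T T (dom_of G)" by (simp add: dom_of_def[abs_def])
  then show ?thesis
    by (auto simp: unit_topology_def continuous_map_in_subtopology topspace_eq dom_unit)
qed

lemma continuous_ran: "continuous_map T (unit_topology G T) (ran_of G)"
proof -
  have "continuous_map T (unit_topology G T) (dom_of G \<circ> ginv G)"
    by (rule continuous_map_compose[OF continuous_ginv continuous_dom])
  then show ?thesis
    by (rule continuous_map_eq) (auto simp: topspace_eq dom_ginv)
qed

lemma openin_ginv_image:
  assumes "openin T U"
  shows "openin T (ginv G ` U)"
proof -
  have "U \<subseteq> carrier G" using openin_subset[OF assms] topspace_eq by simp
  then have "ginv G ` U = {a \<in> topspace T. ginv G a \<in> U}"
    by (auto simp: topspace_eq ginv_closed ginv_ginv intro!: image_eqI[of _ "ginv G" "ginv G _"])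
  then show ?thesis using openin_continuous_map_preimage[OF continuous_ginv assms] by simp
qed

lemma compactin_dom_image: "compactin T U \<Longrightarrow> compactin (unit_topology G T) (dom_of G ` U)"
  by (rule image_compactin[OF _ continuous_dom])

lemma compactin_ran_image: "compactin T U \<Longrightarrow> compactin (unit_topology G T) (ran_of G ` U)"
  by (rule image_compactin[OF _ continuous_ran])

end

lemma local_homeomorphism_imp_open_map:
  assumes "local_homeomorphism X Y f"
  shows "open_map X Y f"
  unfolding open_map_def
proof (intro allI impI)
  fix W assume W: "openin X W"
  show "openin Y (f ` W)"
  proof (subst openin_subopen, intro ballI)
    fix y assume "y \<in> f ` W"
    then obtain x where x: "x \<in> W" "y = f x" by auto
    then have "x \<in> topspace X" using openin_subset[OF W] by auto
    then obtain U where U: "openin X U" "x \<in> U" "openin Y (f ` U)"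
      "homeomorphic_map (subtopology X U) (subtopology Y (f ` U)) f"
      using assms unfolding local_homeomorphism_def by blast
    have "openin (subtopology X U) (W \<inter> U)" using W by (auto simp: openin_subtopology)
    then have "openin (subtopology Y (f ` U)) (f ` (W \<inter> U))"
      using homeomorphic_imp_open_map[OF U(4)] by (auto simp: open_map_def)
    then have "openin Y (f ` (W \<inter> U))" using U(3) openin_trans_full by blast
    then show "\<exists>V. openin Y V \<and> y \<in> V \<and> V \<subseteq> f ` W" using x U(2) by blast
  qed
qed

context etale_groupoid
begin

lemma open_map_dom: "open_map T (unit_topology G T) (dom_of G)"
  by (rule local_homeomorphism_imp_open_map[OF local_homeomorphism_dom])

lemma open_map_ran: "open_map T (unit_topology G T) (ran_of G)"
  unfolding open_map_def
proof (intro allI impI)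
  fix U assume U: "openin T U"
  have "U \<subseteq> carrier G" using openin_subset[OF U] topspace_eq by simp
  then have "ran_of G ` U = dom_of G ` (ginv G ` U)"
    by (force simp: dom_ginv image_image intro!: image_cong)
  then show "openin (unit_topology G T) (ran_of G ` U)"
    using open_map_dom openin_ginv_image[OF U] by (simp add: open_map_def)
qed

text \<open>The preimage of W under the section is the range image of the intersection of U and W,
  which is open because the range map is open.\<close>

lemma continuous_ran_section:
  assumes U: "openin T U" "inj_on (ran_of G) U"
  shows "continuous_map (subtopology (unit_topology G T) (ran_of G ` U)) T (the_inv_into U (ran_of G))"
  unfolding continuous_map_alt
proof (intro conjI allI impI)
  have sub: "U \<subseteq> carrier G" using openin_subset[OF U(1)] topspace_eq by simp
  have top: "topspace (subtopology (unit_topology G T) (ran_of G ` U)) = ran_of G ` U"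
    using sub ran_unit by (auto simp: topspace_unit)
  show "the_inv_into U (ran_of G) \<in> topspace (subtopology (unit_topology G T) (ran_of G ` U)) \<rightarrow> topspace T"
    using sub the_inv_into_into[OF U(2)] by (auto simp: top topspace_eq)
  fix W assume W: "openin T W"
  have "the_inv_into U (ran_of G) -` W \<inter> topspace (subtopology (unit_topology G T) (ran_of G ` U))
      = ran_of G ` (U \<inter> W)"
    unfolding top using U(2) by (auto simp: the_inv_into_f_f)
  moreover have "openin (unit_topology G T) (ran_of G ` (U \<inter> W))"
    using open_map_ran openin_Int[OF U(1) W] by (simp add: open_map_def)
  ultimately show "openin (subtopology (unit_topology G T) (ran_of G ` U))
      (the_inv_into U (ran_of G) -` W \<inter> topspace (subtopology (unit_topology G T) (ran_of G ` U)))"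
    by (auto simp: openin_subtopology)
qed

definition set_comp :: "'a set \<Rightarrow> 'a set \<Rightarrow> 'a set"
  where "set_comp U V = (\<lambda>(a, b). a \<odot> b) ` (U \<times> V \<inter> composable G)"

text \<open>With s the inverse of the range map on U, an arrow c lies in UV if and only if its range
  lies in that of U and s(r(c))^-1 c lies in V. The first condition defines an open set D, and on D
  the second is the preimage of V under a continuous map.\<close>

lemma openin_set_comp:
  assumes U: "openin T U" "inj_on (ran_of G) U" and V: "openin T V"
  shows "openin T (set_comp U V)"
proof -
  let ?s = "the_inv_into U (ran_of G)"
  define D where "D = {c \<in> carrier G. ran_of G c \<in> ran_of G ` U}"
  have sub: "U \<subseteq> carrier G" "V \<subseteq> carrier G"
    using openin_subset[OF U(1)] openin_subset[OF V] topspace_eq by auto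
  have s: "?s (ran_of G c) \<in> U" "ran_of G (?s (ran_of G c)) = ran_of G c" if "c \<in> D" for c
    using that U(2) by (auto simp: D_def the_inv_into_f_f)
  have D: "openin T D"
  proof -
    have "openin (unit_topology G T) (ran_of G ` U)" using open_map_ran U by (simp add: open_map_def)
    from openin_continuous_map_preimage[OF continuous_ran this] show ?thesis
      by (simp add: D_def topspace_eq)
  qed
  have top: "topspace (subtopology T D) = D" by (auto simp: D_def topspace_eq)
  have "continuous_map (subtopology T D) (subtopology (unit_topology G T) (ran_of G ` U)) (ran_of G)"
    using continuous_map_from_subtopology[OF continuous_ran]
    by (auto simp: continuous_map_in_subtopology D_def)
  from continuous_map_compose[OF this continuous_ran_section[OF U]]
  have "continuous_map (subtopology T D) T (\<lambda>c. ?s (ran_of G c))" by (simp add: o_def)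
  from continuous_map_compose[OF this continuous_ginv]
  have "continuous_map (subtopology T D) T (\<lambda>c. ginv G (?s (ran_of G c)))" by (simp add: o_def)
  then have "continuous_map (subtopology T D) T (\<lambda>c. ginv G (?s (ran_of G c)) \<odot> c)"
  proof (rule continuous_map_comp)
    show "continuous_map (subtopology T D) T (\<lambda>c. c)"
      by (simp add: continuous_map_from_subtopology)
    show "dom_of G (ginv G (?s (ran_of G c))) = ran_of G c" if "c \<in> topspace (subtopology T D)" for c
      using that s sub by (simp add: top dom_ginv subset_iff)
  qed
  from openin_continuous_map_preimage[OF this V]
  have "openin (subtopology T D) {c \<in> D. ginv G (?s (ran_of G c)) \<odot> c \<in> V}"
    by (simp only: top)
  then have "openin T {c \<in> D. ginv G (?s (ran_of G c)) \<odot> c \<in> V}"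
    using D openin_trans_full by blast
  also have "{c \<in> D. ginv G (?s (ran_of G c)) \<odot> c \<in> V} = set_comp U V"
  proof (intro equalityI subsetI)
    fix c assume c: "c \<in> {c \<in> D. ginv G (?s (ran_of G c)) \<odot> c \<in> V}"
    let ?a = "?s (ran_of G c)"
    have a: "?a \<in> U" "ran_of G ?a = ran_of G c" using s c by auto
    have "(?a, ginv G ?a \<odot> c) \<in> composable G \<and> ?a \<odot> (ginv G ?a \<odot> c) = c"
      using comp_eq_iff[of ?a c] a sub c by (auto simp: D_def)
    then show "c \<in> set_comp U V"
      unfolding set_comp_def using a c by (intro image_eqI[of _ _ "(?a, ginv G ?a \<odot> c)"]) auto
  next
    fix c assume "c \<in> set_comp U V"
    then obtain a b where ab: "a \<in> U" "b \<in> V" "(a, b) \<in> composable G" "c = a \<odot> b"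
      by (auto simp: set_comp_def)
    have "ran_of G c = ran_of G a" using ab ran_comp by simp
    then show "c \<in> {c \<in> D. ginv G (?s (ran_of G c)) \<odot> c \<in> V}"
      using ab comp_closed[OF ab(3)] ginv_comp_cancel[OF ab(3)] U(2)
      by (auto simp: D_def the_inv_into_f_f)
  qed
  finally show ?thesis .
qed

end

context ample_groupoid
begin

text \<open>The composable pairs are the equalizer of two continuous maps into the unit space. This
  space is Hausdorff, so they are closed in the product, whether or not G itself is
  Hausdorff.\<close>

lemma compactin_set_comp:
  assumes "compactin T U" "compactin T V"
  shows "compactin T (set_comp U V)"
proof -
  let ?P = "prod_topology T T"
  have "closedin ?P {p \<in> topspace ?P. (dom_of G \<circ> fst) p = (ran_of G \<circ> snd) p}"
  proof (rule closedin_continuous_maps_eq[OF Hausdorff_units])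
    show "continuous_map ?P (unit_topology G T) (dom_of G \<circ> fst)"
      by (rule continuous_map_compose[OF continuous_map_fst continuous_dom])
    show "continuous_map ?P (unit_topology G T) (ran_of G \<circ> snd)"
      by (rule continuous_map_compose[OF continuous_map_snd continuous_ran])
  qed
  moreover have "{p \<in> topspace ?P. (dom_of G \<circ> fst) p = (ran_of G \<circ> snd) p} = composable G"
    by (auto simp: composable_def topspace_eq)
  ultimately have "compactin ?P (composable G \<inter> U \<times> V)"
    using assms by (intro closed_Int_compactin) (auto simp: compactin_Times)
  then have "compactin (subtopology ?P (composable G)) (composable G \<inter> U \<times> V)"
    by (simp add: compactin_subtopology)
  from image_compactin[OF this continuous_comp] show ?thesis
    by (simp add: set_comp_def Int_commute)
qed

lemma set_comp_bisection:
  assumes U: "U \<in> compact_open_bisections G T" and V: "V \<in> compact_open_bisections G T"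
  shows "set_comp U V \<in> compact_open_bisections G T"
proof -
  have UV: "openin T U" "compactin T U" "inj_on (dom_of G) U" "inj_on (ran_of G) U"
    "openin T V" "compactin T V" "inj_on (dom_of G) V" "inj_on (ran_of G) V"
    using assms by (auto simp: compact_open_bisections_def)
  have "inj_on (dom_of G) (set_comp U V)"
  proof (rule inj_onI)
    fix c c' assume "c \<in> set_comp U V" "c' \<in> set_comp U V" and eq: "dom_of G c = dom_of G c'"
    then obtain a b a' b' where ab: "a \<in> U" "b \<in> V" "(a, b) \<in> composable G" "c = a \<odot> b"
      "a' \<in> U" "b' \<in> V" "(a', b') \<in> composable G" "c' = a' \<odot> b'"
      by (auto simp: set_comp_def)
    have "b = b'" using eq ab dom_comp UV(7) by (auto dest: inj_onD)
    then have "dom_of G a = dom_of G a'" using ab by (auto simp: composable_def)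
    then have "a = a'" using ab UV(3) by (auto dest: inj_onD)
    then show "c = c'" using ab \<open>b = b'\<close> by simp
  qed
  moreover have "inj_on (ran_of G) (set_comp U V)"
  proof (rule inj_onI)
    fix c c' assume "c \<in> set_comp U V" "c' \<in> set_comp U V" and eq: "ran_of G c = ran_of G c'"
    then obtain a b a' b' where ab: "a \<in> U" "b \<in> V" "(a, b) \<in> composable G" "c = a \<odot> b"
      "a' \<in> U" "b' \<in> V" "(a', b') \<in> composable G" "c' = a' \<odot> b'"
      by (auto simp: set_comp_def)
    have "a = a'" using eq ab ran_comp UV(4) by (auto dest: inj_onD)
    then have "ran_of G b = ran_of G b'" using ab by (auto simp: composable_def)
    then have "b = b'" using ab UV(8) by (auto dest: inj_onD)
    then show "c = c'" using ab \<open>a = a'\<close> by simp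
  qed
  ultimately show ?thesis
    using openin_set_comp[OF UV(1,4,5)] compactin_set_comp[OF UV(2,6)]
    by (simp add: compact_open_bisections_def)
qed

text \<open>A closed part of a compact set is compact, and a compact discrete space is
  finite.\<close>

lemma finite_closed_discrete_Int_compact:
  assumes X: "closedin (unit_topology G T) X" "subtopology (unit_topology G T) X = discrete_topology X"
    and C: "compactin (unit_topology G T) C"
  shows "finite (X \<inter> C)"
proof -
  have "compactin (unit_topology G T) (X \<inter> C)" by (rule closed_Int_compactin[OF X(1) C])
  then have "compactin (subtopology (unit_topology G T) X) (X \<inter> C)"
    by (simp add: compactin_subtopology)
  then show ?thesis by (simp add: X(2) compactin_discrete_topology)
qed

end

section \<open>Groupoid algebras\<close>

locale ample_groupoid_cring = K: cring K + G: ample_groupoid G T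
  for K :: "('k, 'm) ring_scheme" (structure)
    and G :: "('a, 'n) groupoid_scheme" and T :: "'a topology"
begin

abbreviation "KG \<equiv> groupoid_algebra K G T"

abbreviation "bisections \<equiv> compact_open_bisections G T"

abbreviation kg_span :: "'a set set \<Rightarrow> ('a set \<Rightarrow> 'k) \<Rightarrow> 'a \<Rightarrow> 'k"
  where "kg_span F c \<equiv> (\<lambda>a\<in>carrier G. \<Oplus>U\<in>F. c U \<otimes> ring_indicator K U a)"

lemma bisection_subset: "U \<in> bisections \<Longrightarrow> U \<subseteq> carrier G"
  using openin_subset G.topspace_eq by (auto simp: compact_open_bisections_def)

lemma indicator_closed [simp]: "ring_indicator K U a \<in> carrier K"
  by (simp add: ring_indicator_def)

lemma KG_carrierE:
  assumes "f \<in> carrier KG"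
  obtains F c where "finite F" "F \<subseteq> bisections" "\<forall>U\<in>F. c U \<in> carrier K" "f = kg_span F c"
proof -
  obtain F c where "f = kg_span F c" "finite F \<and> F \<subseteq> bisections \<and> c \<in> F \<rightarrow> carrier K"
    using assms unfolding groupoid_algebra_def by auto
  then show thesis using that by blast
qed

lemma KG_spanI:
  assumes "finite F" "F \<subseteq> bisections" "\<And>U. U \<in> F \<Longrightarrow> c U \<in> carrier K"
  shows "kg_span F c \<in> carrier KG"
  using assms unfolding groupoid_algebra_def by auto

lemma kg_span_outside:
  assumes "\<forall>U\<in>F. c U \<in> carrier K" "a \<in> carrier G" "a \<notin> \<Union>F"
  shows "kg_span F c a = \<zero>"
proof -
  have "(\<Oplus>U\<in>F. c U \<otimes> ring_indicator K U a) = (\<Oplus>U\<in>F. \<zero>)"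
    by (rule K.finsum_cong') (use assms in \<open>auto simp: ring_indicator_def\<close>)
  then show ?thesis using assms(2) by simp
qed

lemma KG_val: "f \<in> carrier KG \<Longrightarrow> a \<in> carrier G \<Longrightarrow> f a \<in> carrier K"
  by (erule KG_carrierE) (auto intro!: K.finsum_closed)

lemma KG_extensional: "f \<in> carrier KG \<Longrightarrow> f \<in> extensional (carrier G)"
  by (erule KG_carrierE) auto

lemma KG_eqI:
  "f \<in> carrier KG \<Longrightarrow> g \<in> carrier KG \<Longrightarrow> (\<And>a. a \<in> carrier G \<Longrightarrow> f a = g a) \<Longrightarrow> f = g"
  by (rule extensionalityI[OF KG_extensional KG_extensional])

lemma KG_add_val: "a \<in> carrier G \<Longrightarrow> (f \<oplus>\<^bsub>KG\<^esub> g) a = f a \<oplus> g a"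
  by (simp add: groupoid_algebra_def)

lemma KG_zero_val: "a \<in> carrier G \<Longrightarrow> \<zero>\<^bsub>KG\<^esub> a = \<zero>"
  by (simp add: groupoid_algebra_def)

lemma KG_zero_closed: "\<zero>\<^bsub>KG\<^esub> \<in> carrier KG"
  using KG_spanI[of "{}" undefined] by (simp add: groupoid_algebra_def)

lemma KG_monomial:
  assumes "U \<in> bisections" "c \<in> carrier K"
  shows "(\<lambda>a\<in>carrier G. c \<otimes> ring_indicator K U a) \<in> carrier KG"
  using KG_spanI[of "{U}" "\<lambda>_. c"] assms by simp

lemma KG_add_closed:
  assumes f: "f \<in> carrier KG" and g: "g \<in> carrier KG"
  shows "f \<oplus>\<^bsub>KG\<^esub> g \<in> carrier KG"
proof -
  obtain F c where F: "finite F" "F \<subseteq> bisections" "\<forall>U\<in>F. c U \<in> carrier K" "f = kg_span F c"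
    by (rule KG_carrierE[OF f])
  obtain F' c' where F': "finite F'" "F' \<subseteq> bisections" "\<forall>U\<in>F'. c' U \<in> carrier K" "g = kg_span F' c'"
    by (rule KG_carrierE[OF g])
  \<comment> \<open>The coefficients are extended by zero, so that both sums can run over the union
    of F and F'.\<close>
  define d d' where "d U = (if U \<in> F then c U else \<zero>)" and "d' U = (if U \<in> F' then c' U else \<zero>)" for U
  have dc: "d U \<in> carrier K" "d' U \<in> carrier K" for U using F F' by (auto simp: d_def d'_def)
  have "f \<oplus>\<^bsub>KG\<^esub> g = kg_span (F \<union> F') (\<lambda>U. d U \<oplus> d' U)"
  proof (rule extensionalityI[of _ "carrier G"])
    fix a assume a: "a \<in> carrier G"
    have "f a = (\<Oplus>U\<in>F. d U \<otimes> ring_indicator K U a)"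
      using F a dc by (auto simp: d_def intro!: K.finsum_cong')
    also have "\<dots> = (\<Oplus>U\<in>F \<union> F'. d U \<otimes> ring_indicator K U a)"
      using F F' dc by (intro K.finsum_mono_neutral) (auto simp: d_def)
    finally have fa: "f a = (\<Oplus>U\<in>F \<union> F'. d U \<otimes> ring_indicator K U a)" .
    have "g a = (\<Oplus>U\<in>F'. d' U \<otimes> ring_indicator K U a)"
      using F' a dc by (auto simp: d'_def intro!: K.finsum_cong')
    also have "\<dots> = (\<Oplus>U\<in>F \<union> F'. d' U \<otimes> ring_indicator K U a)"
      using F F' dc by (intro K.finsum_mono_neutral) (auto simp: d'_def)
    finally have ga: "g a = (\<Oplus>U\<in>F \<union> F'. d' U \<otimes> ring_indicator K U a)" .
    have "f a \<oplus> g a = (\<Oplus>U\<in>F \<union> F'. d U \<otimes> ring_indicator K U a \<oplus> d' U \<otimes> ring_indicator K U a)"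
      unfolding fa ga using dc by (intro K.finsum_addf[symmetric]) auto
    also have "\<dots> = (\<Oplus>U\<in>F \<union> F'. (d U \<oplus> d' U) \<otimes> ring_indicator K U a)"
      using dc by (intro K.finsum_cong') (auto simp: K.l_distr)
    finally show "(f \<oplus>\<^bsub>KG\<^esub> g) a = kg_span (F \<union> F') (\<lambda>U. d U \<oplus> d' U) a"
      using a by (simp add: KG_add_val)
  qed (auto simp: groupoid_algebra_def)
  also have "\<dots> \<in> carrier KG" using F F' dc by (intro KG_spanI) auto
  finally show ?thesis .
qed

lemma KG_minus_closed:
  assumes f: "f \<in> carrier KG"
  shows "(\<lambda>a\<in>carrier G. \<ominus> f a) \<in> carrier KG"
proof -
  obtain F c where F: "finite F" "F \<subseteq> bisections" "\<forall>U\<in>F. c U \<in> carrier K" "f = kg_span F c"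
    by (rule KG_carrierE[OF f])
  have "(\<lambda>a\<in>carrier G. \<ominus> f a) = kg_span F (\<lambda>U. \<ominus> \<one> \<otimes> c U)"
  proof (rule extensionalityI[of _ "carrier G"])
    fix a assume a: "a \<in> carrier G"
    have "\<ominus> f a = \<ominus> \<one> \<otimes> (\<Oplus>U\<in>F. c U \<otimes> ring_indicator K U a)"
      using KG_val[OF f a] F(4) a by (simp add: K.l_minus)
    also have "\<dots> = (\<Oplus>U\<in>F. \<ominus> \<one> \<otimes> (c U \<otimes> ring_indicator K U a))"
      using F by (intro K.finsum_rdistr) auto
    also have "\<dots> = (\<Oplus>U\<in>F. \<ominus> \<one> \<otimes> c U \<otimes> ring_indicator K U a)"
      using F by (intro K.finsum_cong') (auto simp: K.m_assoc)
    finally show "(\<lambda>a\<in>carrier G. \<ominus> f a) a = kg_span F (\<lambda>U. \<ominus> \<one> \<otimes> c U) a"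
      using a by simp
  qed auto
  also have "\<dots> \<in> carrier KG" using F by (intro KG_spanI) auto
  finally show ?thesis .
qed

lemma abelian_monoid_KG: "abelian_monoid KG"
proof (rule abelian_monoidI)
  fix f g h assume f: "f \<in> carrier KG" and g: "g \<in> carrier KG" and h: "h \<in> carrier KG"
  note val = KG_val[OF f] KG_val[OF g] KG_val[OF h]
  show "f \<oplus>\<^bsub>KG\<^esub> g \<in> carrier KG" by (rule KG_add_closed[OF f g])
  show "f \<oplus>\<^bsub>KG\<^esub> g \<oplus>\<^bsub>KG\<^esub> h = f \<oplus>\<^bsub>KG\<^esub> (g \<oplus>\<^bsub>KG\<^esub> h)"
    using f g h val by (intro KG_eqI KG_add_closed) (simp_all add: KG_add_val K.a_assoc)
  show "f \<oplus>\<^bsub>KG\<^esub> g = g \<oplus>\<^bsub>KG\<^esub> f"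
    using f g val by (intro KG_eqI KG_add_closed) (simp_all add: KG_add_val K.a_comm)
  show "\<zero>\<^bsub>KG\<^esub> \<oplus>\<^bsub>KG\<^esub> f = f"
    using f val by (intro KG_eqI KG_add_closed KG_zero_closed) (simp_all add: KG_add_val KG_zero_val)
qed (rule KG_zero_closed)

lemma KG_finsum:
  assumes "finite I" "\<And>i. i \<in> I \<Longrightarrow> f i \<in> carrier KG"
  shows "finsum KG f I \<in> carrier KG" "a \<in> carrier G \<Longrightarrow> finsum KG f I a = (\<Oplus>i\<in>I. f i a)"
proof -
  interpret KG: abelian_monoid KG by (rule abelian_monoid_KG)
  show "finsum KG f I \<in> carrier KG" using assms(2) by (intro KG.finsum_closed) auto
  assume a: "a \<in> carrier G"
  from assms show "finsum KG f I a = (\<Oplus>i\<in>I. f i a)"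
  proof (induction I rule: finite_induct)
    case empty
    then show ?case using a by (simp add: KG_zero_val)
  next
    case (insert i I)
    then have "f j a \<in> carrier K" if "j \<in> insert i I" for j
      using that a by (auto intro: KG_val)
    with insert show ?case using a
      by (subst KG.finsum_insert) (auto simp: KG_add_val Pi_def)
  qed
qed

lemma finite_bisection_fiber:
  assumes "U \<in> bisections"
  shows "finite {a \<in> U. ran_of G a = y}"
proof (rule finite_imageD)
  show "finite (ran_of G ` {a \<in> U. ran_of G a = y})"
    by (rule finite_subset[of _ "{y}"]) auto
  have "inj_on (ran_of G) U" using assms by (auto simp: compact_open_bisections_def)
  then show "inj_on (ran_of G) {a \<in> U. ran_of G a = y}" by (rule inj_on_subset) auto
qed

text \<open>Each of the finitely many bisections contains at most one arrow with range y. This gives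
  the entries of a restricted matrix finite support.\<close>

lemma finite_range_fiber:
  assumes f: "f \<in> carrier KG"
  shows "finite {a \<in> carrier G. ran_of G a = y \<and> f a \<noteq> \<zero>}"
proof -
  obtain F c where F: "finite F" "F \<subseteq> bisections" "\<forall>U\<in>F. c U \<in> carrier K" "f = kg_span F c"
    by (rule KG_carrierE[OF f])
  have "f a = \<zero>" if "a \<in> carrier G" "a \<notin> \<Union>F" for a
    unfolding F(4) by (rule kg_span_outside[OF F(3) that])
  then have "{a \<in> carrier G. ran_of G a = y \<and> f a \<noteq> \<zero>} \<subseteq> (\<Union>U\<in>F. {a \<in> U. ran_of G a = y})"
    by blast
  moreover have "finite {a \<in> U. ran_of G a = y}" if "U \<in> F" for U
    using finite_bisection_fiber that F(2) by blast
  ultimately show ?thesis using F(1) by (meson finite_UN_I finite_subset)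
qed

text \<open>The support itself need not be compact, but it lies in finitely many compact bisections,
  whose images in the unit space are compact and so meet X in finite sets.\<close>

lemma finite_closed_discrete_support:
  assumes f: "f \<in> carrier KG"
    and X: "closedin (unit_topology G T) X" "subtopology (unit_topology G T) X = discrete_topology X"
  shows "finite (X \<inter> ran_of G ` support K G f)" "finite (X \<inter> dom_of G ` support K G f)"
proof -
  obtain F c where F: "finite F" "F \<subseteq> bisections" "\<forall>U\<in>F. c U \<in> carrier K" "f = kg_span F c"
    by (rule KG_carrierE[OF f])
  have "f a = \<zero>" if "a \<in> carrier G" "a \<notin> \<Union>F" for a
    unfolding F(4) by (rule kg_span_outside[OF F(3) that])
  then have supp: "support K G f \<subseteq> \<Union>F" by (auto simp: support_def)
  have fin: "finite (X \<inter> ran_of G ` U)" "finite (X \<inter> dom_of G ` U)" if "U \<in> F" for U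
    using that F(2) G.compactin_ran_image G.compactin_dom_image
    by (auto simp: compact_open_bisections_def intro!: G.finite_closed_discrete_Int_compact[OF X])
  have "X \<inter> ran_of G ` support K G f \<subseteq> (\<Union>U\<in>F. X \<inter> ran_of G ` U)"
    "X \<inter> dom_of G ` support K G f \<subseteq> (\<Union>U\<in>F. X \<inter> dom_of G ` U)"
    using supp by blast+
  then show "finite (X \<inter> ran_of G ` support K G f)" "finite (X \<inter> dom_of G ` support K G f)"
    using F(1) fin by (meson finite_UN_I finite_subset)+
qed

text \<open>\<open>comp_eq_iff\<close> lists the factorizations of x by their left factors. The set
  A may exceed the support of f, so that one choice serves for all entries of a row of a
  matrix.\<close>

lemma KG_mult_val:
  assumes f: "f \<in> carrier KG" and g: "g \<in> carrier KG" and x: "x \<in> carrier G"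
    and A: "finite A" "\<And>a. a \<in> A \<Longrightarrow> a \<in> carrier G \<and> ran_of G a = ran_of G x"
      "\<And>a. a \<in> carrier G \<Longrightarrow> ran_of G a = ran_of G x \<Longrightarrow> f a \<noteq> \<zero> \<Longrightarrow> a \<in> A"
  shows "(f \<otimes>\<^bsub>KG\<^esub> g) x = (\<Oplus>a\<in>A. f a \<otimes> g (ginv G a \<odot>\<^bsub>G\<^esub> x))"
proof -
  let ?I = "{(a, b) \<in> composable G. a \<odot>\<^bsub>G\<^esub> b = x \<and> f a \<noteq> \<zero> \<and> g b \<noteq> \<zero>}"
  let ?b = "\<lambda>a. ginv G a \<odot>\<^bsub>G\<^esub> x"
  let ?J = "{a \<in> A. f a \<noteq> \<zero> \<and> g (?b a) \<noteq> \<zero>}"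
  have I: "p \<in> ?I \<longleftrightarrow> (\<exists>a\<in>?J. p = (a, ?b a))" for p
  proof (cases p)
    case (Pair a b)
    show ?thesis
    proof
      assume p: "p \<in> ?I"
      then have c: "(a, b) \<in> composable G \<and> a \<odot>\<^bsub>G\<^esub> b = x" using Pair by simp
      then have "a \<in> carrier G" by (simp add: composable_def)
      then show "\<exists>a\<in>?J. p = (a, ?b a)" using c p Pair A(3) G.comp_eq_iff[of a x b] x by auto
    next
      assume "\<exists>a\<in>?J. p = (a, ?b a)"
      then show "p \<in> ?I" using A(2) G.comp_eq_iff[of _ x] x by auto
    qed
  qed
  have bc: "?b a \<in> carrier G" if "a \<in> A" for a
    using A(2)[OF that] x by (intro G.comp_closed) (auto simp: composable_def G.ginv_closed G.dom_ginv)
  have val: "f a \<otimes> g (?b a) \<in> carrier K" if "a \<in> A" for a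
    using A(2)[OF that] KG_val[OF f] KG_val[OF g] bc[OF that] by simp
  have "(f \<otimes>\<^bsub>KG\<^esub> g) x = (\<Oplus>p\<in>?I. f (fst p) \<otimes> g (snd p))"
    using x by (simp add: groupoid_algebra_def)
  also have "\<dots> = (\<Oplus>a\<in>?J. f a \<otimes> g (?b a))"
  proof (rule K.finsum_bij[where h = fst])
    have "fst ` ?I = ?J"
    proof (intro equalityI subsetI)
      fix a assume "a \<in> fst ` ?I"
      then obtain p where "p \<in> ?I" "a = fst p" by (rule imageE)
      then show "a \<in> ?J" using I[of p] by auto
    next
      fix a assume "a \<in> ?J"
      then have "\<exists>a'\<in>?J. (a, ?b a) = (a', ?b a')" by (intro bexI[of _ a]) auto
      then have "(a, ?b a) \<in> ?I" by (rule I[THEN iffD2])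
      then show "a \<in> fst ` ?I" by (rule rev_image_eqI) simp
    qed
    moreover have "inj_on fst ?I"
    proof (rule inj_onI)
      fix p q assume "p \<in> ?I" "q \<in> ?I" "fst p = fst q"
      then show "p = q" using I[of p] I[of q] by auto
    qed
    ultimately show "bij_betw fst ?I ?J" by (simp add: bij_betw_def)
    fix p assume "p \<in> ?I"
    then show "f (fst p) \<otimes> g (snd p) = f (fst p) \<otimes> g (?b (fst p))"
      using I[of p] by auto
  qed (use val in auto)
  also have "\<dots> = (\<Oplus>a\<in>A. f a \<otimes> g (?b a))"
  proof (rule K.finsum_mono_neutral)
    fix a assume "a \<in> A - ?J"
    then have a: "a \<in> A" and "f a = \<zero> \<or> g (?b a) = \<zero>" by auto
    then show "f a \<otimes> g (?b a) = \<zero>"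
      using KG_val[OF f, of a] KG_val[OF g bc[OF a]] A(2)[OF a] by auto
  qed (use A(1) val in auto)
  finally show ?thesis .
qed

text \<open>The range map is injective on U, so at most one left factor contributes and the value is
  one or zero, without multiplicity.\<close>

lemma sum_indicator_comp:
  assumes UV: "U \<in> bisections" "V \<in> bisections" and x: "x \<in> carrier G"
    and A: "finite A" "\<And>a. a \<in> A \<Longrightarrow> a \<in> carrier G \<and> ran_of G a = ran_of G x"
      "\<And>a. a \<in> U \<Longrightarrow> ran_of G a = ran_of G x \<Longrightarrow> a \<in> A"
  shows "(\<Oplus>a\<in>A. ring_indicator K U a \<otimes> ring_indicator K V (ginv G a \<odot>\<^bsub>G\<^esub> x))
    = ring_indicator K (G.set_comp U V) x"
proof -
  let ?f = "\<lambda>a. ring_indicator K U a \<otimes> ring_indicator K V (ginv G a \<odot>\<^bsub>G\<^esub> x)"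
  have mem: "x \<in> G.set_comp U V \<longleftrightarrow> (\<exists>a\<in>A. a \<in> U \<and> ginv G a \<odot>\<^bsub>G\<^esub> x \<in> V)"
  proof
    assume "x \<in> G.set_comp U V"
    then obtain a b where ab: "a \<in> U" "b \<in> V" "(a, b) \<in> composable G" "x = a \<odot>\<^bsub>G\<^esub> b"
      by (auto simp: G.set_comp_def)
    then have "ran_of G a = ran_of G x \<and> b = ginv G a \<odot>\<^bsub>G\<^esub> x"
      using G.comp_eq_iff[of a x b] bisection_subset[OF UV(1)] x by auto
    then show "\<exists>a\<in>A. a \<in> U \<and> ginv G a \<odot>\<^bsub>G\<^esub> x \<in> V" using A(3) ab by auto
  next
    assume "\<exists>a\<in>A. a \<in> U \<and> ginv G a \<odot>\<^bsub>G\<^esub> x \<in> V"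
    then obtain a where a: "a \<in> A" "a \<in> U" "ginv G a \<odot>\<^bsub>G\<^esub> x \<in> V" by blast
    then have "(a, ginv G a \<odot>\<^bsub>G\<^esub> x) \<in> composable G \<and> a \<odot>\<^bsub>G\<^esub> (ginv G a \<odot>\<^bsub>G\<^esub> x) = x"
      using G.comp_eq_iff[of a x] A(2) x by blast
    then show "x \<in> G.set_comp U V"
      unfolding G.set_comp_def using a by (intro image_eqI[of _ _ "(a, ginv G a \<odot>\<^bsub>G\<^esub> x)"]) auto
  qed
  show ?thesis
  proof (cases "x \<in> G.set_comp U V")
    case True
    then obtain a0 where a0: "a0 \<in> A" "a0 \<in> U" "ginv G a0 \<odot>\<^bsub>G\<^esub> x \<in> V" using mem by blast
    have "inj_on (ran_of G) U" using UV(1) by (simp add: compact_open_bisections_def)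
    then have unique: "a = a0" if "a \<in> A" "a \<in> U" for a
      using that a0 A(2) by (metis inj_onD)
    have "(\<Oplus>a\<in>A. ?f a) = (\<Oplus>a\<in>A. if a = a0 then \<one> else \<zero>)"
    proof (rule K.finsum_cong')
      fix a assume a: "a \<in> A"
      show "?f a = (if a = a0 then \<one> else \<zero>)"
      proof (cases "a = a0")
        case False
        then have "a \<notin> U" using unique[OF a] by blast
        then show ?thesis using False by (simp add: ring_indicator_def)
      qed (use a0 in \<open>simp add: ring_indicator_def\<close>)
    qed auto
    also have "\<dots> = \<one>" using A(1) a0 by (intro K.finsum_delta) auto
    finally show ?thesis using True by (simp add: ring_indicator_def)
  next
    case False
    then have "(\<Oplus>a\<in>A. ?f a) = (\<Oplus>a\<in>A. \<zero>)"
      using mem by (intro K.finsum_cong') (auto simp: ring_indicator_def)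
    then show ?thesis using False by (simp add: ring_indicator_def)
  qed
qed

text \<open>Expanding both factors reduces to products of two indicator functions, and the product
  of two compact open bisections is again one.\<close>

lemma KG_mult_closed:
  assumes f: "f \<in> carrier KG" and g: "g \<in> carrier KG"
  shows "f \<otimes>\<^bsub>KG\<^esub> g \<in> carrier KG"
proof -
  obtain F c where F: "finite F" "F \<subseteq> bisections" "\<forall>U\<in>F. c U \<in> carrier K" "f = kg_span F c"
    by (rule KG_carrierE[OF f])
  obtain F' c' where F': "finite F'" "F' \<subseteq> bisections" "\<forall>U\<in>F'. c' U \<in> carrier K" "g = kg_span F' c'"
    by (rule KG_carrierE[OF g])
  define m where "m p = (\<lambda>a\<in>carrier G. (c (fst p) \<otimes> c' (snd p)) \<otimes>
    ring_indicator K (G.set_comp (fst p) (snd p)) a)" for p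
  have m: "m p \<in> carrier KG" if "p \<in> F \<times> F'" for p
    unfolding m_def using that F F' by (intro KG_monomial G.set_comp_bisection) auto
  have fin: "finite (F \<times> F')" using F F' by simp
  have "f \<otimes>\<^bsub>KG\<^esub> g = finsum KG m (F \<times> F')"
  proof (rule extensionalityI[of _ "carrier G"])
    show "finsum KG m (F \<times> F') \<in> extensional (carrier G)"
      using KG_extensional[OF KG_finsum(1)[OF fin m]] .
    fix x assume x: "x \<in> carrier G"
    define A where "A = {a \<in> \<Union>F. ran_of G a = ran_of G x}"
    have sub: "U \<subseteq> carrier G" if "U \<in> F" for U using that F(2) bisection_subset by blast
    have Ac: "a \<in> carrier G \<and> ran_of G a = ran_of G x" if "a \<in> A" for a
      using that sub by (auto simp: A_def)
    have Afin: "finite A"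
    proof -
      have "finite {a \<in> U. ran_of G a = ran_of G x}" if "U \<in> F" for U
        using finite_bisection_fiber that F(2) by blast
      moreover have "A = (\<Union>U\<in>F. {a \<in> U. ran_of G a = ran_of G x})" by (auto simp: A_def)
      ultimately show ?thesis using F(1) by simp
    qed
    let ?b = "\<lambda>a. ginv G a \<odot>\<^bsub>G\<^esub> x"
    have bc: "?b a \<in> carrier G" if "a \<in> A" for a
      using Ac[OF that] x by (intro G.comp_closed) (auto simp: composable_def G.ginv_closed G.dom_ginv)
    have "(f \<otimes>\<^bsub>KG\<^esub> g) x = (\<Oplus>a\<in>A. f a \<otimes> g (?b a))"
    proof (rule KG_mult_val[OF f g x Afin Ac])
      fix a assume a: "a \<in> carrier G" "ran_of G a = ran_of G x" "f a \<noteq> \<zero>"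
      have "a \<in> \<Union>F"
      proof (rule ccontr)
        assume "a \<notin> \<Union>F"
        then have "f a = \<zero>" unfolding F(4) by (rule kg_span_outside[OF F(3) a(1)])
        then show False using a(3) by simp
      qed
      then show "a \<in> A" using a by (simp add: A_def)
    qed
    also have "\<dots> = (\<Oplus>a\<in>A. \<Oplus>p\<in>F \<times> F'. (c (fst p) \<otimes> c' (snd p)) \<otimes>
        (ring_indicator K (fst p) a \<otimes> ring_indicator K (snd p) (?b a)))"
    proof (rule K.finsum_cong')
      fix a assume a: "a \<in> A"
      have "f a \<otimes> g (?b a) = (\<Oplus>U\<in>F. c U \<otimes> ring_indicator K U a) \<otimes> g (?b a)"
        using Ac[OF a] F(4) by simp
      also have "\<dots> = (\<Oplus>U\<in>F. c U \<otimes> ring_indicator K U a \<otimes> g (?b a))"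
        using F KG_val[OF g bc[OF a]] by (intro K.finsum_ldistr) auto
      also have "\<dots> = (\<Oplus>U\<in>F. \<Oplus>V\<in>F'. c U \<otimes> ring_indicator K U a \<otimes> (c' V \<otimes> ring_indicator K V (?b a)))"
      proof (rule K.finsum_cong')
        fix U assume U: "U \<in> F"
        have "g (?b a) = (\<Oplus>V\<in>F'. c' V \<otimes> ring_indicator K V (?b a))"
          using bc[OF a] F'(4) by simp
        then show "c U \<otimes> ring_indicator K U a \<otimes> g (?b a)
            = (\<Oplus>V\<in>F'. c U \<otimes> ring_indicator K U a \<otimes> (c' V \<otimes> ring_indicator K V (?b a)))"
          using F' bspec[OF F(3) U] by (simp only:) (intro K.finsum_rdistr, auto)
      qed (use F F' in \<open>auto intro!: K.finsum_closed\<close>)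
      also have "\<dots> = (\<Oplus>p\<in>F \<times> F'. c (fst p) \<otimes> ring_indicator K (fst p) a \<otimes>
          (c' (snd p) \<otimes> ring_indicator K (snd p) (?b a)))"
        using F F' by (intro K.finsum_Sigma) auto
      also have "\<dots> = (\<Oplus>p\<in>F \<times> F'. (c (fst p) \<otimes> c' (snd p)) \<otimes>
        (ring_indicator K (fst p) a \<otimes> ring_indicator K (snd p) (?b a)))"
      proof (rule K.finsum_cong')
        fix p assume "p \<in> F \<times> F'"
        then have "c (fst p) \<in> carrier K" "c' (snd p) \<in> carrier K" using F F' by auto
        then show "c (fst p) \<otimes> ring_indicator K (fst p) a \<otimes> (c' (snd p) \<otimes> ring_indicator K (snd p) (?b a))
            = (c (fst p) \<otimes> c' (snd p)) \<otimes> (ring_indicator K (fst p) a \<otimes> ring_indicator K (snd p) (?b a))"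
          by (simp add: K.m_ac)
      qed (use F F' in auto)
      finally show "f a \<otimes> g (?b a) = (\<Oplus>p\<in>F \<times> F'. (c (fst p) \<otimes> c' (snd p)) \<otimes>
        (ring_indicator K (fst p) a \<otimes> ring_indicator K (snd p) (?b a)))" .
    qed (use F F' in \<open>auto intro!: K.finsum_closed\<close>)
    also have "\<dots> = (\<Oplus>p\<in>F \<times> F'. \<Oplus>a\<in>A. (c (fst p) \<otimes> c' (snd p)) \<otimes>
        (ring_indicator K (fst p) a \<otimes> ring_indicator K (snd p) (?b a)))"
      using F F' Afin by (intro K.finsum_swap) auto
    also have "\<dots> = (\<Oplus>p\<in>F \<times> F'. m p x)"
    proof (rule K.finsum_cong')
      fix p assume p: "p \<in> F \<times> F'"
      then have cp: "c (fst p) \<otimes> c' (snd p) \<in> carrier K" using F F' by auto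
      have "(\<Oplus>a\<in>A. (c (fst p) \<otimes> c' (snd p)) \<otimes>
          (ring_indicator K (fst p) a \<otimes> ring_indicator K (snd p) (?b a)))
        = (c (fst p) \<otimes> c' (snd p)) \<otimes>
          (\<Oplus>a\<in>A. ring_indicator K (fst p) a \<otimes> ring_indicator K (snd p) (?b a))"
        using Afin cp by (intro K.finsum_rdistr[symmetric]) auto
      also have "(\<Oplus>a\<in>A. ring_indicator K (fst p) a \<otimes> ring_indicator K (snd p) (?b a))
          = ring_indicator K (G.set_comp (fst p) (snd p)) x"
      proof (rule sum_indicator_comp[OF _ _ x Afin Ac])
        show "fst p \<in> bisections" "snd p \<in> bisections" using p F(2) F'(2) by auto
        show "a \<in> A" if "a \<in> fst p" "ran_of G a = ran_of G x" for a
          unfolding A_def using that p SigmaD1[of "fst p" "snd p" F] by (simp, blast)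
      qed
      finally show "(\<Oplus>a\<in>A. (c (fst p) \<otimes> c' (snd p)) \<otimes>
          (ring_indicator K (fst p) a \<otimes> ring_indicator K (snd p) (?b a))) = m p x"
        using x by (simp add: m_def)
    qed (use m x KG_val in auto)
    also have "\<dots> = finsum KG m (F \<times> F') x"
      using KG_finsum(2)[OF fin m x] by simp
    finally show "(f \<otimes>\<^bsub>KG\<^esub> g) x = finsum KG m (F \<times> F') x" .
  qed (simp add: groupoid_algebra_def)
  then show ?thesis using KG_finsum(1)[OF fin m] by simp
qed


lemma KG_matrix_mult_closed:
  assumes A: "A \<in> carrier (matrix_ring n KG)" and B: "B \<in> carrier (matrix_ring n KG)"
  shows "A \<otimes>\<^bsub>matrix_ring n KG\<^esub> B \<in> carrier (matrix_ring n KG)"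
  using matrix_ring_entry[OF A] matrix_ring_entry[OF B]
  by (auto simp: matrix_ring_def PiE_iff intro!: KG_finsum(1) KG_mult_closed)

lemma KG_matrix_mult_val:
  assumes A: "A \<in> carrier (matrix_ring n KG)" and B: "B \<in> carrier (matrix_ring n KG)"
    and ij: "i < n" "j < n" and x: "x \<in> carrier G"
    and S: "finite S" "\<And>a. a \<in> S \<Longrightarrow> a \<in> carrier G \<and> ran_of G a = ran_of G x"
      "\<And>k a. k < n \<Longrightarrow> a \<in> carrier G \<Longrightarrow> ran_of G a = ran_of G x \<Longrightarrow> A (i, k) a \<noteq> \<zero> \<Longrightarrow> a \<in> S"
  shows "(A \<otimes>\<^bsub>matrix_ring n KG\<^esub> B) (i, j) x
    = (\<Oplus>k\<in>{..<n}. \<Oplus>a\<in>S. A (i, k) a \<otimes> B (k, j) (ginv G a \<odot>\<^bsub>G\<^esub> x))"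
proof -
  note e = matrix_ring_entry[OF A ij(1)] matrix_ring_entry[OF B _ ij(2)]
  have prod: "A (i, k) \<otimes>\<^bsub>KG\<^esub> B (k, j) \<in> carrier KG" if "k < n" for k
    using e that by (intro KG_mult_closed)
  have "(A \<otimes>\<^bsub>matrix_ring n KG\<^esub> B) (i, j) x
      = (\<Oplus>k\<in>{..<n}. (A (i, k) \<otimes>\<^bsub>KG\<^esub> B (k, j)) x)"
    unfolding matrix_ring_mult[OF ij] using prod x by (intro KG_finsum(2)) auto
  also have "\<dots> = (\<Oplus>k\<in>{..<n}. \<Oplus>a\<in>S. A (i, k) a \<otimes> B (k, j) (ginv G a \<odot>\<^bsub>G\<^esub> x))"
  proof (rule K.finsum_cong')
    fix k assume "k \<in> {..<n}"
    then have k: "k < n" by simp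
    show "(A (i, k) \<otimes>\<^bsub>KG\<^esub> B (k, j)) x = (\<Oplus>a\<in>S. A (i, k) a \<otimes> B (k, j) (ginv G a \<odot>\<^bsub>G\<^esub> x))"
      by (rule KG_mult_val[OF e(1)[OF k] e(2)[OF k] x S(1,2) S(3)[OF k]])
  next
    show "(\<lambda>k. \<Oplus>a\<in>S. A (i, k) a \<otimes> B (k, j) (ginv G a \<odot>\<^bsub>G\<^esub> x)) \<in> {..<n} \<rightarrow> carrier K"
    proof (intro Pi_I K.finsum_closed K.m_closed)
      fix k a assume k: "k \<in> {..<n}" and a: "a \<in> S"
      show "A (i, k) a \<in> carrier K" using KG_val[OF e(1)] k S(2)[OF a] by simp
      have "ginv G a \<odot>\<^bsub>G\<^esub> x \<in> carrier G"
        using S(2)[OF a] x by (intro G.comp_closed) (auto simp: composable_def G.ginv_closed G.dom_ginv)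
      then show "B (k, j) (ginv G a \<odot>\<^bsub>G\<^esub> x) \<in> carrier K" using KG_val[OF e(2)] k by simp
    qed
  qed simp
  finally show ?thesis .
qed

end

text \<open>
  The chosen arrows \<open>\<gamma> y\<close> from \<open>x0\<close> identify the arrows between points of the orbit with triples of two
  points and an element of the isotropy group. Restricted to the finite set \<open>F\<close> of points, a matrix over
  the groupoid algebra becomes a matrix over the group algebra, with indices in \<open>{..<n} \<times> F\<close>.
\<close>

locale orbit_chart = ample_groupoid_cring K G T
  for K :: "('k, 'm) ring_scheme" (structure) and G :: "('a, 'n) groupoid_scheme" and T +
  fixes x0 :: 'a and \<gamma> :: "'a \<Rightarrow> 'a" and F :: "'a set" and n N :: nat and h :: "nat \<Rightarrow> nat \<times> 'a"
  assumes x0: "x0 \<in> unit_space G"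
    and \<gamma>: "\<And>y. y \<in> F \<Longrightarrow> \<gamma> y \<in> carrier G \<and> dom_of G (\<gamma> y) = x0 \<and> ran_of G (\<gamma> y) = y"
    and F: "finite F"
    and h: "bij_betw h {..<N} ({..<n} \<times> F)"
begin

abbreviation "H \<equiv> isotropy_group G x0"

sublocale chart: cring_group K H
  using G.group_isotropy[OF x0] by (simp add: cring_group_def K.is_cring)

definition arrow :: "'a \<Rightarrow> 'a \<Rightarrow> 'a \<Rightarrow> 'a"
  where "arrow y g z = \<gamma> y \<odot>\<^bsub>G\<^esub> (g \<odot>\<^bsub>G\<^esub> ginv G (\<gamma> z))"

lemma H_D: "g \<in> carrier H \<Longrightarrow> g \<in> carrier G \<and> dom_of G g = x0 \<and> ran_of G g = x0"
  by (simp add: isotropy_group_def)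

lemma H_mult: "g \<otimes>\<^bsub>H\<^esub> g' = g \<odot>\<^bsub>G\<^esub> g'"
  by (simp add: isotropy_group_def)

lemma ginv_\<gamma>: "y \<in> F \<Longrightarrow>
    ginv G (\<gamma> y) \<in> carrier G \<and> dom_of G (ginv G (\<gamma> y)) = y \<and> ran_of G (ginv G (\<gamma> y)) = x0"
  using \<gamma> by (simp add: G.ginv_closed G.dom_ginv G.ran_ginv)

lemma half_arrow:
  assumes "g \<in> carrier H" "z \<in> F"
  shows "(g, ginv G (\<gamma> z)) \<in> composable G"
    and "g \<odot>\<^bsub>G\<^esub> ginv G (\<gamma> z) \<in> carrier G"
    and "dom_of G (g \<odot>\<^bsub>G\<^esub> ginv G (\<gamma> z)) = z" "ran_of G (g \<odot>\<^bsub>G\<^esub> ginv G (\<gamma> z)) = x0"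
proof -
  show c: "(g, ginv G (\<gamma> z)) \<in> composable G"
    using assms H_D ginv_\<gamma> by (simp add: composable_def)
  show "g \<odot>\<^bsub>G\<^esub> ginv G (\<gamma> z) \<in> carrier G" "dom_of G (g \<odot>\<^bsub>G\<^esub> ginv G (\<gamma> z)) = z"
    "ran_of G (g \<odot>\<^bsub>G\<^esub> ginv G (\<gamma> z)) = x0"
    using G.comp_closed[OF c] G.dom_comp[OF c] G.ran_comp[OF c] assms H_D ginv_\<gamma> by auto
qed

lemma arrow_composable:
  assumes "y \<in> F" "g \<in> carrier H" "z \<in> F"
  shows "(\<gamma> y, g \<odot>\<^bsub>G\<^esub> ginv G (\<gamma> z)) \<in> composable G"
  using half_arrow[OF assms(2,3)] \<gamma> assms by (simp add: composable_def)

lemma arrow_props: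
  assumes "y \<in> F" "g \<in> carrier H" "z \<in> F"
  shows "arrow y g z \<in> carrier G" "dom_of G (arrow y g z) = z" "ran_of G (arrow y g z) = y"
  using G.comp_closed[OF arrow_composable[OF assms]] G.dom_comp[OF arrow_composable[OF assms]]
    G.ran_comp[OF arrow_composable[OF assms]] half_arrow[OF assms(2,3)] \<gamma> assms
  by (simp_all add: arrow_def)

lemma arrow_mult:
  assumes y: "y \<in> F" and w: "w \<in> F" and z: "z \<in> F" and g: "g \<in> carrier H" "g' \<in> carrier H"
  shows "arrow y g w \<odot>\<^bsub>G\<^esub> arrow w g' z = arrow y (g \<otimes>\<^bsub>H\<^esub> g') z"
proof -
  let ?q = "g \<odot>\<^bsub>G\<^esub> ginv G (\<gamma> w)" and ?r = "arrow w g' z" and ?t = "ginv G (\<gamma> z)"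
  have qr: "(?q, ?r) \<in> composable G"
    using half_arrow[OF g(1) w] arrow_props[OF w g(2) z] by (simp add: composable_def)
  have wr: "(ginv G (\<gamma> w), ?r) \<in> composable G"
    using ginv_\<gamma>[OF w] arrow_props[OF w g(2) z] by (simp add: composable_def)
  have gg: "(g, g') \<in> composable G" using g H_D by (simp add: composable_def)
  have "arrow y g w \<odot>\<^bsub>G\<^esub> ?r = \<gamma> y \<odot>\<^bsub>G\<^esub> (?q \<odot>\<^bsub>G\<^esub> ?r)"
    unfolding arrow_def[of y] by (rule G.comp_assoc[OF arrow_composable[OF y g(1) w] qr])
  also have "?q \<odot>\<^bsub>G\<^esub> ?r = g \<odot>\<^bsub>G\<^esub> (ginv G (\<gamma> w) \<odot>\<^bsub>G\<^esub> ?r)"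
    by (rule G.comp_assoc[OF half_arrow(1)[OF g(1) w] wr])
  also have "ginv G (\<gamma> w) \<odot>\<^bsub>G\<^esub> ?r = g' \<odot>\<^bsub>G\<^esub> ?t"
    unfolding arrow_def by (rule G.ginv_comp_cancel[OF arrow_composable[OF w g(2) z]])
  also have "g \<odot>\<^bsub>G\<^esub> (g' \<odot>\<^bsub>G\<^esub> ?t) = g \<otimes>\<^bsub>H\<^esub> g' \<odot>\<^bsub>G\<^esub> ?t"
    unfolding H_mult by (rule G.comp_assoc[OF gg half_arrow(1)[OF g(2) z], symmetric])
  finally show ?thesis by (simp add: arrow_def)
qed

lemma arrow_ginv_mult:
  assumes "y \<in> F" "w \<in> F" "z \<in> F" and g: "g \<in> carrier H" "g' \<in> carrier H"
  shows "ginv G (arrow y g w) \<odot>\<^bsub>G\<^esub> arrow y g' z = arrow w (inv\<^bsub>H\<^esub> g \<otimes>\<^bsub>H\<^esub> g') z"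
proof -
  let ?c = "arrow w (inv\<^bsub>H\<^esub> g \<otimes>\<^bsub>H\<^esub> g') z"
  have c: "inv\<^bsub>H\<^esub> g \<otimes>\<^bsub>H\<^esub> g' \<in> carrier H" using g by simp
  have "(arrow y g w, ?c) \<in> composable G"
    using arrow_props[OF assms(1) g(1) assms(2)] arrow_props[OF assms(2) c assms(3)]
    by (simp add: composable_def)
  from G.ginv_comp_cancel[OF this] show ?thesis
    using arrow_mult[OF assms(1,2,3) g(1) c] g by simp
qed

lemma arrow_inj:
  assumes "y \<in> F" "z \<in> F" "g \<in> carrier H" "g' \<in> carrier H" "arrow y g z = arrow y g' z"
  shows "g = g'"
proof -
  have "g \<odot>\<^bsub>G\<^esub> ginv G (\<gamma> z) = g' \<odot>\<^bsub>G\<^esub> ginv G (\<gamma> z)"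
    using G.ginv_comp_cancel[OF arrow_composable[OF assms(1,3,2)]]
      G.ginv_comp_cancel[OF arrow_composable[OF assms(1,4,2)]] assms(5)
    unfolding arrow_def by metis
  then have "g \<odot>\<^bsub>G\<^esub> ginv G (\<gamma> z) \<odot>\<^bsub>G\<^esub> \<gamma> z = g' \<odot>\<^bsub>G\<^esub> ginv G (\<gamma> z) \<odot>\<^bsub>G\<^esub> \<gamma> z" by simp
  moreover have "k \<odot>\<^bsub>G\<^esub> ginv G (\<gamma> z) \<odot>\<^bsub>G\<^esub> \<gamma> z = k" if "k \<in> carrier H" for k
    using G.comp_assoc[OF half_arrow(1)[OF that assms(2)] G.composable_ginv(1)] \<gamma>[OF assms(2)]
      G.comp_dom[of k] H_D[OF that] by (simp add: dom_of_def)
  ultimately show ?thesis using assms by simp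
qed

lemma arrow_surj:
  assumes a: "a \<in> carrier G" and y: "ran_of G a \<in> F" and z: "dom_of G a \<in> F"
  obtains g where "g \<in> carrier H" "a = arrow (ran_of G a) g (dom_of G a)"
proof
  let ?y = "\<gamma> (ran_of G a)" and ?z = "\<gamma> (dom_of G a)"
  let ?b = "ginv G ?y \<odot>\<^bsub>G\<^esub> a"
  have ya: "(ginv G ?y, a) \<in> composable G" using ginv_\<gamma>[OF y] a by (simp add: composable_def)
  have b: "?b \<in> carrier G" "dom_of G ?b = dom_of G a" "ran_of G ?b = x0"
    using G.comp_closed[OF ya] G.dom_comp[OF ya] G.ran_comp[OF ya] ginv_\<gamma>[OF y] by auto
  have bz: "(?b, ?z) \<in> composable G" using b \<gamma>[OF z] by (simp add: composable_def)
  show "?b \<odot>\<^bsub>G\<^esub> ?z \<in> carrier H"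
    using G.comp_closed[OF bz] G.dom_comp[OF bz] G.ran_comp[OF bz] b \<gamma>[OF z]
    by (simp add: isotropy_group_def)
  have "?b \<odot>\<^bsub>G\<^esub> ?z \<odot>\<^bsub>G\<^esub> ginv G ?z = ?b \<odot>\<^bsub>G\<^esub> ran_of G ?z"
    using G.comp_assoc[OF bz G.composable_ginv(2)] \<gamma>[OF z] by (simp add: ran_of_def)
  also have "\<dots> = ?b" using G.comp_dom[OF b(1)] b(2) \<gamma>[OF z] by simp
  finally have "arrow (ran_of G a) (?b \<odot>\<^bsub>G\<^esub> ?z) (dom_of G a) = ?y \<odot>\<^bsub>G\<^esub> ?b"
    by (simp add: arrow_def)
  also have "\<dots> = a" using G.comp_ginv_cancel[of ?y a] \<gamma>[OF y] a by simp
  finally show "a = arrow (ran_of G a) (?b \<odot>\<^bsub>G\<^esub> ?z) (dom_of G a)" ..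
qed

text \<open>Matrix rings are indexed by initial segments of the naturals, so h enumerates the pairs
  of a matrix index and a point of F.\<close>

definition restrict_matrix :: "(nat \<times> nat \<Rightarrow> 'a \<Rightarrow> 'k) \<Rightarrow> nat \<times> nat \<Rightarrow> 'a \<Rightarrow> 'k"
  where "restrict_matrix A = (\<lambda>(p, q)\<in>{..<N} \<times> {..<N}. \<lambda>g\<in>carrier H.
    A (fst (h p), fst (h q)) (arrow (snd (h p)) g (snd (h q))))"

lemma h_D: "p < N \<Longrightarrow> fst (h p) < n \<and> snd (h p) \<in> F"
  using bij_betwE[OF h] by (force simp: mem_Times_iff)

lemma restrict_matrix_val:
  "p < N \<Longrightarrow> q < N \<Longrightarrow> g \<in> carrier H \<Longrightarrow>
    restrict_matrix A (p, q) g = A (fst (h p), fst (h q)) (arrow (snd (h p)) g (snd (h q)))"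
  by (simp add: restrict_matrix_def)

text \<open>For fixed indices the arrows involved share one range, only finitely many of those lie
  in the support, and distinct g give distinct arrows.\<close>

lemma restrict_matrix_closed:
  assumes A: "A \<in> carrier (matrix_ring n KG)"
  shows "restrict_matrix A \<in> carrier (matrix_ring N chart.KH)"
proof -
  have "restrict_matrix A (p, q) \<in> carrier chart.KH" if pq: "p < N" "q < N" for p q
  proof -
    have f: "A (fst (h p), fst (h q)) \<in> carrier KG"
      using matrix_ring_entry[OF A] h_D pq by simp
    let ?f = "A (fst (h p), fst (h q))"
    let ?a = "\<lambda>g. arrow (snd (h p)) g (snd (h q))"
    have yz: "snd (h p) \<in> F" "snd (h q) \<in> F" using h_D pq by auto
    note props = arrow_props[OF yz(1) _ yz(2)]
    show ?thesis
    proof (rule chart.group_algebra_carrierI)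
      show "restrict_matrix A (p, q) g \<in> carrier K" if "g \<in> carrier H" for g
        using KG_val[OF f props(1)[OF that]] restrict_matrix_val[OF pq that] by simp
      show "restrict_matrix A (p, q) \<in> extensional (carrier H)"
        using pq by (simp add: restrict_matrix_def)
      show "finite {g \<in> carrier H. ?f (?a g) \<noteq> \<zero>}"
      proof (rule finite_imageD)
        show "finite (?a ` {g \<in> carrier H. ?f (?a g) \<noteq> \<zero>})"
          using props by (intro finite_subset[OF _ finite_range_fiber[OF f, of "snd (h p)"]]) auto
        show "inj_on ?a {g \<in> carrier H. ?f (?a g) \<noteq> \<zero>}"
          using arrow_inj[OF yz] by (auto intro!: inj_onI)
      qed
      show "\<forall>g\<in>carrier H - {g \<in> carrier H. ?f (?a g) \<noteq> \<zero>}. restrict_matrix A (p, q) g = \<zero>"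
        using restrict_matrix_val[OF pq] by auto
    qed
  qed
  then show ?thesis by (auto simp: matrix_ring_carrier PiE_iff restrict_matrix_def)
qed

text \<open>A factorization of an arrow over F passes through a middle point. By \<open>supp\<close>
  this point lies in F whenever the left factor contributes, so restricting to F loses no term; the
  pairs of an index k and a middle point w become the summation index of the N by N
  matrices.\<close>

lemma restrict_matrix_mult:
  assumes A: "A \<in> carrier (matrix_ring n KG)" and B: "B \<in> carrier (matrix_ring n KG)"
    and supp: "\<And>i j a. i < n \<Longrightarrow> j < n \<Longrightarrow> a \<in> carrier G \<Longrightarrow> ran_of G a \<in> F \<Longrightarrow>
      A (i, j) a \<noteq> \<zero> \<Longrightarrow> dom_of G a \<in> F"
  shows "restrict_matrix (A \<otimes>\<^bsub>matrix_ring n KG\<^esub> B)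
    = restrict_matrix A \<otimes>\<^bsub>matrix_ring N chart.KH\<^esub> restrict_matrix B"
proof (rule matrix_ring_eqI)
  let ?\<Phi> = restrict_matrix
  let ?MN = "matrix_ring N chart.KH"
  interpret KH: ring chart.KH by (rule chart.ring_group_algebra)
  interpret MN: ring ?MN by (rule KH.ring_matrix_ring)
  note \<Phi>A = restrict_matrix_closed[OF A] and \<Phi>B = restrict_matrix_closed[OF B]
    and \<Phi>AB = restrict_matrix_closed[OF KG_matrix_mult_closed[OF A B]]
  show "?\<Phi> (A \<otimes>\<^bsub>matrix_ring n KG\<^esub> B) \<in> carrier ?MN" by (rule \<Phi>AB)
  show "?\<Phi> A \<otimes>\<^bsub>?MN\<^esub> ?\<Phi> B \<in> carrier ?MN" using \<Phi>A \<Phi>B by simp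
  fix p q assume pq: "p < N" "q < N"
  obtain S where S: "finite S" "S \<subseteq> carrier H"
    "\<forall>i<N. \<forall>j<N. \<forall>g\<in>carrier H - S. ?\<Phi> A (i, j) g = \<zero>"
    by (rule chart.matrix_support[OF \<Phi>A])
  have Sc: "g \<in> carrier H" if "g \<in> S" for g using that S by blast
  define i j y z where "i = fst (h p)" "j = fst (h q)" "y = snd (h p)" "z = snd (h q)"
  note defs = this
  have ij: "i < n" "j < n" and yz: "y \<in> F" "z \<in> F" using h_D pq by (auto simp: defs)
  show "?\<Phi> (A \<otimes>\<^bsub>matrix_ring n KG\<^esub> B) (p, q) = (?\<Phi> A \<otimes>\<^bsub>?MN\<^esub> ?\<Phi> B) (p, q)"
  proof (rule chart.group_algebra_eqI)
    show "?\<Phi> (A \<otimes>\<^bsub>matrix_ring n KG\<^esub> B) (p, q) \<in> carrier chart.KH"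
      "(?\<Phi> A \<otimes>\<^bsub>?MN\<^esub> ?\<Phi> B) (p, q) \<in> carrier chart.KH"
      using matrix_ring_entry[OF \<Phi>AB pq] matrix_ring_entry[OF MN.m_closed[OF \<Phi>A \<Phi>B] pq] by auto
    fix g assume g: "g \<in> carrier H"
    let ?x = "arrow y g z"
    let ?P = "F \<times> S"
    let ?a = "\<lambda>(w, g'). arrow y g' w"
    note x = arrow_props[OF yz(1) g yz(2)]
    have a: "?a s \<in> carrier G" "dom_of G (?a s) = fst s" "ran_of G (?a s) = y" if "s \<in> ?P" for s
      using that arrow_props[OF yz(1)] Sc by auto
    have inj: "inj_on ?a ?P"
    proof (rule inj_onI)
      fix s s' assume s: "s \<in> ?P" "s' \<in> ?P" and eq: "?a s = ?a s'"
      then have "fst s = fst s'" using a(2)[OF s(1)] a(2)[OF s(2)] by simp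
      then show "s = s'" using s eq arrow_inj[OF yz(1)] Sc by (cases s; cases s') auto
    qed
    let ?t = "\<lambda>k w g'. A (i, k) (arrow y g' w) \<otimes> B (k, j) (arrow w (inv\<^bsub>H\<^esub> g' \<otimes>\<^bsub>H\<^esub> g) z)"
    have tc: "?t k w g' \<in> carrier K" if "k < n" "w \<in> F" "g' \<in> S" for k w g'
    proof (rule K.m_closed)
      show "A (i, k) (arrow y g' w) \<in> carrier K"
        using KG_val[OF matrix_ring_entry[OF A ij(1) that(1)]] arrow_props[OF yz(1) Sc[OF that(3)] that(2)]
        by simp
      have "inv\<^bsub>H\<^esub> g' \<otimes>\<^bsub>H\<^esub> g \<in> carrier H" using Sc[OF that(3)] g by simp
      from arrow_props(1)[OF that(2) this yz(2)]
      show "B (k, j) (arrow w (inv\<^bsub>H\<^esub> g' \<otimes>\<^bsub>H\<^esub> g) z) \<in> carrier K"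
        using KG_val[OF matrix_ring_entry[OF B that(1) ij(2)]] by simp
    qed
    have "?\<Phi> (A \<otimes>\<^bsub>matrix_ring n KG\<^esub> B) (p, q) g = (A \<otimes>\<^bsub>matrix_ring n KG\<^esub> B) (i, j) ?x"
      using restrict_matrix_val[OF pq g] by (simp add: defs)
    \<comment> \<open>The left factors that contribute are listed by their domain w in F and their
      group element, which lies in S because S carries the supports of all restricted entries of
      A.\<close>
    also have "\<dots> = (\<Oplus>k\<in>{..<n}. \<Oplus>b\<in>?a ` ?P. A (i, k) b \<otimes> B (k, j) (ginv G b \<odot>\<^bsub>G\<^esub> ?x))"
    proof (rule KG_matrix_mult_val[OF A B ij x(1)])
      show "finite (?a ` ?P)" using F S by simp
      show "b \<in> carrier G \<and> ran_of G b = ran_of G ?x" if "b \<in> ?a ` ?P" for b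
        using that a x(3) by (metis (no_types, lifting) imageE)
      fix k b assume k: "k < n" and b: "b \<in> carrier G" "ran_of G b = ran_of G ?x" "A (i, k) b \<noteq> \<zero>"
      have rb: "ran_of G b = y" using b(2) x(3) by simp
      have db: "dom_of G b \<in> F" using supp[OF ij(1) k b(1) _ b(3)] rb yz by simp
      obtain g' where g': "g' \<in> carrier H" "b = arrow y g' (dom_of G b)"
        by (rule arrow_surj[OF b(1) _ db]) (use rb yz in auto)
      have "(k, dom_of G b) \<in> h ` {..<N}" using h k db by (simp add: bij_betw_def)
      then obtain r where r: "r < N" "h r = (k, dom_of G b)" by auto
      have "?\<Phi> A (p, r) g' = A (i, k) b"
        using restrict_matrix_val[OF pq(1) r(1) g'(1)] r(2) g'(2) by (simp add: defs)
      then have "g' \<in> S" using S(3) pq(1) r(1) g'(1) b(3) by (metis DiffI)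
      then show "b \<in> ?a ` ?P" using g'(2) db by (intro image_eqI[of _ _ "(dom_of G b, g')"]) auto
    qed
    also have "\<dots> = (\<Oplus>k\<in>{..<n}. \<Oplus>w\<in>F. \<Oplus>g'\<in>S. ?t k w g')"
    proof (rule K.finsum_cong')
      fix k assume "k \<in> {..<n}"
      then have k: "k < n" by simp
      have "(\<Oplus>w\<in>F. \<Oplus>g'\<in>S. ?t k w g') = (\<Oplus>s\<in>?P. ?t k (fst s) (snd s))"
        using F S tc[OF k] by (intro K.finsum_Sigma) auto
      also have "\<dots> = (\<Oplus>b\<in>?a ` ?P. A (i, k) b \<otimes> B (k, j) (ginv G b \<odot>\<^bsub>G\<^esub> ?x))"
      proof (rule K.finsum_bij)
        show "bij_betw ?a ?P (?a ` ?P)" using inj by (simp add: bij_betw_def)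
        show eq: "?t k (fst s) (snd s) = A (i, k) (?a s) \<otimes> B (k, j) (ginv G (?a s) \<odot>\<^bsub>G\<^esub> ?x)"
          if "s \<in> ?P" for s
          using that arrow_ginv_mult[OF yz(1) _ yz(2) _ g, of "fst s" "snd s"] Sc
          by (cases s) auto
        fix b assume "b \<in> ?a ` ?P"
        then obtain s where s: "s \<in> ?P" "b = ?a s" by (rule imageE)
        then show "A (i, k) b \<otimes> B (k, j) (ginv G b \<odot>\<^bsub>G\<^esub> ?x) \<in> carrier K"
          using eq[OF s(1)] tc[OF k, of "fst s" "snd s"] by (simp add: mem_Times_iff)
      qed
      finally show "(\<Oplus>b\<in>?a ` ?P. A (i, k) b \<otimes> B (k, j) (ginv G b \<odot>\<^bsub>G\<^esub> ?x))
          = (\<Oplus>w\<in>F. \<Oplus>g'\<in>S. ?t k w g')" ..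
    qed (use tc in \<open>auto intro!: K.finsum_closed\<close>)
    also have "\<dots> = (\<Oplus>s\<in>{..<n} \<times> F. \<Oplus>g'\<in>S. ?t (fst s) (snd s) g')"
      using F tc by (intro K.finsum_Sigma) (auto intro!: K.finsum_closed)
    also have "\<dots> = (\<Oplus>r\<in>{..<N}. \<Oplus>g'\<in>S. ?t (fst (h r)) (snd (h r)) g')"
    proof (rule K.finsum_bij[OF h, symmetric])
      fix s assume "s \<in> {..<n} \<times> F"
      then show "(\<Oplus>g'\<in>S. ?t (fst s) (snd s) g') \<in> carrier K"
        using tc by (intro K.finsum_closed) (auto simp: mem_Times_iff)
    qed simp
    also have "\<dots> = (\<Oplus>r\<in>{..<N}. \<Oplus>g'\<in>S. ?\<Phi> A (p, r) g' \<otimes> ?\<Phi> B (r, q) (inv\<^bsub>H\<^esub> g' \<otimes>\<^bsub>H\<^esub> g))"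
    proof (rule K.finsum_cong')
      fix r assume "r \<in> {..<N}"
      then have r: "r < N" by simp
      show "(\<Oplus>g'\<in>S. ?t (fst (h r)) (snd (h r)) g')
          = (\<Oplus>g'\<in>S. ?\<Phi> A (p, r) g' \<otimes> ?\<Phi> B (r, q) (inv\<^bsub>H\<^esub> g' \<otimes>\<^bsub>H\<^esub> g))"
      proof (rule K.finsum_cong')
        fix g' assume "g' \<in> S"
        then have g': "g' \<in> carrier H" by (rule Sc)
        then have "inv\<^bsub>H\<^esub> g' \<otimes>\<^bsub>H\<^esub> g \<in> carrier H" using g by simp
        then show "?t (fst (h r)) (snd (h r)) g' = ?\<Phi> A (p, r) g' \<otimes> ?\<Phi> B (r, q) (inv\<^bsub>H\<^esub> g' \<otimes>\<^bsub>H\<^esub> g)"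
          using restrict_matrix_val[OF pq(1) r g'] restrict_matrix_val[OF r pq(2)] by (simp add: defs)
      qed (use chart.matrix_entry_closed[OF \<Phi>A pq(1) r] chart.matrix_entry_closed[OF \<Phi>B r pq(2)] Sc g in auto)
    qed (use chart.matrix_entry_closed[OF \<Phi>A pq(1)] chart.matrix_entry_closed[OF \<Phi>B _ pq(2)] Sc g
        in \<open>auto intro!: K.finsum_closed\<close>)
    also have "\<dots> = (?\<Phi> A \<otimes>\<^bsub>?MN\<^esub> ?\<Phi> B) (p, q) g"
      using S(3) pq(1) by (intro chart.matrix_group_algebra_mult[OF \<Phi>A \<Phi>B pq g S(1,2), symmetric]) auto
    finally show "?\<Phi> (A \<otimes>\<^bsub>matrix_ring n KG\<^esub> B) (p, q) g = (?\<Phi> A \<otimes>\<^bsub>?MN\<^esub> ?\<Phi> B) (p, q) g" .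
  qed
qed

end

section \<open>Comparison over one closed discrete orbit, and passage to a dense family of
  orbits\<close>

context ample_groupoid_cring
begin

lemma dom_in_orbit:
  assumes "a \<in> carrier G" "ran_of G a \<in> orbit_of G x"
  shows "dom_of G a \<in> orbit_of G x"
proof -
  obtain b where b: "b \<in> carrier G" "dom_of G b = x" "ran_of G b = ran_of G a"
    using assms(2) by (auto simp: orbit_of_def)
  have c: "(ginv G a, b) \<in> composable G"
    using assms(1) b by (simp add: composable_def G.ginv_closed G.dom_ginv)
  show ?thesis
    using G.comp_closed[OF c] G.dom_comp[OF c] G.ran_comp[OF c] b(2) assms(1)
    by (auto simp: orbit_of_def G.ran_ginv G.dom_unit intro!: bexI[of _ "ginv G a \<odot>\<^bsub>G\<^esub> b"])
qed

lemma matrix_eq_on_orbit: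
  assumes x0: "x0 \<in> unit_space G" and X: "X = orbit_of G x0"
    and closed: "closedin (unit_topology G T) X"
    and discrete: "subtopology (unit_topology G T) X = discrete_topology X"
    and fin: "stably_finite (group_algebra K (isotropy_group G x0))"
    and n: "n \<ge> 1"
    and e: "e \<in> carrier (matrix_ring n KG)" "e \<otimes>\<^bsub>matrix_ring n KG\<^esub> e = e"
    and u: "u \<in> corner (matrix_ring n KG) e" and v: "v \<in> corner (matrix_ring n KG) e"
    and uv: "u \<otimes>\<^bsub>matrix_ring n KG\<^esub> v = e"
    and ij: "i < n" "j < n" and a: "a \<in> carrier G" "ran_of G a \<in> X"
  shows "(v \<otimes>\<^bsub>matrix_ring n KG\<^esub> u) (i, j) a = e (i, j) a"
proof -
  let ?M = "matrix_ring n KG"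
  obtain r where r: "r \<in> carrier ?M" "u = e \<otimes>\<^bsub>?M\<^esub> r \<otimes>\<^bsub>?M\<^esub> e" using u by (auto simp: corner_def)
  obtain s where s: "s \<in> carrier ?M" "v = e \<otimes>\<^bsub>?M\<^esub> s \<otimes>\<^bsub>?M\<^esub> e" using v by (auto simp: corner_def)
  let ?er = "e \<otimes>\<^bsub>?M\<^esub> r" and ?es = "e \<otimes>\<^bsub>?M\<^esub> s" and ?vu = "v \<otimes>\<^bsub>?M\<^esub> u"
  note mc = KG_matrix_mult_closed
  have er: "?er \<in> carrier ?M" and es: "?es \<in> carrier ?M" using mc e r s by auto
  have uM: "u \<in> carrier ?M" and vM: "v \<in> carrier ?M" using mc er es e r s by auto
  have vuM: "?vu \<in> carrier ?M" by (rule mc[OF vM uM])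
  \<comment> \<open>Restriction is shown to be multiplicative for left factors whose arrows over X
    have both ends in F, so L contains every left factor that occurs below. The product vu is
    included so that its nonzero values over X can be read from the restriction.\<close>
  define L where "L = {e, ?er, ?es, u, v, ?vu}"
  have L: "finite L" "L \<subseteq> carrier ?M" using e er es uM vM vuM by (auto simp: L_def)
  define Z where "Z A i j = X \<inter> ran_of G ` support K G (A (i, j)) \<union> X \<inter> dom_of G ` support K G (A (i, j))"
    for A and i j :: nat
  \<comment> \<open>All ends in X of arrows from the supports of the members of L. The point x0
    makes F nonempty, since stable finiteness speaks of matrices of positive size.\<close>
  define F where "F = insert x0 (\<Union>A\<in>L. \<Union>i\<in>{..<n}. \<Union>j\<in>{..<n}. Z A i j)"
  have Z: "finite (Z A i j)" if "A \<in> L" "i < n" "j < n" for A i j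
  proof -
    have "A (i, j) \<in> carrier KG" by (rule matrix_ring_entry[OF _ that(2,3)]) (use that(1) L(2) in blast)
    from finite_closed_discrete_support[OF this closed discrete] show ?thesis by (simp only: Z_def finite_Un simp_thms)
  qed
  have F: "finite F"
    unfolding F_def by (intro finite.insertI finite_UN_I finite_lessThan L(1) Z) auto
  have x0X: "x0 \<in> X"
    unfolding X orbit_of_def using x0 G.unit_spaceD[OF x0] by blast
  have FX: "F \<subseteq> X" using x0X unfolding F_def Z_def by blast
  have in_F: "ran_of G b \<in> F" "dom_of G b \<in> F"
    if "A \<in> L" "i < n" "j < n" "b \<in> carrier G" "ran_of G b \<in> X" "A (i, j) b \<noteq> \<zero>" for A i j b
  proof -
    have b: "b \<in> support K G (A (i, j))" using that by (simp add: support_def)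
    have "dom_of G b \<in> X" using dom_in_orbit that(4,5) X by simp
    then have "ran_of G b \<in> X \<inter> ran_of G ` support K G (A (i, j))"
      "dom_of G b \<in> X \<inter> dom_of G ` support K G (A (i, j))"
      using b that(5) by auto
    then have "ran_of G b \<in> Z A i j" "dom_of G b \<in> Z A i j" unfolding Z_def by blast+
    then show "ran_of G b \<in> F" "dom_of G b \<in> F"
      unfolding F_def using that(1-3) by blast+
  qed
  have "\<exists>b. b \<in> carrier G \<and> dom_of G b = x0 \<and> ran_of G b = y" if "y \<in> F" for y
    using that FX by (auto simp: X orbit_of_def)
  then obtain \<gamma> where \<gamma>: "\<And>y. y \<in> F \<Longrightarrow> \<gamma> y \<in> carrier G \<and> dom_of G (\<gamma> y) = x0 \<and> ran_of G (\<gamma> y) = y"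
    by metis
  define N where "N = card ({..<n} \<times> F)"
  have "finite ({..<n} \<times> F)" using F by simp
  then obtain h where h: "bij_betw h {..<N} ({..<n} \<times> F)"
    using ex_bij_betw_nat_finite[of "{..<n} \<times> F"] by (auto simp: N_def lessThan_atLeast0)
  have "F \<noteq> {}" by (simp add: F_def)
  then have N: "N \<ge> 1" using n F card_gt_0_iff[of F] by (simp add: N_def card_cartesian_product Suc_le_eq)
  interpret C: orbit_chart K G T x0 \<gamma> F n N h
    by unfold_locales (use x0 \<gamma> F h in auto)
  let ?\<Phi> = C.restrict_matrix
  let ?MN = "matrix_ring N (group_algebra K (isotropy_group G x0))"
  have hom: "?\<Phi> (A \<otimes>\<^bsub>?M\<^esub> B) = ?\<Phi> A \<otimes>\<^bsub>?MN\<^esub> ?\<Phi> B" if "A \<in> L" "B \<in> carrier ?M" for A B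
    using that L(2) FX in_F(2)[OF that(1)]
    by (intro C.restrict_matrix_mult) blast+
  have in_L: "e \<in> L" "?er \<in> L" "?es \<in> L" "u \<in> L" "v \<in> L" "?vu \<in> L" by (auto simp: L_def)
  note \<Phi>c = C.restrict_matrix_closed
  have \<Phi>e: "?\<Phi> e \<otimes>\<^bsub>?MN\<^esub> ?\<Phi> e = ?\<Phi> e" using hom[OF in_L(1) e(1)] e(2) by simp
  have \<Phi>u: "?\<Phi> u \<in> corner ?MN (?\<Phi> e)"
  proof -
    have "?\<Phi> u = ?\<Phi> e \<otimes>\<^bsub>?MN\<^esub> ?\<Phi> r \<otimes>\<^bsub>?MN\<^esub> ?\<Phi> e"
      unfolding r(2) hom[OF in_L(2) e(1)] hom[OF in_L(1) r(1)] by simp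
    then show ?thesis unfolding corner_def using \<Phi>c[OF r(1)] by blast
  qed
  have \<Phi>v: "?\<Phi> v \<in> corner ?MN (?\<Phi> e)"
  proof -
    have "?\<Phi> v = ?\<Phi> e \<otimes>\<^bsub>?MN\<^esub> ?\<Phi> s \<otimes>\<^bsub>?MN\<^esub> ?\<Phi> e"
      unfolding s(2) hom[OF in_L(3) e(1)] hom[OF in_L(1) s(1)] by simp
    then show ?thesis unfolding corner_def using \<Phi>c[OF s(1)] by blast
  qed
  have "dedekind_finite ?MN" using fin N unfolding stably_finite_def by blast
  moreover have "?\<Phi> u \<otimes>\<^bsub>?MN\<^esub> ?\<Phi> v = ?\<Phi> e" using hom[OF in_L(4) vM] uv by simp
  ultimately have "?\<Phi> v \<otimes>\<^bsub>?MN\<^esub> ?\<Phi> u = ?\<Phi> e"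
    using \<Phi>c[OF e(1)] \<Phi>e \<Phi>u \<Phi>v unfolding dedekind_finite_def by blast
  then have \<Phi>vu: "?\<Phi> ?vu = ?\<Phi> e" using hom[OF in_L(5) uM] by simp
  show ?thesis
  \<comment> \<open>If one of the two values is nonzero, then both ends of a lie in F, and both
    values appear as coefficients of the restricted matrices, which agree.\<close>
  proof (cases "?vu (i, j) a = \<zero> \<and> e (i, j) a = \<zero>")
    case False
    then have "ran_of G a \<in> F \<and> dom_of G a \<in> F"
      using in_F[OF in_L(6) ij a] in_F[OF in_L(1) ij a] by blast
    then have ra: "ran_of G a \<in> F" and da: "dom_of G a \<in> F" by auto
    obtain g where g: "g \<in> carrier (isotropy_group G x0)" "a = C.arrow (ran_of G a) g (dom_of G a)"
      by (rule C.arrow_surj[OF a(1) ra da])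
    have "(i, ran_of G a) \<in> h ` {..<N}" "(j, dom_of G a) \<in> h ` {..<N}"
      using h ij ra da by (auto simp: bij_betw_def)
    then obtain p q where p: "p < N" "h p = (i, ran_of G a)" and q: "q < N" "h q = (j, dom_of G a)"
      by (metis imageE lessThan_iff)
    have "?\<Phi> A (p, q) g = A (i, j) a" for A
      using C.restrict_matrix_val[OF p(1) q(1) g(1)] p(2) q(2) g(2) by simp
    then show ?thesis using \<Phi>vu by metis
  qed simp
qed

text \<open>Density speaks of single elements of \<open>KG\<close>, so it is applied to each entry
  of vu - e; by \<open>matrix_eq_on_orbit\<close> such an entry vanishes at all arrows with range in
  the family of orbits.\<close>

theorem stably_finite_if_orbits:
  assumes "\<O> \<subseteq> orbits G"
    and closed: "\<And>X. X \<in> \<O> \<Longrightarrow> closedin (unit_topology G T) X"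
    and discrete: "\<And>X. X \<in> \<O> \<Longrightarrow> subtopology (unit_topology G T) X = discrete_topology X"
    and dense: "K_dense K G T (\<Union>\<O>)"
    and fin: "\<And>X x. X \<in> \<O> \<Longrightarrow> x \<in> X \<Longrightarrow> stably_finite (group_algebra K (isotropy_group G x))"
  shows "stably_finite KG"
  unfolding stably_finite_def dedekind_finite_def
proof (intro allI ballI impI)
  fix n :: nat and e u v
  let ?M = "matrix_ring n KG"
  assume n: "n \<ge> 1" and e: "e \<in> carrier ?M" "e \<otimes>\<^bsub>?M\<^esub> e = e"
    and u: "u \<in> corner ?M e" and v: "v \<in> corner ?M e" and uv: "u \<otimes>\<^bsub>?M\<^esub> v = e"
  have uM: "u \<in> carrier ?M" "v \<in> carrier ?M"
    using u v e(1) by (auto simp: corner_def intro!: KG_matrix_mult_closed)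
  note vu = KG_matrix_mult_closed[OF uM(2,1)]
  show "v \<otimes>\<^bsub>?M\<^esub> u = e"
  proof (rule matrix_ring_eqI[OF vu e(1)])
    fix i j assume ij: "i < n" "j < n"
    let ?f = "(v \<otimes>\<^bsub>?M\<^esub> u) (i, j)" and ?g = "e (i, j)"
    have f: "?f \<in> carrier KG" and g: "?g \<in> carrier KG"
      using matrix_ring_entry[OF vu ij] matrix_ring_entry[OF e(1) ij] by auto
    define d where "d = ?f \<oplus>\<^bsub>KG\<^esub> (\<lambda>a\<in>carrier G. \<ominus> ?g a)"
    have d: "d \<in> carrier KG" unfolding d_def by (rule KG_add_closed[OF f KG_minus_closed[OF g]])
    have d_val: "d a = ?f a \<ominus> ?g a" if "a \<in> carrier G" for a
      using that by (simp add: d_def KG_add_val a_minus_def)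
    have "d = \<zero>\<^bsub>KG\<^esub>"
    proof (rule ccontr)
      assume "d \<noteq> \<zero>\<^bsub>KG\<^esub>"
      then have "\<Union>\<O> \<inter> ran_of G ` support K G d \<noteq> {}"
        by (rule dense[unfolded K_dense_def, THEN conjunct2, rule_format, OF d])
      then obtain X a where a: "X \<in> \<O>" "ran_of G a \<in> X" "a \<in> support K G d" by blast
      have da: "a \<in> carrier G" "d a \<noteq> \<zero>" using a(3) by (simp_all add: support_def)
      obtain x0 where x0: "x0 \<in> unit_space G" "X = orbit_of G x0"
        using assms(1) a(1) by (auto simp: orbits_def)
      have "x0 \<in> X" unfolding x0(2) orbit_of_def using x0(1) G.unit_spaceD[OF x0(1)] by blast
      then have "?f a = ?g a"
        using matrix_eq_on_orbit[OF x0 closed[OF a(1)] discrete[OF a(1)] fin[OF a(1)] n e u v uv ij da(1) a(2)]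
        by simp
      then have "d a = \<zero>" using d_val[OF da(1)] KG_val[OF g da(1)] by (simp add: K.r_neg a_minus_def)
      then show False using da(2) by simp
    qed
    then have "?f a = ?g a" if "a \<in> carrier G" for a
      using d_val[OF that] KG_zero_val[OF that] KG_val[OF f that] KG_val[OF g that] K.r_right_minus_eq
      by metis
    then show "?f = ?g" by (rule KG_eqI[OF f g])
  qed
qed

end

theorem theorem4p1:
  fixes G :: "('a, 'n) groupoid_scheme" and T :: "'a topology"
    and K :: "('k, 'm) ring_scheme" and \<O> :: "'a set set"
  assumes "ample_groupoid G T"
    and "cring K"
    and "\<O> \<subseteq> orbits G"
    and "\<And>X. X \<in> \<O> \<Longrightarrow> closedin (unit_topology G T) X"
    and "\<And>X. X \<in> \<O> \<Longrightarrow> subtopology (unit_topology G T) X = discrete_topology X"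
    and "K_dense K G T (\<Union>\<O>)"
  shows "((\<forall>X \<in> \<O>. \<forall>x \<in> X. stably_finite (group_algebra K (isotropy_group G x)))
            \<longrightarrow> stably_finite (groupoid_algebra K G T)) \<and>
         (domain K \<and> char_zero K \<or> (\<forall>X \<in> \<O>. \<forall>x \<in> X. sofic (isotropy_group G x))
            \<longrightarrow> stably_finite (groupoid_algebra K G T))"
proof -
  interpret ample_groupoid_cring K G T
    using assms(1,2) by (simp add: ample_groupoid_cring_def)
  have chart: "cring_group K (isotropy_group G x)" if "X \<in> \<O>" "x \<in> X" for X x
  proof -
    have "x \<in> unit_space G" using that assms(3) by (auto simp: orbits_def orbit_of_def)
    then show ?thesis using G.group_isotropy by (simp add: cring_group_def K.is_cring)
  qed
  have main: "stably_finite (groupoid_algebra K G T)"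
    if "\<And>X x. X \<in> \<O> \<Longrightarrow> x \<in> X \<Longrightarrow> stably_finite (group_algebra K (isotropy_group G x))"
    by (rule stably_finite_if_orbits[OF assms(3-6) that])
  show ?thesis
  proof (intro conjI impI)
    assume "\<forall>X \<in> \<O>. \<forall>x \<in> X. stably_finite (group_algebra K (isotropy_group G x))"
    then show "stably_finite (groupoid_algebra K G T)" by (intro main) blast
  next
    assume "domain K \<and> char_zero K \<or> (\<forall>X \<in> \<O>. \<forall>x \<in> X. sofic (isotropy_group G x))"
    then have "stably_finite (group_algebra K (isotropy_group G x))" if "X \<in> \<O>" "x \<in> X" for X x
      using cring_group.char_zero_stably_finite[OF chart[OF that]]
        cring_group.sofic_stably_finite[OF chart[OF that]] that by blast
    then show "stably_finite (groupoid_algebra K G T)" by (rule main)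
  qed
qed

end
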